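(* Let $M$ be a holonomic $D_1$-module, and let $U_\bullet M$ be any $V_\bullet D_1$-good filtration. Then $M$ is regular at $0$ if and only if $\operatorname{rank}(\mathrm{gr}^U(M))=\operatorname{rank}(M)$.
   Context: $D_1=\mathbb{C}\langle x,\partial\rangle$ is the first Weyl algebra. For $k\in\mathbb{Z}$, $V_kD_1:=\{P\in D_1 : P(\mathbb{C}[x]x^p)\subseteq\mathbb{C}[x]x^{p-k}\text{ for all }p\in\mathbb{Z}\}$. A $V_\bullet D_1$-good filtration on $M$ is a filtration $U_\bullet M$ for which there are $m_1,\dots,m_s\in M$, generating $M$, and $k_1,\dots,k_s\in\mathbb{Z}$ with $U_kM=\sum_l V_{k-k_l}D_1\cdot m_l$ for all $k\in\mathbb{Z}$. $\mathrm{gr}^U(M)=\bigoplus_k U_kM/U_{k-1}M$ is a module over $\mathrm{gr}^VD_1\cong D_1$. The rank of a finitely generated $D_1$-module $N$ is $\dim_{\mathbb{C}(x)}(\mathbb{C}(x)\otimes_{\mathbb{C}[x]}N)$. Regular at $0$ is the standard notion of regular singularity at $0$ (including the nonsingular case): the irregularity complex of $M^{\mathrm{an}}$ at $0$, $R\mathcal{H}\mathit{om}_{\mathcal{D}_{\mathbb{C}^{\mathrm{an}}}}(M^{\mathrm{an}}( *0),\mathcal{O}_{\mathbb{C}^{\mathrm{an}}})_0$, has no cohomology; equivalently, $\mathbb{C}((x))\otimes_{\mathbb{C}[x]}M$ has a $\mathbb{C}[[x]]$-lattice stable under $x\partial$. *)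

theory Defs
  imports
    "HOL-Algebra.Free_Abelian_Groups"
    "HOL-Algebra.AbelCoset"
    "HOL-Library.Extended_Nat"
    "HOL-Computational_Algebra.Computational_Algebra"
    "Jordan_Normal_Form.VS_Connect"
begin

hide_const (open) Multiset.mult

section \<open>The first Weyl algebra\<close>

text \<open>The group ring of the integers is the ring \<open>\<complex>[x, 1/x]\<close> of Laurent polynomials,
  with \<open>x\<^sup>n = single n 1\<close>.\<close>

type_synonym laurent = "int \<Rightarrow>\<^sub>0 complex"

definition laurent_of_poly :: "complex poly \<Rightarrow> laurent" where
  "laurent_of_poly p = (\<Sum>n\<le>degree p. Poly_Mapping.single (int n) (coeff p n))"

definition const_op :: "complex \<Rightarrow> laurent \<Rightarrow> laurent" where
  "const_op c = (\<lambda>f. Poly_Mapping.single 0 c * f)"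

definition x_op :: "laurent \<Rightarrow> laurent" where
  "x_op = (\<lambda>f. Poly_Mapping.single 1 1 * f)"

definition d_op :: "laurent \<Rightarrow> laurent" where
  "d_op = (\<lambda>f. \<Sum>n\<in>Poly_Mapping.keys f.
     Poly_Mapping.single (n - 1) (of_int n * Poly_Mapping.lookup f n))"

definition poly_op :: "complex poly \<Rightarrow> laurent \<Rightarrow> laurent" where
  "poly_op p = (\<lambda>f. laurent_of_poly p * f)"

text \<open>The action of the Weyl algebra on \<open>\<complex>[x, 1/x]\<close> is faithful, so the Weyl algebra is realised as
  the algebra of operators on \<open>\<complex>[x, 1/x]\<close> generated by \<open>\<complex>\<close>, \<open>x\<close> and \<open>\<partial>\<close>.\<close>

inductive_set weyl_ops :: "(laurent \<Rightarrow> laurent) set" where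
  const: "const_op c \<in> weyl_ops"
| x: "x_op \<in> weyl_ops"
| d: "d_op \<in> weyl_ops"
| add: "P \<in> weyl_ops \<Longrightarrow> Q \<in> weyl_ops \<Longrightarrow> (\<lambda>f. P f + Q f) \<in> weyl_ops"
| comp: "P \<in> weyl_ops \<Longrightarrow> Q \<in> weyl_ops \<Longrightarrow> P \<circ> Q \<in> weyl_ops"

definition weyl :: "(laurent \<Rightarrow> laurent) ring" where
  "weyl = \<lparr>carrier = weyl_ops, mult = (\<circ>), one = id, zero = (\<lambda>f. 0), add = (\<lambda>P Q f. P f + Q f)\<rparr>"

text \<open>\<open>x_ideal p\<close> is \<open>\<complex>[x] x\<^sup>p\<close>, for an arbitrary integer \<open>p\<close>.\<close>

definition x_ideal :: "int \<Rightarrow> laurent set" where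
  "x_ideal p = {laurent_of_poly q * Poly_Mapping.single p 1 | q. True}"

definition V_weyl :: "int \<Rightarrow> (laurent \<Rightarrow> laurent) set" where
  "V_weyl k = {P \<in> carrier weyl. \<forall>p. P ` x_ideal p \<subseteq> x_ideal (p - k)}"


section \<open>Modules over the Weyl algebra\<close>

text \<open>The locale \<^locale>\<open>module\<close> of the library requires a commutative ring of scalars.\<close>

locale left_module = R?: ring R + M?: abelian_group M
  for R :: "('a, 'b) ring_scheme" (structure) and M :: "('a, 'm, 'c) module_scheme" (structure) +
  assumes smult_closed: "a \<in> carrier R \<Longrightarrow> x \<in> carrier M \<Longrightarrow> a \<odot>\<^bsub>M\<^esub> x \<in> carrier M"
    and smult_l_distr: "a \<in> carrier R \<Longrightarrow> b \<in> carrier R \<Longrightarrow> x \<in> carrier M \<Longrightarrow>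
      (a \<oplus>\<^bsub>R\<^esub> b) \<odot>\<^bsub>M\<^esub> x = a \<odot>\<^bsub>M\<^esub> x \<oplus>\<^bsub>M\<^esub> b \<odot>\<^bsub>M\<^esub> x"
    and smult_r_distr: "a \<in> carrier R \<Longrightarrow> x \<in> carrier M \<Longrightarrow> y \<in> carrier M \<Longrightarrow>
      a \<odot>\<^bsub>M\<^esub> (x \<oplus>\<^bsub>M\<^esub> y) = a \<odot>\<^bsub>M\<^esub> x \<oplus>\<^bsub>M\<^esub> a \<odot>\<^bsub>M\<^esub> y"
    and smult_assoc: "a \<in> carrier R \<Longrightarrow> b \<in> carrier R \<Longrightarrow> x \<in> carrier M \<Longrightarrow>
      (a \<otimes>\<^bsub>R\<^esub> b) \<odot>\<^bsub>M\<^esub> x = a \<odot>\<^bsub>M\<^esub> (b \<odot>\<^bsub>M\<^esub> x)"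
    and smult_one: "x \<in> carrier M \<Longrightarrow> \<one>\<^bsub>R\<^esub> \<odot>\<^bsub>M\<^esub> x = x"

type_synonym 'm weyl_module = "(laurent \<Rightarrow> laurent, 'm) module"

definition restrict_scalars :: "('a \<Rightarrow> 'b) \<Rightarrow> ('b, 'm) module \<Rightarrow> ('a, 'm) module" where
  "restrict_scalars \<phi> M = \<lparr>carrier = carrier M, mult = mult M, one = one M, zero = zero M,
     add = add M, smult = (\<lambda>a x. \<phi> a \<odot>\<^bsub>M\<^esub> x)\<rparr>"

text \<open>\<open>op_sums M s m W\<close> is \<open>W\<^sub>0 m\<^sub>0 + \<dots> + W\<^sub>r m\<^sub>r\<close>, where \<open>r = s - 1\<close>.\<close>

definition op_sums ::
  "'m weyl_module \<Rightarrow> nat \<Rightarrow> (nat \<Rightarrow> 'm) \<Rightarrow> (nat \<Rightarrow> (laurent \<Rightarrow> laurent) set) \<Rightarrow> 'm set" where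
  "op_sums M s m W = {(\<Oplus>\<^bsub>M\<^esub> l\<in>{..<s}. P l \<odot>\<^bsub>M\<^esub> m l) | P. \<forall>l<s. P l \<in> W l}"

definition generates :: "'m weyl_module \<Rightarrow> nat \<Rightarrow> (nat \<Rightarrow> 'm) \<Rightarrow> bool" where
  "generates M s m \<longleftrightarrow>
     (\<forall>l<s. m l \<in> carrier M) \<and> op_sums M s m (\<lambda>_. carrier weyl) = carrier M"


section \<open>Holonomic modules\<close>

text \<open>The Bernstein filtration: \<open>bernstein k\<close> is the span over \<open>\<complex>\<close> of the \<open>x\<^sup>a \<partial>\<^sup>b\<close> with
  \<open>a + b \<le> k\<close>.\<close>

definition bernstein :: "nat \<Rightarrow> (laurent \<Rightarrow> laurent) set" where
  "bernstein k =
     {(\<lambda>f. \<Sum>a\<le>k. \<Sum>b\<le>k - a. const_op (c a b) ((x_op ^^ a) ((d_op ^^ b) f))) | c. True}"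

text \<open>The dimension \<open>d(M)\<close> of a nonzero finitely generated module is the degree of the Hilbert
  polynomial of the filtration \<open>k \<mapsto> bernstein k \<cdot> m\<^sub>0 + \<dots>\<close> attached to some (equivalently, any)
  finite generating family.\<close>

definition has_bernstein_dim :: "'m weyl_module \<Rightarrow> nat \<Rightarrow> bool" where
  "has_bernstein_dim M d \<longleftrightarrow>
     (\<exists>s m (h :: rat poly). generates M s m \<and> degree h = d \<and>
        (\<forall>\<^sub>F k in sequentially.
           of_nat (vectorspace.dim class_ring
             ((restrict_scalars const_op M)\<lparr>carrier := op_sums M s m (\<lambda>_. bernstein k)\<rparr>))
           = poly h (of_nat k)))"

definition holonomic :: "'m weyl_module \<Rightarrow> bool" where
  "holonomic M \<longleftrightarrow>
     left_module weyl M \<and> (carrier M = {\<zero>\<^bsub>M\<^esub>} \<or> has_bernstein_dim M 1)"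


section \<open>Good V-filtrations and the associated graded module\<close>

definition V_good_filtration :: "'m weyl_module \<Rightarrow> (int \<Rightarrow> 'm set) \<Rightarrow> bool" where
  "V_good_filtration M U \<longleftrightarrow>
     (\<exists>s m (e :: nat \<Rightarrow> int). generates M s m \<and>
        (\<forall>k. U k = op_sums M s m (\<lambda>l. V_weyl (k - e l))))"

text \<open>The component of \<open>P\<close> that is homogeneous of V-degree \<open>k\<close>, i.e. maps each \<open>x\<^sup>n\<close> to a multiple
  of \<open>x\<^bsup>n - k\<^esup>\<close>. An operator is the finite sum of its components; sending \<open>P\<close> to the family of the
  classes of \<open>hcomp k P\<close> in \<open>V\<^sub>k / V\<^bsub>k - 1\<^esub>\<close> is the isomorphism from the Weyl algebra to its
  associated graded ring.\<close>

definition hcomp :: "int \<Rightarrow> (laurent \<Rightarrow> laurent) \<Rightarrow> laurent \<Rightarrow> laurent" where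
  "hcomp k P = (\<lambda>f. \<Sum>n\<in>Poly_Mapping.keys f.
     Poly_Mapping.single (n - k)
       (Poly_Mapping.lookup (P (Poly_Mapping.single n 1)) (n - k) * Poly_Mapping.lookup f n))"

text \<open>Elements of \<open>\<Oplus>\<^sub>k U\<^sub>k / U\<^bsub>k - 1\<^esub>\<close> are families of cosets, almost all of them trivial. The
  action of the associated graded ring, \<open>[P] [w] = [P w]\<close>, is transported along the
  isomorphism above; the union over representatives \<open>w\<close> is a union of equal cosets.\<close>

definition gr :: "'m weyl_module \<Rightarrow> (int \<Rightarrow> 'm set) \<Rightarrow> (int \<Rightarrow> 'm set) weyl_module" where
  "gr M U = \<lparr>
     carrier = {u. (\<forall>k. u k \<in> (\<lambda>w. U (k - 1) +>\<^bsub>M\<^esub> w) ` U k) \<and> finite {k. u k \<noteq> U (k - 1)}},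
     mult = undefined, one = undefined,
     zero = (\<lambda>k. U (k - 1)),
     add = (\<lambda>u v k. u k <+>\<^bsub>M\<^esub> v k),
     smult = (\<lambda>P u j. \<Union>w\<in>{w. \<forall>k. w k \<in> u (j - k)}.
       U (j - 1) +>\<^bsub>M\<^esub> (\<Oplus>\<^bsub>M\<^esub> k\<in>{k. hcomp k P \<noteq> \<zero>\<^bsub>weyl\<^esub>}. hcomp k P \<odot>\<^bsub>M\<^esub> w k))\<rparr>"


section \<open>Extension of scalars from the polynomial ring\<close>

text \<open>For a commutative ring \<open>A\<close>, viewed as an algebra over \<open>\<complex>[x]\<close> through \<open>\<phi>\<close>, and a module \<open>N\<close>
  over \<open>\<complex>[x]\<close>, the tensor product of \<open>A\<close> and \<open>N\<close> over \<open>\<complex>[x]\<close> is the free abelian group on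
  \<open>A \<times> N\<close> modulo the subgroup \<open>tensor_null\<close> generated by the usual relations.\<close>

definition tensor_free :: "('b, 'n) module \<Rightarrow> ('a \<times> 'n \<Rightarrow>\<^sub>0 int) monoid" where
  "tensor_free N = free_Abelian_group (UNIV \<times> carrier N)"

definition tensor_null ::
  "(complex poly \<Rightarrow> 'a::comm_ring_1) \<Rightarrow> (complex poly, 'n) module \<Rightarrow> ('a \<times> 'n \<Rightarrow>\<^sub>0 int) set" where
  "tensor_null \<phi> N = generate (tensor_free N)
     ({frag_of (a + b, n) - frag_of (a, n) - frag_of (b, n) | a b n. n \<in> carrier N} \<union>
      {frag_of (a, n \<oplus>\<^bsub>N\<^esub> n') - frag_of (a, n) - frag_of (a, n') | a n n'.
         n \<in> carrier N \<and> n' \<in> carrier N} \<union>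
      {frag_of (a * \<phi> p, n) - frag_of (a, p \<odot>\<^bsub>N\<^esub> n) | a p n. n \<in> carrier N})"

text \<open>The map on the tensor product induced by an additive map of the free group that is given on
  the generators by \<open>g\<close> (and preserves the relations).\<close>

definition tensor_map ::
  "(complex poly \<Rightarrow> 'a::comm_ring_1) \<Rightarrow> (complex poly, 'n) module \<Rightarrow>
   ('a \<times> 'n \<Rightarrow> ('a \<times> 'n \<Rightarrow>\<^sub>0 int)) \<Rightarrow> ('a \<times> 'n \<Rightarrow>\<^sub>0 int) set \<Rightarrow> ('a \<times> 'n \<Rightarrow>\<^sub>0 int) set" where
  "tensor_map \<phi> N g X = (\<Union>c\<in>X. tensor_null \<phi> N #>\<^bsub>tensor_free N\<^esub> frag_extend g c)"

definition tensor ::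
  "(complex poly \<Rightarrow> 'a::comm_ring_1) \<Rightarrow> (complex poly, 'n) module \<Rightarrow>
   ('a, ('a \<times> 'n \<Rightarrow>\<^sub>0 int) set) module" where
  "tensor \<phi> N = (let T = tensor_free N Mod tensor_null \<phi> N in
     \<lparr>carrier = carrier T, mult = undefined, one = undefined,
      zero = \<one>\<^bsub>T\<^esub>, add = mult T,
      smult = (\<lambda>a. tensor_map \<phi> N (\<lambda>(b, n). frag_of (a * b, n)))\<rparr>)"


section \<open>Rank and regularity at the origin\<close>

definition rational_extension ::
  "'m weyl_module \<Rightarrow> (complex poly fract, (complex poly fract \<times> 'm \<Rightarrow>\<^sub>0 int) set) module" where
  "rational_extension M = tensor to_fract (restrict_scalars poly_op M)"

text \<open>For modules that are not holonomic the rank may be infinite.\<close>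

definition rank :: "'m weyl_module \<Rightarrow> enat" where
  "rank M =
     (if vectorspace.fin_dim class_ring (rational_extension M)
      then enat (vectorspace.dim class_ring (rational_extension M)) else \<infinity>)"

definition laurent_extension ::
  "'m weyl_module \<Rightarrow> (complex fls, (complex fls \<times> 'm \<Rightarrow>\<^sub>0 int) set) module" where
  "laurent_extension M = tensor (\<lambda>p. fps_to_fls (fps_of_poly p)) (restrict_scalars poly_op M)"

text \<open>The operator \<open>x\<partial>\<close> acts on \<open>\<complex>((x)) \<otimes> M\<close> by the Leibniz rule.\<close>

definition laurent_euler ::
  "'m weyl_module \<Rightarrow> (complex fls \<times> 'm \<Rightarrow>\<^sub>0 int) set \<Rightarrow> (complex fls \<times> 'm \<Rightarrow>\<^sub>0 int) set" where
  "laurent_euler M =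
     tensor_map (\<lambda>p. fps_to_fls (fps_of_poly p)) (restrict_scalars poly_op M)
       (\<lambda>(f, m). frag_of (fls_X * fls_deriv f, m) + frag_of (f, (x_op \<circ> d_op) \<odot>\<^bsub>M\<^esub> m))"

text \<open>A lattice is a finitely generated submodule over \<open>\<complex>[[x]]\<close> that spans over \<open>\<complex>((x))\<close>.\<close>

definition lattice_in :: "(complex fls, 't) module \<Rightarrow> 't set \<Rightarrow> bool" where
  "lattice_in T L \<longleftrightarrow>
     (\<exists>A. finite A \<and> A \<subseteq> carrier T \<and>
        L = LinearCombinations.module.span (class_ring :: complex fps ring)
              (restrict_scalars fps_to_fls T) A) \<and>
     LinearCombinations.module.span class_ring T L = carrier T"

definition regular_at_0 :: "'m weyl_module \<Rightarrow> bool" where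
  "regular_at_0 M \<longleftrightarrow>
     (\<exists>L. lattice_in (laurent_extension M) L \<and> laurent_euler M ` L \<subseteq> L)"

end

theory Submission
  imports Defs
begin

text \<open>
Let \<open>n\<close> be the rank of \<open>M\<close>. For all sufficiently small \<open>k\<close> one has \<open>U\<^bsub>k-1\<^esub> = x U\<^sub>k\<close>; fix such a \<open>k\<close> and let \<open>W\<close> be the
image of \<open>U\<^sub>k\<close> in \<open>\<complex>(x) \<otimes> M = \<complex>(x)\<^sup>n\<close>. Inverting \<open>x\<close> turns \<open>gr\<^sup>U(M)\<close> into \<open>\<complex>[x, 1/x] \<otimes> W/xW\<close>, so the rank
of \<open>gr\<^sup>U(M)\<close> is \<open>dim W/xW\<close>. This is at most \<open>n\<close>: a linear relation over \<open>\<complex>[x]\<close> with coefficients that are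
not all divisible by \<open>x\<close> gives a nontrivial relation modulo \<open>xW\<close>.

If \<open>dim W/xW = n\<close>, then lifts of a basis generate \<open>W\<close> over the local ring \<open>\<complex>[x]\<^sub>(\<^sub>0\<^sub>)\<close>, so \<open>\<complex>[[x]] W\<close> is a lattice,
and it is stable under \<open>x\<partial>\<close> because \<open>U\<^sub>k\<close> is. Conversely, a suitable multiple \<open>x\<^bsup>-d\<^esup>L\<close> of a stable lattice \<open>L\<close> contains
the generators of the filtration, hence the module that they generate over \<open>V\<^sub>0 = \<complex>[x]\<langle>x\<partial>\<rangle>\<close>, hence \<open>W\<close>.
Thus \<open>W \<subseteq> x\<^bsup>-e\<^esup>\<complex>[[x]]\<^sup>n\<close> for some \<open>e\<close>, and the growth of \<open>dim W/x\<^sup>jW \<le> j dim W/xW\<close> in \<open>j\<close> forces \<open>dim W/xW \<ge> n\<close>.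

Holonomicity enters only through the finiteness of \<open>n\<close>: a Hilbert polynomial of degree 1 bounds the number of
elements of \<open>M\<close> that are independent over \<open>\<complex>[x]\<close>.
\<close>

section \<open>Linear algebra over the rational functions\<close>

text \<open>If \<open>M\<close> is generated by \<open>m\<close> with
  \<open>x \<theta> m = m\<close>, for instance, then \<open>\<theta>\<close> divides by
  \<open>x\<close>, hence \<open>W = \<complex>[x, 1/x]\<close> and \<open>W/xW = 0\<close> although
  \<open>n = 1\<close>. Nakayama is replaced by dimension counts, that is, by linear systems with
  more unknowns than equations.

  \<open>M\<close> may have torsion over \<open>\<complex>[x]\<close>, which \<open>W\<close> does
  not see. It does no harm: if \<open>p t = 0\<close> and \<open>x\<^sup>d\<close> is the power of
  \<open>x\<close> in \<open>p\<close>, then \<open>x\<^sup>d t\<close> is a polynomial multiple of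
  \<open>x ^ (d + 1) t\<close>, so \<open>x\<^sup>d\<close> kills the class of \<open>t\<close> in
  the associated graded module.

  The extensions of \<open>M\<close> to \<open>\<complex>(x)\<close> and
  \<open>\<complex>((x))\<close> are handled in coordinates: fractions solving
  \<open>p u = q\<^sub>0 b\<^sub>0 + ...\<close> inside \<open>M\<close>, and their expansions at 0.
  The level \<open>k\<close> is the minimum of 0 and the degrees of the generators, because
  \<open>V_weyl (k - 1) = x V_weyl k\<close> for \<open>k \<le> 0\<close>.\<close>

lemma common_bound:
  fixes P :: "'i \<Rightarrow> 'k::linorder \<Rightarrow> bool"
  assumes "finite I" "\<And>i. i \<in> I \<Longrightarrow> \<exists>k. P i k" "\<And>i k k'. P i k \<Longrightarrow> k \<le> k' \<Longrightarrow> P i k'"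
  shows "\<exists>k. \<forall>i\<in>I. P i k"
  using assms(1,2)
proof (induction I rule: finite_induct)
  case (insert i I)
  then obtain k k' where "P i k" "\<forall>j\<in>I. P j k'" by blast
  then have "\<forall>j\<in>insert i I. P j (max k k')" by (auto intro: assms(3))
  then show ?case ..
qed simp

text \<open>Gaussian elimination, one equation at a time: a nonzero coefficient
  \<open>\<kappa> i j0\<close> of the new equation eliminates the unknown \<open>j0\<close>, and
  \<open>\<mu>\<close> holds the coefficients of the other equations after the substitution.\<close>

lemma homogeneous_system:
  fixes \<kappa> :: "'i \<Rightarrow> 'j \<Rightarrow> 'a::field"
  assumes "finite I" "finite J" "card I < card J"
  shows "\<exists>z. (\<exists>j\<in>J. z j \<noteq> 0) \<and> (\<forall>i\<in>I. (\<Sum>j\<in>J. \<kappa> i j * z j) = 0)"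
  using assms
proof (induction I arbitrary: J \<kappa> rule: finite_induct)
  case empty
  then have "J \<noteq> {}" by auto
  then show ?case by (intro exI[of _ "\<lambda>_. 1"]) auto
next
  case (insert i I)
  show ?case
  proof (cases "\<forall>j\<in>J. \<kappa> i j = 0")
    case True
    from insert.IH[of J \<kappa>] insert.prems insert.hyps obtain z
      where "\<exists>j\<in>J. z j \<noteq> 0" "\<forall>i\<in>I. (\<Sum>j\<in>J. \<kappa> i j * z j) = 0"
      by auto
    with True show ?thesis by (intro exI[of _ z]) auto
  next
    case False
    then obtain j0 where j0: "j0 \<in> J" "\<kappa> i j0 \<noteq> 0" by blast
    define \<mu> where "\<mu> = (\<lambda>i' j. \<kappa> i' j - \<kappa> i' j0 * \<kappa> i j / \<kappa> i j0)"
    have "card I < card (J - {j0})"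
      using insert.prems insert.hyps j0 by (simp add: card_Diff_singleton_if)
    with insert.IH[of "J - {j0}" \<mu>] insert.prems obtain z
      where z: "\<exists>j\<in>J - {j0}. z j \<noteq> 0" "\<forall>i\<in>I. (\<Sum>j\<in>J - {j0}. \<mu> i j * z j) = 0"
      by auto
    define s where "s = (\<Sum>j\<in>J - {j0}. \<kappa> i j * z j)"
    define z' where "z' = z(j0 := - s / \<kappa> i j0)"
    have split: "(\<Sum>j\<in>J. \<kappa> i' j * z' j) = (\<Sum>j\<in>J - {j0}. \<kappa> i' j * z j) - \<kappa> i' j0 * s / \<kappa> i j0" for i'
    proof -
      have "(\<Sum>j\<in>J. \<kappa> i' j * z' j) = \<kappa> i' j0 * z' j0 + (\<Sum>j\<in>J - {j0}. \<kappa> i' j * z' j)"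
        using insert.prems j0 by (intro sum.remove) auto
      also have "(\<Sum>j\<in>J - {j0}. \<kappa> i' j * z' j) = (\<Sum>j\<in>J - {j0}. \<kappa> i' j * z j)"
        by (intro sum.cong) (auto simp: z'_def)
      finally show ?thesis by (simp add: z'_def)
    qed
    have "(\<Sum>j\<in>J. \<kappa> i j * z' j) = 0"
      unfolding split using j0 by (simp add: s_def)
    moreover have "(\<Sum>j\<in>J. \<kappa> i' j * z' j) = 0" if "i' \<in> I" for i'
    proof -
      have "0 = (\<Sum>j\<in>J - {j0}. \<mu> i' j * z j)" using z that by simp
      also have "\<dots> = (\<Sum>j\<in>J - {j0}. \<kappa> i' j * z j - \<kappa> i' j0 / \<kappa> i j0 * (\<kappa> i j * z j))"
        by (intro sum.cong) (auto simp: \<mu>_def algebra_simps)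
      also have "\<dots> = (\<Sum>j\<in>J - {j0}. \<kappa> i' j * z j) - \<kappa> i' j0 / \<kappa> i j0 * s"
        by (simp add: sum_subtractf s_def sum_distrib_left)
      finally show ?thesis unfolding split by simp
    qed
    moreover have "\<exists>j\<in>J. z' j \<noteq> 0" using z by (auto simp: z'_def)
    ultimately show ?thesis by blast
  qed
qed

section \<open>Relations over the rational functions, normalised at the origin\<close>

abbreviation poly_X :: "complex poly" where "poly_X \<equiv> [:0, 1:]"

lemma common_denominator:
  fixes z :: "'j \<Rightarrow> complex poly fract"
  assumes "finite J"
  shows "\<exists>d p. d \<noteq> 0 \<and> (\<forall>j\<in>J. to_fract d * z j = to_fract (p j))"
  using assms
proof (induction J rule: finite_induct)
  case empty
  then show ?case by (intro exI[of _ 1]) auto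
next
  case (insert j J)
  then obtain d p where dp: "d \<noteq> 0" "\<forall>j\<in>J. to_fract d * z j = to_fract (p j)" by blast
  obtain a b where ab: "z j = Fract a b" "b \<noteq> 0" by (cases "z j") auto
  have "to_fract b * z j = to_fract a" using ab by (simp add: to_fract_def eq_fract)
  then have "to_fract (d * b) * z j = to_fract (d * a)"
    by (simp add: mult.assoc)
  moreover have "to_fract (d * b) * z i = to_fract (b * p i)" if "i \<in> J" for i
  proof -
    have "to_fract (d * b) * z i = to_fract b * (to_fract d * z i)" by (simp add: mult_ac)
    then show ?thesis using dp that by simp
  qed
  ultimately have "\<forall>i\<in>insert j J. to_fract (d * b) * z i = to_fract (if i = j then d * a else b * p i)"
    by auto
  then show ?case using dp ab by (intro exI[of _ "d * b"] exI[of _ "\<lambda>i. if i = j then d * a else b * p i"]) auto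
qed

text \<open>The common factor \<open>x\<close> is cancelled until some constant term survives. The
  degree of one fixed nonzero member drops with each division, so the process stops.\<close>

lemma divide_power_X:
  fixes p :: "'j \<Rightarrow> complex poly"
  assumes "finite J" "j \<in> J" "p j \<noteq> 0"
  shows "\<exists>m q. (\<forall>j\<in>J. p j = poly_X ^ m * q j) \<and> (\<exists>j\<in>J. poly (q j) 0 \<noteq> 0)"
  using assms(2,3)
proof (induction "degree (p j)" arbitrary: p rule: less_induct)
  case less
  show ?case
  proof (cases "\<exists>j\<in>J. poly (p j) 0 \<noteq> 0")
    case True
    then show ?thesis by (intro exI[of _ 0] exI[of _ p]) auto
  next
    case False
    then have "\<forall>i\<in>J. \<exists>q. p i = poly_X * q" by (auto simp: poly_eq_0_iff_dvd dvd_def)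
    then obtain q where q: "\<forall>i\<in>J. p i = poly_X * q i" by metis
    have nz: "q j \<noteq> 0" using q less.prems by auto
    have "degree (q j) < degree (p j)"
      using nz q less.prems by (auto simp: degree_mult_eq)
    from less.hyps[of q, OF this less.prems(1) nz] obtain m r
      where "\<forall>j\<in>J. q j = poly_X ^ m * r j" "\<exists>j\<in>J. poly (r j) 0 \<noteq> 0" by blast
    then show ?thesis using q by (intro exI[of _ "Suc m"] exI[of _ r]) auto
  qed
qed

text \<open>A dependence over \<open>\<complex>(x)\<close> is cleared of denominators and of the
  common power of \<open>x\<close>. The surviving constant term is what later turns a relation over
  \<open>\<complex>[x]\<close> into a nontrivial relation over \<open>\<complex>\<close> modulo
  \<open>xW\<close>.\<close>

lemma polynomial_relation:
  fixes w :: "'j \<Rightarrow> nat \<Rightarrow> complex poly fract"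
  assumes "finite J" "n < card J"
  shows "\<exists>p. (\<exists>j\<in>J. poly (p j) 0 \<noteq> 0) \<and> (\<forall>i<n. (\<Sum>j\<in>J. to_fract (p j) * w j i) = 0)"
proof -
  obtain z where z: "\<exists>j\<in>J. z j \<noteq> 0" "\<forall>i\<in>{..<n}. (\<Sum>j\<in>J. w j i * z j) = 0"
    using homogeneous_system[of "{..<n}" J "\<lambda>i j. w j i"] assms by auto
  obtain d p where dp: "d \<noteq> 0" "\<forall>j\<in>J. to_fract d * z j = to_fract (p j)"
    using common_denominator[OF assms(1), of z] by blast
  from z(1) obtain j where j: "j \<in> J" "z j \<noteq> 0" by blast
  then have "p j \<noteq> 0" using dp by force
  from divide_power_X[of J j p] j assms(1) this obtain m q
    where q: "\<forall>j\<in>J. p j = poly_X ^ m * q j" "\<exists>j\<in>J. poly (q j) 0 \<noteq> 0" by blast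
  have "(\<Sum>j\<in>J. to_fract (q j) * w j i) = 0" if "i < n" for i
  proof -
    have "to_fract (poly_X ^ m) * (\<Sum>j\<in>J. to_fract (q j) * w j i) = (\<Sum>j\<in>J. to_fract (p j) * w j i)"
      unfolding sum_distrib_left by (intro sum.cong) (auto simp: q)
    also have "\<dots> = (\<Sum>j\<in>J. to_fract d * (w j i * z j))"
      by (intro sum.cong) (auto simp: mult.assoc mult.commute dp(2)[rule_format, symmetric])
    also have "\<dots> = 0" using z(2) that by (simp flip: sum_distrib_left)
    finally show ?thesis by simp
  qed
  with q show ?thesis by blast
qed

subsection \<open>Extension of embeddings to the field of fractions\<close>

text \<open>All fractions representing \<open>z\<close> give the same value, by cross
  multiplication, if \<open>\<phi>\<close> is an embedding. The two instances are
  \<open>to_fract\<close> and the expansion of a polynomial as a Laurent series; thus the same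
  rational coordinates serve for both extensions of scalars.\<close>

definition fract_ext :: "(complex poly \<Rightarrow> 'a::field) \<Rightarrow> complex poly fract \<Rightarrow> 'a" where
  "fract_ext \<phi> z = (SOME r. \<exists>p q. q \<noteq> 0 \<and> to_fract q * z = to_fract p \<and> r = \<phi> p / \<phi> q)"

lemma fractE:
  fixes z :: "complex poly fract"
  obtains p q where "q \<noteq> 0" "to_fract q * z = to_fract p"
proof -
  obtain a b where "z = Fract a b" "b \<noteq> 0" by (cases z) auto
  then show ?thesis by (intro that[of b a]) (auto simp: to_fract_def eq_fract)
qed

locale poly_embedding =
  fixes \<phi> :: "complex poly \<Rightarrow> 'a::field"
  assumes hom_add: "\<phi> (p + q) = \<phi> p + \<phi> q"
    and hom_mult: "\<phi> (p * q) = \<phi> p * \<phi> q"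
    and hom_one: "\<phi> 1 = 1"
    and hom_inj: "\<phi> p = 0 \<Longrightarrow> p = 0"
begin

lemma hom_zero: "\<phi> 0 = 0"
proof -
  have "\<phi> 0 + \<phi> 0 = \<phi> 0 + 0" using hom_add[of 0 0] by simp
  then show ?thesis by (simp only: add_left_cancel)
qed

lemma hom_eq_0_iff: "\<phi> p = 0 \<longleftrightarrow> p = 0"
  using hom_inj hom_zero by auto

lemma ext_eqI:
  assumes "q \<noteq> 0" "to_fract q * z = to_fract p"
  shows "fract_ext \<phi> z = \<phi> p / \<phi> q"
proof -
  let ?P = "\<lambda>r. \<exists>p q. q \<noteq> 0 \<and> to_fract q * z = to_fract p \<and> r = \<phi> p / \<phi> q"
  have "?P (\<phi> p / \<phi> q)" using assms by blast
  then have "?P (fract_ext \<phi> z)" unfolding fract_ext_def by (rule someI)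
  then obtain a b where ab: "b \<noteq> 0" "to_fract b * z = to_fract a" "fract_ext \<phi> z = \<phi> a / \<phi> b"
    by blast
  have "to_fract (q * a) = to_fract (p * b)"
    unfolding to_fract_mult ab(2)[symmetric] assms(2)[symmetric] by (simp add: mult_ac)
  then have "q * a = p * b" by (simp only: to_fract_eq_iff)
  then have "\<phi> q * \<phi> a = \<phi> p * \<phi> b" by (metis hom_mult)
  then show ?thesis
    using assms(1) ab by (simp add: frac_eq_eq hom_eq_0_iff mult.commute)
qed

lemma ext_to_fract [simp]: "fract_ext \<phi> (to_fract p) = \<phi> p"
  using ext_eqI[of 1 "to_fract p" p] by (simp add: hom_one)

lemma ext_add [simp]: "fract_ext \<phi> (z + w) = fract_ext \<phi> z + fract_ext \<phi> w"
proof -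
  obtain p q where pq: "q \<noteq> 0" "to_fract q * z = to_fract p" by (rule fractE)
  obtain p' q' where pq': "q' \<noteq> 0" "to_fract q' * w = to_fract p'" by (rule fractE)
  have "to_fract (q * q') * (z + w) = to_fract (q' * p + q * p')"
    unfolding to_fract_mult to_fract_add pq(2)[symmetric] pq'(2)[symmetric] by (simp add: algebra_simps)
  then have "fract_ext \<phi> (z + w) = \<phi> (q' * p + q * p') / \<phi> (q * q')"
    using pq pq' by (intro ext_eqI) auto
  then show ?thesis
    using pq pq' ext_eqI[OF pq] ext_eqI[OF pq'] by (simp add: hom_add hom_mult hom_eq_0_iff add_frac_eq)
qed

lemma ext_mult [simp]: "fract_ext \<phi> (z * w) = fract_ext \<phi> z * fract_ext \<phi> w"
proof -
  obtain p q where pq: "q \<noteq> 0" "to_fract q * z = to_fract p" by (rule fractE)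
  obtain p' q' where pq': "q' \<noteq> 0" "to_fract q' * w = to_fract p'" by (rule fractE)
  have "to_fract (q * q') * (z * w) = to_fract (p * p')"
    unfolding to_fract_mult pq(2)[symmetric] pq'(2)[symmetric] by (simp add: algebra_simps)
  then have "fract_ext \<phi> (z * w) = \<phi> (p * p') / \<phi> (q * q')"
    using pq pq' by (intro ext_eqI) auto
  then show ?thesis
    using ext_eqI[OF pq] ext_eqI[OF pq'] by (simp add: hom_mult)
qed

lemma ext_0 [simp]: "fract_ext \<phi> 0 = 0"
  using ext_to_fract[of 0] by (simp add: hom_zero)

lemma ext_1 [simp]: "fract_ext \<phi> 1 = 1"
  using ext_to_fract[of 1] by (simp add: hom_one)

lemma ext_sum: "fract_ext \<phi> (sum f A) = (\<Sum>a\<in>A. fract_ext \<phi> (f a))"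
  by (induction A rule: infinite_finite_induct) auto

lemma ext_eq_0_iff: "fract_ext \<phi> z = 0 \<longleftrightarrow> z = 0"
proof -
  obtain p q where pq: "q \<noteq> 0" "to_fract q * z = to_fract p" by (rule fractE)
  show ?thesis
    using ext_eqI[OF pq] pq by (auto simp: hom_eq_0_iff)
qed

end

interpretation rat: poly_embedding to_fract
  by unfold_locales auto

interpretation laur: poly_embedding "\<lambda>p. fps_to_fls (fps_of_poly p) :: complex fls"
  by unfold_locales (auto simp: fps_of_poly_add fps_of_poly_mult fls_times_fps_to_fls)

abbreviation to_laurent :: "complex poly fract \<Rightarrow> complex fls" where
  "to_laurent \<equiv> fract_ext (\<lambda>p. fps_to_fls (fps_of_poly p))"


lemma to_laurent_X: "to_laurent (to_fract (poly_X ^ m)) = fls_X_intpow (int m)"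
  unfolding laur.ext_to_fract
  by (simp add: fps_of_poly_power fls_X_power_conv_shift_1 fps_to_fls_power fps_of_poly_pCons)

subsection \<open>Submodules of rational vectors and their reduction modulo the variable\<close>

abbreviation cst :: "complex \<Rightarrow> complex poly fract" where "cst c \<equiv> to_fract [:c:]"

abbreviation rat_X :: "complex poly fract" where "rat_X \<equiv> to_fract poly_X"

lemma rat_X_power: "rat_X ^ m = to_fract (poly_X ^ m)"
  by (induction m) (simp_all only: power_0 power_Suc to_fract_1 to_fract_mult)

text \<open>A \<open>\<complex>[x]\<close>-submodule of \<open>\<complex>(x)\<^sup>n\<close>, with
  vectors encoded as functions that vanish from \<open>n\<close> on. Finite generation is
  deliberately absent: it fails for the intended \<open>W\<close> in the irregular case.\<close>

locale rational_submodule =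
  fixes W :: "(nat \<Rightarrow> complex poly fract) set" and n :: nat
  assumes zero_mem: "(\<lambda>_. 0) \<in> W"
    and add_mem: "v \<in> W \<Longrightarrow> w \<in> W \<Longrightarrow> (\<lambda>i. v i + w i) \<in> W"
    and smult_mem: "w \<in> W \<Longrightarrow> (\<lambda>i. to_fract p * w i) \<in> W"
    and support: "w \<in> W \<Longrightarrow> n \<le> i \<Longrightarrow> w i = 0"
begin

lemma sum_mem:
  assumes "\<And>j. j \<in> J \<Longrightarrow> w j \<in> W"
  shows "(\<lambda>i. \<Sum>j\<in>J. to_fract (p j) * w j i) \<in> W"
  using assms
proof (induction J rule: infinite_finite_induct)
  case (insert j J)
  then show ?case using add_mem[OF smult_mem[of "w j" "p j"], of "\<lambda>i. \<Sum>j\<in>J. to_fract (p j) * w j i"] by auto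
qed (auto simp: zero_mem)

lemma uminus_mem: "w \<in> W \<Longrightarrow> (\<lambda>i. - w i) \<in> W"
  using smult_mem[of w "-1"] by simp

text \<open>Each coefficient is split as \<open>p(0) + x q\<close>; the part divisible by
  \<open>x\<close> is moved to the other side, where it gives \<open>x\<close> times an element of
  \<open>W\<close>.\<close>

lemma constant_relation:
  assumes "\<And>j. j \<in> J \<Longrightarrow> w j \<in> W" "\<And>k. k < n \<Longrightarrow> (\<Sum>j\<in>J. to_fract (p j) * w j k) = 0"
  shows "\<exists>v\<in>W. \<forall>k. (\<Sum>j\<in>J. cst (poly (p j) 0) * w j k) = rat_X * v k"
proof -
  have "\<exists>r. p j = [:poly (p j) 0:] + poly_X * r" for j
    by (cases "p j") (auto intro: exI)
  then obtain q where q: "\<And>j. p j = [:poly (p j) 0:] + poly_X * q j" by metis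
  let ?v = "\<lambda>k. - (\<Sum>j\<in>J. to_fract (q j) * w j k)"
  have "(\<Sum>j\<in>J. to_fract (p j) * w j k) = 0" for k
    using assms support by (cases "k < n") auto
  moreover have "cst (poly (p j) 0) + rat_X * to_fract (q j) = to_fract (p j)" for j
    by (subst (2) q) (simp only: to_fract_add to_fract_mult)
  ultimately have "(\<Sum>j\<in>J. (cst (poly (p j) 0) + rat_X * to_fract (q j)) * w j k) = 0" for k
    by (simp only:)
  then have "(\<Sum>j\<in>J. cst (poly (p j) 0) * w j k) = rat_X * ?v k" for k
    by (simp add: distrib_right sum.distrib sum_distrib_left mult.assoc eq_neg_iff_add_eq_0)
  moreover have "?v \<in> W" using assms by (intro uminus_mem sum_mem) auto
  ultimately show ?thesis by (intro bexI[of _ ?v]) auto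
qed

text \<open>Linear independence over \<open>\<complex>\<close> in \<open>W / xW\<close>.\<close>

definition mod_indep :: "nat \<Rightarrow> (nat \<Rightarrow> nat \<Rightarrow> complex poly fract) \<Rightarrow> bool" where
  "mod_indep r u \<longleftrightarrow> (\<forall>i<r. u i \<in> W) \<and>
    (\<forall>c. (\<exists>v\<in>W. \<forall>k. (\<Sum>i<r. cst (c i) * u i k) = rat_X * v k) \<longrightarrow> (\<forall>i<r. c i = 0))"

definition mod_basis :: "nat \<Rightarrow> (nat \<Rightarrow> nat \<Rightarrow> complex poly fract) \<Rightarrow> bool" where
  "mod_basis r u \<longleftrightarrow> mod_indep r u \<and>
    (\<forall>w\<in>W. \<exists>c. \<exists>v\<in>W. \<forall>k. w k = (\<Sum>i<r. cst (c i) * u i k) + rat_X * v k)"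

lemma mod_indep_le:
  assumes "mod_indep r u"
  shows "r \<le> n"
proof (rule ccontr)
  assume "\<not> r \<le> n"
  then obtain p where p: "\<exists>j<r. poly (p j) 0 \<noteq> 0" "\<forall>i<n. (\<Sum>j<r. to_fract (p j) * u j i) = 0"
    using polynomial_relation[of "{..<r}" n u] by auto
  have "\<exists>v\<in>W. \<forall>k. (\<Sum>j<r. cst (poly (p j) 0) * u j k) = rat_X * v k"
    using assms p by (intro constant_relation) (auto simp: mod_indep_def)
  then have "\<forall>i<r. poly (p i) 0 = 0"
    using assms unfolding mod_indep_def by (auto dest!: spec[of _ "\<lambda>i. poly (p i) 0"])
  with p show False by auto
qed

text \<open>Independent families have length at most \<open>n\<close>, so a longest one exists.
  Adding any \<open>w\<close> to it creates a relation, in which the coefficient of \<open>w\<close>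
  is nonzero by independence; solving for \<open>w\<close> gives the spanning property.\<close>

lemma mod_basis_exists: "\<exists>r u. r \<le> n \<and> mod_basis r u"
proof -
  let ?P = "\<lambda>r. \<exists>u. mod_indep r u"
  have "?P 0" by (simp add: mod_indep_def)
  moreover have "\<forall>r. ?P r \<longrightarrow> r \<le> n" using mod_indep_le by blast
  ultimately have r: "?P (Greatest ?P)" "\<And>r'. ?P r' \<Longrightarrow> r' \<le> Greatest ?P"
    using GreatestI_nat[of ?P 0 n] Greatest_le_nat[of ?P _ n] by auto
  define r where "r = Greatest ?P"
  obtain u where u: "mod_indep r u" using r unfolding r_def by blast
  have "\<exists>c. \<exists>v\<in>W. \<forall>k. w k = (\<Sum>i<r. cst (c i) * u i k) + rat_X * v k" if w: "w \<in> W" for w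
  proof -
    let ?u = "u(r := w)"
    have "\<not> mod_indep (Suc r) ?u" using r(2)[of "Suc r"] unfolding r_def by auto
    moreover have "\<forall>i<Suc r. ?u i \<in> W" using u w by (auto simp: mod_indep_def less_Suc_eq)
    ultimately obtain c v where cv: "v \<in> W" "\<exists>i<Suc r. c i \<noteq> 0"
      "\<forall>k. (\<Sum>i<Suc r. cst (c i) * ?u i k) = rat_X * v k"
      unfolding mod_indep_def by blast
    then have eq: "(\<Sum>i<r. cst (c i) * u i k) + cst (c r) * w k = rat_X * v k" for k
    proof -
      have "(\<Sum>i<r. cst (c i) * ?u i k) = (\<Sum>i<r. cst (c i) * u i k)"
        by (intro sum.cong) auto
      moreover have "(\<Sum>i<r. cst (c i) * ?u i k) + cst (c r) * ?u r k = rat_X * v k"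
        using cv(3) unfolding sum.lessThan_Suc by blast
      ultimately show ?thesis by (simp only: fun_upd_same)
    qed
    have "c r \<noteq> 0"
    proof
      assume "c r = 0"
      then have "\<forall>k. (\<Sum>i<r. cst (c i) * u i k) = rat_X * v k" using eq by simp
      then have "\<forall>i<r. c i = 0" using u cv(1) unfolding mod_indep_def by blast
      with cv(2) \<open>c r = 0\<close> show False by (auto simp: less_Suc_eq)
    qed
    have inv: "cst (inverse (c r)) * cst (c r) = 1"
      using \<open>c r \<noteq> 0\<close> by (simp flip: to_fract_mult add: one_pCons[symmetric])
    have "w k = (\<Sum>i<r. cst (- c i * inverse (c r)) * u i k) + rat_X * (cst (inverse (c r)) * v k)" for k
    proof -
      have e1: "cst (- c i * inverse (c r)) = - (cst (inverse (c r)) * cst (c i))" for i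
        by (simp flip: to_fract_mult to_fract_uminus)
      have "w k = cst (inverse (c r)) * (cst (c r) * w k)"
        by (simp only: mult.assoc[symmetric] inv mult_1)
      also have "cst (c r) * w k = rat_X * v k - (\<Sum>i<r. cst (c i) * u i k)"
        using eq[of k] by (simp add: eq_diff_eq add.commute)
      moreover have "(\<Sum>i<r. cst (- c i * inverse (c r)) * u i k) = - (cst (inverse (c r)) * (\<Sum>i<r. cst (c i) * u i k))"
        unfolding sum_distrib_left sum_negf[symmetric]
        by (intro sum.cong refl, subst e1) (simp only: mult.assoc minus_mult_left)
      ultimately show ?thesis by (simp only: right_diff_distrib mult.left_commute) simp
    qed
    then show ?thesis
      using smult_mem[OF cv(1), of "[:inverse (c r):]"]
      by (intro exI[of _ "\<lambda>i. - c i * inverse (c r)"] bexI[of _ "\<lambda>k. cst (inverse (c r)) * v k"]) auto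
  qed
  with u have "mod_basis r u" by (auto simp: mod_basis_def)
  then show ?thesis using mod_indep_le[OF u] by blast
qed

text \<open>This is the substitute for Nakayama's lemma. The \<open>n + 1\<close> vectors
  \<open>u i\<close> and \<open>w\<close> are dependent over \<open>\<complex>[x]\<close>. The
  coefficient of \<open>w\<close> is a unit at 0, since otherwise the relation would reduce to a
  nontrivial one among the \<open>u i\<close> modulo \<open>xW\<close>.\<close>

lemma local_generation:
  assumes "mod_indep n u" "w \<in> W"
  shows "\<exists>p q. poly p 0 \<noteq> 0 \<and> (\<forall>k. to_fract p * w k = (\<Sum>i<n. to_fract (q i) * u i k))"
proof -
  let ?u = "u(n := w)"
  obtain p where p: "\<exists>j<Suc n. poly (p j) 0 \<noteq> 0" "\<forall>i<n. (\<Sum>j<Suc n. to_fract (p j) * ?u j i) = 0"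
    using polynomial_relation[of "{..<Suc n}" n ?u] by auto
  have mem: "\<And>j. j \<in> {..<Suc n} \<Longrightarrow> ?u j \<in> W" using assms by (auto simp: mod_indep_def less_Suc_eq)
  have eq: "(\<Sum>j<n. to_fract (p j) * u j k) + to_fract (p n) * w k = 0" for k
  proof -
    have "(\<Sum>j<Suc n. to_fract (p j) * ?u j k) = 0"
      using p(2) support[OF mem] by (cases "k < n") auto
    moreover have "(\<Sum>j<n. to_fract (p j) * ?u j k) = (\<Sum>j<n. to_fract (p j) * u j k)"
      by (intro sum.cong) auto
    ultimately show ?thesis by simp
  qed
  have "poly (p n) 0 \<noteq> 0"
  proof
    assume 0: "poly (p n) 0 = 0"
    obtain v where v: "v \<in> W" "\<forall>k. (\<Sum>j<Suc n. cst (poly (p j) 0) * ?u j k) = rat_X * v k"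
      using constant_relation[where J = "{..<Suc n}" and w = ?u and p = p, OF mem] p(2) by auto
    have "(\<Sum>j<n. cst (poly (p j) 0) * ?u j k) = (\<Sum>j<n. cst (poly (p j) 0) * u j k)" for k
      by (intro sum.cong) auto
    then have "\<forall>k. (\<Sum>j<n. cst (poly (p j) 0) * u j k) = rat_X * v k" using v(2) 0 by simp
    then have "\<forall>i<n. poly (p i) 0 = 0"
      using assms(1) v(1) unfolding mod_indep_def by (auto dest!: spec[of _ "\<lambda>i. poly (p i) 0"])
    with p(1) 0 show False by (auto simp: less_Suc_eq)
  qed
  moreover have "to_fract (p n) * w k = (\<Sum>i<n. to_fract (- p i) * u i k)" for k
    using eq[of k] by (simp add: sum_negf eq_neg_iff_add_eq_0 add.commute)
  ultimately show ?thesis by (intro exI[of _ "p n"] exI[of _ "\<lambda>i. - p i"]) auto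
qed

text \<open>The expansion of the remainder is substituted repeatedly. The outcome says that the
  \<open>j r\<close> vectors \<open>x\<^sup>i u\<^sub>l\<close> span \<open>W\<close> modulo
  \<open>x\<^sup>j W\<close>.\<close>

lemma mod_basis_iterate:
  assumes "mod_basis r u" "w \<in> W"
  shows "\<exists>q. \<exists>v\<in>W. \<forall>k. w k = (\<Sum>(i,l)\<in>{..<j}\<times>{..<r}. cst (q i l) * (rat_X ^ i * u l k)) + rat_X ^ j * v k"
proof (induction j)
  case 0
  then show ?case using assms by auto
next
  case (Suc j)
  then obtain q v where qv: "v \<in> W"
    "\<forall>k. w k = (\<Sum>(i,l)\<in>{..<j}\<times>{..<r}. cst (q i l) * (rat_X ^ i * u l k)) + rat_X ^ j * v k" by blast
  obtain c v' where v': "v' \<in> W" "\<forall>k. v k = (\<Sum>l<r. cst (c l) * u l k) + rat_X * v' k"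
    using assms(1) qv(1) unfolding mod_basis_def by blast
  have "w k = (\<Sum>(i,l)\<in>{..<Suc j}\<times>{..<r}. cst ((q(j := c)) i l) * (rat_X ^ i * u l k)) + rat_X ^ Suc j * v' k" for k
  proof -
    have "(\<Sum>(i,l)\<in>{..<Suc j}\<times>{..<r}. cst ((q(j := c)) i l) * (rat_X ^ i * u l k))
      = (\<Sum>i<Suc j. \<Sum>l<r. cst ((q(j := c)) i l) * (rat_X ^ i * u l k))"
      by (simp add: sum.cartesian_product)
    also have "\<dots> = (\<Sum>i<j. \<Sum>l<r. cst (q i l) * (rat_X ^ i * u l k)) + (\<Sum>l<r. cst (c l) * (rat_X ^ j * u l k))"
      by simp
    also have "(\<Sum>i<j. \<Sum>l<r. cst (q i l) * (rat_X ^ i * u l k)) = (\<Sum>(i,l)\<in>{..<j}\<times>{..<r}. cst (q i l) * (rat_X ^ i * u l k))"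
      by (simp add: sum.cartesian_product)
    also have "(\<Sum>l<r. cst (c l) * (rat_X ^ j * u l k)) = rat_X ^ j * (\<Sum>l<r. cst (c l) * u l k)"
      by (simp add: sum_distrib_left mult.left_commute)
    finally show ?thesis using qv(2) v'(2) by (simp add: algebra_simps)
  qed
  then show ?case using v'(1) by blast
qed

text \<open>If \<open>W\<close> lies in \<open>x\<^bsup>-e\<^esup>\<complex>[[x]]\<^sup>n\<close> and contains \<open>x\<^sup>d \<complex>[x]\<^sup>n\<close>, then \<open>W / x\<^sup>j W\<close> has dimension at least
  \<open>n (j - d - e)\<close>; on the other hand it has dimension at most \<open>r j\<close>. Now let \<open>j\<close> grow.\<close>

lemma bounded_imp_le_mod_basis:
  assumes basis: "mod_basis r u"
    and unit: "\<And>l. l < n \<Longrightarrow> (\<lambda>i. if i = l then to_fract (poly_X ^ d) else 0) \<in> W"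
    and bounded: "\<And>w k. w \<in> W \<Longrightarrow> w k \<noteq> 0 \<Longrightarrow> - int e \<le> fls_subdegree (to_laurent (w k))"
  shows "n \<le> r"
proof (rule ccontr)
  assume "\<not> n \<le> r"
  \<comment> \<open>The \<open>N n\<close> test vectors \<open>x ^ (d + a) e\<^sub>l\<close> with
    \<open>a < N\<close> must outnumber the \<open>j r\<close> spanning vectors modulo
    \<open>x\<^sup>j W\<close>. As \<open>n \<ge> r + 1\<close>, this follows from
    \<open>N > (d + e) r\<close>. The summands \<open>d + e\<close> of \<open>j\<close> make the
    orders at 0 collide at the end.\<close>
  define N where "N = (d + e) * r + 1"
  define j where "j = N + d + e"
  define y where "y = (\<lambda>(a, l) (i::nat). if i = l then to_fract (poly_X ^ (d + a)) else 0 :: complex poly fract)"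
  have y_mem: "y t \<in> W" if "t \<in> {..<N} \<times> {..<n}" for t
  proof -
    from that obtain a l where t: "t = (a, l)" "l < n" by auto
    have "(\<lambda>i. to_fract (poly_X ^ a) * (if i = l then to_fract (poly_X ^ d) else 0)) \<in> W"
      using smult_mem[OF unit[OF t(2)]] .
    also have "(\<lambda>i. to_fract (poly_X ^ a) * (if i = l then to_fract (poly_X ^ d) else 0)) = y t"
      by (auto simp: t y_def power_add fun_eq_iff)
    finally show ?thesis .
  qed
  have "\<forall>t\<in>{..<N} \<times> {..<n}. \<exists>q. \<exists>v\<in>W. \<forall>k. y t k = (\<Sum>(i,l)\<in>{..<j}\<times>{..<r}. cst (q i l) * (rat_X ^ i * u l k)) + rat_X ^ j * v k"
    using mod_basis_iterate[OF basis y_mem] by blast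
  from bchoice[OF this] obtain q where "\<forall>t\<in>{..<N} \<times> {..<n}. \<exists>v\<in>W. \<forall>k. y t k = (\<Sum>(i,l)\<in>{..<j}\<times>{..<r}. cst (q t i l) * (rat_X ^ i * u l k)) + rat_X ^ j * v k" ..
  from bchoice[OF this[unfolded Bex_def]] obtain v where
    v: "\<forall>t\<in>{..<N} \<times> {..<n}. v t \<in> W \<and> (\<forall>k. y t k = (\<Sum>(i,l)\<in>{..<j}\<times>{..<r}. cst (q t i l) * (rat_X ^ i * u l k)) + rat_X ^ j * v t k)" ..
  have qv: "v t \<in> W"
    "y t k = (\<Sum>(i,l)\<in>{..<j}\<times>{..<r}. cst (q t i l) * (rat_X ^ i * u l k)) + rat_X ^ j * v t k"
    if "t \<in> {..<N} \<times> {..<n}" for t k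
    using bspec[OF v that] by blast+
  have "j * r < N * (r + 1)" by (simp add: j_def N_def algebra_simps)
  also have "\<dots> \<le> N * n" using \<open>\<not> n \<le> r\<close> by (intro mult_left_mono) auto
  \<comment> \<open>The combination of the test vectors with coefficients \<open>z\<close> has no
    component along the spanning vectors, hence lies in \<open>x\<^sup>j W\<close>.\<close>
  finally obtain z where z: "\<exists>t\<in>{..<N} \<times> {..<n}. z t \<noteq> 0"
    "\<forall>s\<in>{..<j}\<times>{..<r}. (\<Sum>t\<in>{..<N} \<times> {..<n}. q t (fst s) (snd s) * z t) = 0"
    using homogeneous_system[of "{..<j}\<times>{..<r}" "{..<N} \<times> {..<n}" "\<lambda>s t. q t (fst s) (snd s)"] by auto
  define v' where "v' = (\<lambda>k. \<Sum>t\<in>{..<N} \<times> {..<n}. cst (z t) * v t k)"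
  have v': "v' \<in> W" unfolding v'_def using qv(1) by (intro sum_mem) auto
  have cst_sum: "cst (sum f A) = (\<Sum>a\<in>A. cst (f a))" for f :: "nat \<times> nat \<Rightarrow> complex" and A
  proof (induction A rule: infinite_finite_induct)
    case (insert a A)
    have "cst (f a + sum f A) = cst (f a) + cst (sum f A)" by (simp flip: to_fract_add)
    then show ?case using insert by simp
  qed auto
  have main: "(\<Sum>t\<in>{..<N} \<times> {..<n}. cst (z t) * y t k) = rat_X ^ j * v' k" for k
  proof -
    have "(\<Sum>t\<in>{..<N} \<times> {..<n}. cst (z t) * y t k)
      = (\<Sum>t\<in>{..<N} \<times> {..<n}. \<Sum>(i,l)\<in>{..<j}\<times>{..<r}. cst (q t i l * z t) * (rat_X ^ i * u l k)) + rat_X ^ j * v' k"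
      unfolding v'_def sum_distrib_left sum.distrib[symmetric]
    proof (intro sum.cong refl)
      fix t assume t: "t \<in> {..<N} \<times> {..<n}"
      have "cst (z t) * y t k = cst (z t) * (\<Sum>(i,l)\<in>{..<j}\<times>{..<r}. cst (q t i l) * (rat_X ^ i * u l k)) + rat_X ^ j * (cst (z t) * v t k)"
        unfolding qv(2)[OF t] by (simp add: algebra_simps)
      also have "cst (z t) * (\<Sum>(i,l)\<in>{..<j}\<times>{..<r}. cst (q t i l) * (rat_X ^ i * u l k))
        = (\<Sum>(i,l)\<in>{..<j}\<times>{..<r}. cst (q t i l * z t) * (rat_X ^ i * u l k))"
        unfolding sum_distrib_left
      proof (intro sum.cong refl, clarify)
        fix a b
        have "cst (q t a b * z t) = cst (z t) * cst (q t a b)" by (simp flip: to_fract_mult add: mult.commute)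
        then show "cst (z t) * (cst (q t a b) * (rat_X ^ a * u b k)) = cst (q t a b * z t) * (rat_X ^ a * u b k)"
          by (simp only: mult.assoc)
      qed
      finally show "cst (z t) * y t k = (\<Sum>(i,l)\<in>{..<j}\<times>{..<r}. cst (q t i l * z t) * (rat_X ^ i * u l k)) + rat_X ^ j * (cst (z t) * v t k)" .
    qed
    also have "(\<Sum>t\<in>{..<N} \<times> {..<n}. \<Sum>(i,l)\<in>{..<j}\<times>{..<r}. cst (q t i l * z t) * (rat_X ^ i * u l k))
      = (\<Sum>(i,l)\<in>{..<j}\<times>{..<r}. cst (\<Sum>t\<in>{..<N} \<times> {..<n}. q t i l * z t) * (rat_X ^ i * u l k))"
      unfolding cst_sum sum_distrib_right by (subst sum.swap) (simp add: case_prod_unfold)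
    also have "\<dots> = 0" using z(2) by (intro sum.neutral) auto
    finally show ?thesis by simp
  qed
  \<comment> \<open>One position is enough: there the combination is the polynomial
    \<open>P\<close>, whose coefficient at \<open>d + a0\<close> is \<open>z (a0, l0)\<close>. Hence
    \<open>P\<close> has order at most \<open>d + a0 < d + N\<close> at 0.\<close>
  obtain a0 l0 where al: "a0 < N" "l0 < n" "z (a0, l0) \<noteq> 0" using z(1) by auto
  define P where "P = (\<Sum>a<N. monom (z (a, l0)) (d + a))"
  have "to_fract P = rat_X ^ j * v' l0"
  proof -
    have "(\<Sum>t\<in>{..<N} \<times> {..<n}. cst (z t) * y t l0) = (\<Sum>a<N. \<Sum>l<n. cst (z (a, l)) * y (a, l) l0)"
      by (simp add: sum.cartesian_product case_prod_unfold)
    also have "\<dots> = (\<Sum>a<N. cst (z (a, l0)) * to_fract (poly_X ^ (d + a)))"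
    proof (intro sum.cong refl)
      fix a
      have "(\<Sum>l<n. cst (z (a, l)) * y (a, l) l0) = (\<Sum>l\<in>{l0}. cst (z (a, l)) * y (a, l) l0)"
        using al by (intro sum.mono_neutral_right) (auto simp: y_def)
      then show "(\<Sum>l<n. cst (z (a, l)) * y (a, l) l0) = cst (z (a, l0)) * to_fract (poly_X ^ (d + a))"
        by (simp add: y_def)
    qed
    also have "\<dots> = to_fract P"
    proof -
      have "cst c * to_fract (poly_X ^ m) = to_fract (monom c m)" for c m
        by (simp flip: to_fract_mult add: monom_altdef)
      then show ?thesis
        unfolding P_def by (simp only:) (induction N, auto)
    qed
    finally show ?thesis using main[of l0] by simp
  qed
  have cP: "coeff P (d + a0) = z (a0, l0)"
    using al by (simp add: P_def coeff_sum)
  then have "P \<noteq> 0" using al by auto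
  have "fps_of_poly P \<noteq> 0" using \<open>P \<noteq> 0\<close> by simp
  have "subdegree (fps_of_poly P) \<le> d + a0"
    using cP al by (intro subdegree_leI) auto
  then have deg1: "fls_subdegree (to_laurent (to_fract P)) \<le> int (d + a0)"
    by (simp add: fls_subdegree_fls_to_fps)
  have "v' l0 \<noteq> 0" using \<open>P \<noteq> 0\<close> \<open>to_fract P = _\<close> by auto
  \<comment> \<open>As a component of an element of \<open>x\<^sup>j W\<close>, the same polynomial
    has order at least \<open>j - e = N + d\<close>.\<close>
  have "to_laurent (rat_X ^ j * v' l0) = fls_X_intpow (int j) * to_laurent (v' l0)"
    using to_laurent_X[of j] by (simp only: laur.ext_mult rat_X_power)
  then have "fls_subdegree (to_laurent (to_fract P)) = int j + fls_subdegree (to_laurent (v' l0))"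
    using \<open>to_fract P = _\<close> \<open>v' l0 \<noteq> 0\<close> laur.ext_eq_0_iff by simp
  with deg1 bounded[OF v' \<open>v' l0 \<noteq> 0\<close>] al show False by (simp add: j_def)
qed

end

section \<open>Extension of scalars\<close>

text \<open>The vector space laws of the tensor product come from its own relations, so what is
  asked of \<open>N\<close> is closure and \<open>0 + 0 = 0\<close>. The associated graded module
  becomes an instance on the strength of these.\<close>

locale tensor_product =
  fixes \<phi> :: "complex poly \<Rightarrow> 'a::field" and N :: "(complex poly, 'n) module"
  assumes zero_closed: "\<zero>\<^bsub>N\<^esub> \<in> carrier N"
    and zero_add: "\<zero>\<^bsub>N\<^esub> \<oplus>\<^bsub>N\<^esub> \<zero>\<^bsub>N\<^esub> = \<zero>\<^bsub>N\<^esub>"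
    and add_closed: "n \<in> carrier N \<Longrightarrow> n' \<in> carrier N \<Longrightarrow> n \<oplus>\<^bsub>N\<^esub> n' \<in> carrier N"
    and smult_closed: "n \<in> carrier N \<Longrightarrow> p \<odot>\<^bsub>N\<^esub> n \<in> carrier N"
begin

abbreviation F where "F \<equiv> tensor_free N"
abbreviation Z where "Z \<equiv> tensor_null \<phi> N"
abbreviation T where "T \<equiv> tensor \<phi> N"

definition cls :: "('a \<times> 'n \<Rightarrow>\<^sub>0 int) \<Rightarrow> ('a \<times> 'n \<Rightarrow>\<^sub>0 int) set" where
  "cls f = Z #>\<^bsub>F\<^esub> f"

definition tns :: "'a \<Rightarrow> 'n \<Rightarrow> ('a \<times> 'n \<Rightarrow>\<^sub>0 int) set" where
  "tns a n = cls (frag_of (a, n))"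

lemma F_simps [simp]:
  "f \<in> carrier F \<longleftrightarrow> Poly_Mapping.keys f \<subseteq> UNIV \<times> carrier N"
  "\<one>\<^bsub>F\<^esub> = 0" "f \<otimes>\<^bsub>F\<^esub> g = f + g"
  by (simp_all add: tensor_free_def)

lemma comm_group_F: "comm_group F"
  by (simp add: tensor_free_def abelian_free_Abelian_group)

lemma inv_F: "f \<in> carrier F \<Longrightarrow> inv\<^bsub>F\<^esub> f = - f"
  by (simp add: tensor_free_def)

lemma F_closed:
  "f \<in> carrier F \<Longrightarrow> g \<in> carrier F \<Longrightarrow> f + g \<in> carrier F"
  "f \<in> carrier F \<Longrightarrow> - f \<in> carrier F"
  "f \<in> carrier F \<Longrightarrow> g \<in> carrier F \<Longrightarrow> f - g \<in> carrier F"
  "n \<in> carrier N \<Longrightarrow> frag_of (a, n) \<in> carrier F"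
  using Poly_Mapping.keys_add[of f g] keys_diff[of f g] by (auto simp: keys_minus)

definition rels :: "('a \<times> 'n \<Rightarrow>\<^sub>0 int) set" where
  "rels = {frag_of (a + b, n) - frag_of (a, n) - frag_of (b, n) | a b n. n \<in> carrier N} \<union>
      {frag_of (a, n \<oplus>\<^bsub>N\<^esub> n') - frag_of (a, n) - frag_of (a, n') | a n n'.
         n \<in> carrier N \<and> n' \<in> carrier N} \<union>
      {frag_of (a * \<phi> p, n) - frag_of (a, p \<odot>\<^bsub>N\<^esub> n) | a p n. n \<in> carrier N}"

lemma null_eq: "Z = generate F rels"
  by (simp add: tensor_null_def rels_def)

lemma rels_subset: "rels \<subseteq> carrier F"
  unfolding rels_def by (auto intro!: F_closed simp del: F_simps simp: add_closed smult_closed)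

lemma subgroup_null: "subgroup Z F"
proof -
  interpret comm_group F by (rule comm_group_F)
  show ?thesis unfolding null_eq by (rule generate_is_subgroup[OF rels_subset])
qed

lemma null_subset: "Z \<subseteq> carrier F"
  using subgroup.subset[OF subgroup_null] .

lemma null_zero: "0 \<in> Z"
  using subgroup.one_closed[OF subgroup_null] by simp

lemma null_add: "f \<in> Z \<Longrightarrow> g \<in> Z \<Longrightarrow> f + g \<in> Z"
  using subgroup.m_closed[OF subgroup_null] by simp

lemma null_uminus: "f \<in> Z \<Longrightarrow> - f \<in> Z"
proof -
  assume "f \<in> Z"
  then have "inv\<^bsub>F\<^esub> f \<in> Z" "f \<in> carrier F"
    using subgroup.m_inv_closed[OF subgroup_null] null_subset by blast+
  then show "- f \<in> Z" using inv_F by metis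
qed

lemma null_diff: "f \<in> Z \<Longrightarrow> g \<in> Z \<Longrightarrow> f - g \<in> Z"
  using null_add[OF _ null_uminus, of f g] by simp

lemma null_rels:
  "n \<in> carrier N \<Longrightarrow> frag_of (a + b, n) - frag_of (a, n) - frag_of (b, n) \<in> Z"
  "n \<in> carrier N \<Longrightarrow> n' \<in> carrier N \<Longrightarrow> frag_of (a, n \<oplus>\<^bsub>N\<^esub> n') - frag_of (a, n) - frag_of (a, n') \<in> Z"
  "n \<in> carrier N \<Longrightarrow> frag_of (a * \<phi> p, n) - frag_of (a, p \<odot>\<^bsub>N\<^esub> n) \<in> Z"
proof -
  show "n \<in> carrier N \<Longrightarrow> frag_of (a + b, n) - frag_of (a, n) - frag_of (b, n) \<in> Z"
    unfolding null_eq rels_def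
    by (rule generate.incl, rule UnI1, rule UnI1, rule CollectI, rule exI[of _ a], rule exI[of _ b], rule exI[of _ n], simp)
  show "n \<in> carrier N \<Longrightarrow> n' \<in> carrier N \<Longrightarrow> frag_of (a, n \<oplus>\<^bsub>N\<^esub> n') - frag_of (a, n) - frag_of (a, n') \<in> Z"
    unfolding null_eq rels_def
    by (rule generate.incl, rule UnI1, rule UnI2, rule CollectI, rule exI[of _ a], rule exI[of _ n], rule exI[of _ n'], simp)
  show "n \<in> carrier N \<Longrightarrow> frag_of (a * \<phi> p, n) - frag_of (a, p \<odot>\<^bsub>N\<^esub> n) \<in> Z"
    unfolding null_eq rels_def
    by (rule generate.incl, rule UnI2, rule CollectI, rule exI[of _ a], rule exI[of _ p], rule exI[of _ n], simp)
qed

lemma null_induct [consumes 1, case_names zero add uminus rel1 rel2 rel3]: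
  assumes "f \<in> Z" "P 0" "\<And>f g. P f \<Longrightarrow> P g \<Longrightarrow> P (f + g)" "\<And>f. P f \<Longrightarrow> P (- f)"
    "\<And>a b n. n \<in> carrier N \<Longrightarrow> P (frag_of (a + b, n) - frag_of (a, n) - frag_of (b, n))"
    "\<And>a n n'. n \<in> carrier N \<Longrightarrow> n' \<in> carrier N \<Longrightarrow>
      P (frag_of (a, n \<oplus>\<^bsub>N\<^esub> n') - frag_of (a, n) - frag_of (a, n'))"
    "\<And>a p n. n \<in> carrier N \<Longrightarrow> P (frag_of (a * \<phi> p, n) - frag_of (a, p \<odot>\<^bsub>N\<^esub> n))"
  shows "P f"
proof -
  have rel: "P h" if "h \<in> rels" for h
    using that assms(5-7) unfolding rels_def by blast
  show ?thesis
    using assms(1) unfolding null_eq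
  proof (induction f rule: generate.induct)
    case (inv h)
    then have "h \<in> carrier F" using rels_subset by blast
    then show ?case using assms(4)[OF rel[OF inv]] inv_F by metis
  qed (use assms rel in auto)
qed

lemma mem_cls: "h \<in> cls f \<longleftrightarrow> h - f \<in> Z"
proof
  assume "h - f \<in> Z"
  then show "h \<in> cls f" unfolding cls_def r_coset_def by (auto intro!: bexI[of _ "h - f"])
qed (auto simp: cls_def r_coset_def)

lemma cls_eq_iff: "cls f = cls g \<longleftrightarrow> f - g \<in> Z"
proof
  assume "cls f = cls g"
  then show "f - g \<in> Z" using null_zero mem_cls[of f f] mem_cls[of f g] by simp
next
  assume fg: "f - g \<in> Z"
  have "h - f \<in> Z \<longleftrightarrow> h - g \<in> Z" for h
    using null_add[OF _ fg, of "h - f"] null_diff[OF _ fg, of "h - g"] by (auto simp: algebra_simps)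
  then show "cls f = cls g" by (auto simp: mem_cls)
qed

lemma carrier_T: "carrier T = cls ` carrier F"
  by (auto simp: tensor_def Let_def FactGroup_def RCOSETS_def cls_def)

lemma cls_closed: "f \<in> carrier F \<Longrightarrow> cls f \<in> carrier T"
  by (simp add: carrier_T del: F_simps)

lemma zero_T: "\<zero>\<^bsub>T\<^esub> = cls 0"
  by (auto simp: tensor_def Let_def FactGroup_def mem_cls)

lemma add_T: "f \<in> carrier F \<Longrightarrow> g \<in> carrier F \<Longrightarrow> cls f \<oplus>\<^bsub>T\<^esub> cls g = cls (f + g)"
proof -
  assume fg: "f \<in> carrier F" "g \<in> carrier F"
  interpret comm_group F by (rule comm_group_F)
  interpret normal Z F by (rule subgroup_imp_normal[OF subgroup_null])
  have "cls f <#>\<^bsub>F\<^esub> cls g = cls (f \<otimes>\<^bsub>F\<^esub> g)"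
    unfolding cls_def using fg by (rule rcos_sum)
  then show ?thesis by (simp add: tensor_def Let_def FactGroup_def)
qed

text \<open>If the map preserves the relations, all representatives yield the same coset and the
  union in \<open>tensor_map\<close> collapses.\<close>

lemma tensor_map_cls:
  assumes "\<And>z. z \<in> Z \<Longrightarrow> frag_extend g z \<in> Z"
  shows "tensor_map \<phi> N g (cls f) = cls (frag_extend g f)"
proof -
  have "cls (frag_extend g c) = cls (frag_extend g f)" if "c \<in> cls f" for c
    using assms that unfolding mem_cls by (simp add: cls_eq_iff frag_extend_diff[symmetric])
  moreover have "f \<in> cls f" by (simp add: mem_cls null_zero)
  moreover have "tensor_map \<phi> N g (cls f) = (\<Union>c\<in>cls f. cls (frag_extend g c))"
    unfolding tensor_map_def by (simp only: cls_def)
  ultimately show ?thesis by blast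
qed

lemma frag_extend_closed:
  assumes "\<And>a n. n \<in> carrier N \<Longrightarrow> g (a, n) \<in> carrier F" "f \<in> carrier F"
  shows "frag_extend g f \<in> carrier F"
proof -
  have "Poly_Mapping.keys (g x) \<subseteq> UNIV \<times> carrier N" if "x \<in> Poly_Mapping.keys f" for x
    using assms that by (cases x) auto
  then show ?thesis using keys_frag_extend[of g f] by (auto; blast)
qed

definition scl :: "'a \<Rightarrow> 'a \<times> 'n \<Rightarrow> ('a \<times> 'n \<Rightarrow>\<^sub>0 int)" where
  "scl a = (\<lambda>(b, n). frag_of (a * b, n))"

lemma scl_null: "z \<in> Z \<Longrightarrow> frag_extend (scl a) z \<in> Z"
proof (induction z rule: null_induct)
  case (rel1 b c n)
  then show ?case using null_rels(1)[of n "a * b" "a * c"]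
    by (simp add: frag_extend_diff scl_def distrib_left)
next
  case (rel2 b n n')
  then show ?case using null_rels(2)[of n n' "a * b"]
    by (simp add: frag_extend_diff scl_def)
next
  case (rel3 b p n)
  then show ?case using null_rels(3)[of n "a * b" p]
    by (simp add: frag_extend_diff scl_def mult.assoc)
qed (auto simp: frag_extend_add frag_extend_minus null_add null_uminus null_zero)

lemma smult_T: "a \<odot>\<^bsub>T\<^esub> cls f = cls (frag_extend (scl a) f)"
  using tensor_map_cls[of "scl a" f] scl_null
  by (simp add: tensor_def Let_def scl_def)

lemma scl_closed: "f \<in> carrier F \<Longrightarrow> frag_extend (scl a) f \<in> carrier F"
  by (rule frag_extend_closed) (auto simp: scl_def)

lemma F_induct [consumes 1, case_names zero diff of]:
  assumes "f \<in> carrier F" "P 0" "\<And>f g. f \<in> carrier F \<Longrightarrow> g \<in> carrier F \<Longrightarrow> P f \<Longrightarrow> P g \<Longrightarrow> P (f - g)"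
    "\<And>a n. n \<in> carrier N \<Longrightarrow> P (frag_of (a, n))"
  shows "P f"
  by (rule free_Abelian_group_induct[of f "UNIV \<times> carrier N"]) (use assms in auto)

lemma vectorspace_T: "vectorspace class_ring T"
proof (rule vs_criteria)
  show "field (class_ring :: 'a ring)" by (rule class_field)
  show "\<zero>\<^bsub>T\<^esub> \<in> carrier T" unfolding zero_T by (rule cls_closed) simp
  show "\<forall>v w. v \<in> carrier T \<and> w \<in> carrier T \<longrightarrow> v \<oplus>\<^bsub>T\<^esub> w \<in> carrier T"
    unfolding carrier_T by (auto simp: add_T F_closed simp del: F_simps)
  show "\<forall>v\<in>carrier T. \<exists>w\<in>carrier T. v \<oplus>\<^bsub>T\<^esub> w = \<zero>\<^bsub>T\<^esub>"
  proof
    fix v assume "v \<in> carrier T"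
    then obtain f where f: "f \<in> carrier F" "v = cls f" by (auto simp: carrier_T simp del: F_simps)
    then show "\<exists>w\<in>carrier T. v \<oplus>\<^bsub>T\<^esub> w = \<zero>\<^bsub>T\<^esub>"
      by (intro bexI[of _ "cls (- f)"]) (auto simp: add_T F_closed zero_T cls_closed simp del: F_simps)
  qed
  show "\<forall>c v. c \<in> carrier class_ring \<and> v \<in> carrier T \<longrightarrow> c \<odot>\<^bsub>T\<^esub> v \<in> carrier T"
    unfolding carrier_T by (auto simp: smult_T scl_closed simp del: F_simps)
  show "\<forall>v w. v \<in> carrier T \<and> w \<in> carrier T \<longrightarrow> v \<oplus>\<^bsub>T\<^esub> w = w \<oplus>\<^bsub>T\<^esub> v"
    unfolding carrier_T by (auto simp: add_T add.commute simp del: F_simps)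
  show "\<forall>v w x. v \<in> carrier T \<and> w \<in> carrier T \<and> x \<in> carrier T \<longrightarrow> v \<oplus>\<^bsub>T\<^esub> w \<oplus>\<^bsub>T\<^esub> x = v \<oplus>\<^bsub>T\<^esub> (w \<oplus>\<^bsub>T\<^esub> x)"
    unfolding carrier_T by (auto simp: add_T add.assoc F_closed simp del: F_simps)
  show "\<forall>v\<in>carrier T. v \<oplus>\<^bsub>T\<^esub> \<zero>\<^bsub>T\<^esub> = v"
  proof
    fix v assume "v \<in> carrier T"
    then obtain f where f: "f \<in> carrier F" "v = cls f" by (auto simp: carrier_T simp del: F_simps)
    have "0 \<in> carrier F" by simp
    from add_T[OF f(1) this] show "v \<oplus>\<^bsub>T\<^esub> \<zero>\<^bsub>T\<^esub> = v" unfolding zero_T f(2) by simp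
  qed
  show "\<forall>a b v. a \<in> carrier class_ring \<and> b \<in> carrier class_ring \<and> v \<in> carrier T \<longrightarrow>
      (a \<otimes>\<^bsub>class_ring\<^esub> b) \<odot>\<^bsub>T\<^esub> v = a \<odot>\<^bsub>T\<^esub> (b \<odot>\<^bsub>T\<^esub> v)"
  proof -
    have "frag_extend (scl (a * b)) f = frag_extend (scl a) (frag_extend (scl b) f)" if "f \<in> carrier F" for a b f
      using that by (induction f rule: F_induct) (simp_all add: frag_extend_diff scl_def mult.assoc)
    then show ?thesis unfolding carrier_T by (auto simp: smult_T simp del: F_simps)
  qed
  show "\<forall>v\<in>carrier T. \<one>\<^bsub>class_ring\<^esub> \<odot>\<^bsub>T\<^esub> v = v"
  proof -
    have "frag_extend (scl 1) f = f" if "f \<in> carrier F" for f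
      using that by (induction f rule: F_induct) (simp_all add: frag_extend_diff scl_def)
    then show ?thesis unfolding carrier_T by (auto simp: smult_T simp del: F_simps)
  qed
  show "\<forall>a b v. a \<in> carrier class_ring \<and> b \<in> carrier class_ring \<and> v \<in> carrier T \<longrightarrow>
      (a \<oplus>\<^bsub>class_ring\<^esub> b) \<odot>\<^bsub>T\<^esub> v = a \<odot>\<^bsub>T\<^esub> v \<oplus>\<^bsub>T\<^esub> b \<odot>\<^bsub>T\<^esub> v"
  proof -
    \<comment> \<open>Unlike the other laws for scalars, this one fails in the free group and holds
      only modulo the first family of relations.\<close>
    have "frag_extend (scl (a + b)) f - (frag_extend (scl a) f + frag_extend (scl b) f) \<in> Z" if "f \<in> carrier F" for a b f
      using that
    proof (induction f rule: F_induct)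
      case (diff f g)
      then show ?case using null_diff[OF diff(3,4)] by (simp add: frag_extend_diff algebra_simps)
    next
      case (of c n)
      then show ?case using null_rels(1)[of n "a * c" "b * c"] by (simp add: scl_def distrib_right algebra_simps)
    qed (simp add: null_zero)
    then have "cls (frag_extend (scl (a + b)) f) = cls (frag_extend (scl a) f + frag_extend (scl b) f)"
      if "f \<in> carrier F" for a b f
      using that unfolding cls_eq_iff by blast
    then show ?thesis unfolding carrier_T
      by (auto simp: smult_T add_T scl_closed simp del: F_simps)
  qed
  show "\<forall>a v w. a \<in> carrier class_ring \<and> v \<in> carrier T \<and> w \<in> carrier T \<longrightarrow>
      a \<odot>\<^bsub>T\<^esub> (v \<oplus>\<^bsub>T\<^esub> w) = a \<odot>\<^bsub>T\<^esub> v \<oplus>\<^bsub>T\<^esub> a \<odot>\<^bsub>T\<^esub> w"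
    unfolding carrier_T by (auto simp: smult_T add_T F_closed scl_closed frag_extend_add simp del: F_simps)
qed

sublocale T: vectorspace class_ring T
  by (rule vectorspace_T)

lemma tns_closed [simp]: "n \<in> carrier N \<Longrightarrow> tns a n \<in> carrier T"
  unfolding tns_def by (intro cls_closed F_closed)

lemma tns_add_right: "n \<in> carrier N \<Longrightarrow> n' \<in> carrier N \<Longrightarrow> tns a (n \<oplus>\<^bsub>N\<^esub> n') = tns a n \<oplus>\<^bsub>T\<^esub> tns a n'"
  using null_rels(2)[of n n' a] by (simp add: tns_def add_T F_closed cls_eq_iff algebra_simps)

lemma tns_smult: "n \<in> carrier N \<Longrightarrow> tns a (p \<odot>\<^bsub>N\<^esub> n) = tns (a * \<phi> p) n"
  using null_rels(3)[of n a p] null_uminus[of "frag_of (a * \<phi> p, n) - frag_of (a, p \<odot>\<^bsub>N\<^esub> n)"]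
  by (simp add: tns_def cls_eq_iff)

lemma smult_tns: "a \<odot>\<^bsub>T\<^esub> tns b n = tns (a * b) n"
  by (simp add: tns_def smult_T scl_def)

lemma tns_eq_smult: "tns a n = a \<odot>\<^bsub>T\<^esub> tns 1 n"
  by (simp add: smult_tns)

lemma tns_zero: "tns a \<zero>\<^bsub>N\<^esub> = \<zero>\<^bsub>T\<^esub>"
  using tns_add_right[OF zero_closed zero_closed, of a] zero_closed tns_closed[OF zero_closed, of a]
  by (simp add: zero_add)

lemma cls_diff: "f \<in> carrier F \<Longrightarrow> g \<in> carrier F \<Longrightarrow> cls (f - g) = cls f \<oplus>\<^bsub>T\<^esub> (- 1) \<odot>\<^bsub>T\<^esub> cls g"
proof -
  assume fg: "f \<in> carrier F" "g \<in> carrier F"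
  have "cls (- g) \<oplus>\<^bsub>T\<^esub> cls g = \<zero>\<^bsub>T\<^esub>" using fg by (simp add: add_T F_closed zero_T del: F_simps)
  then have "cls (- g) = \<ominus>\<^bsub>T\<^esub> cls g"
    using fg by (metis F_closed(2) T.minus_equality cls_closed)
  also have "\<dots> = (- 1) \<odot>\<^bsub>T\<^esub> cls g"
    using T.smult_l_minus[of 1 "cls g"] T.smult_one[of "cls g"] cls_closed[OF fg(2)] by (simp add: class_ring_simps)
  finally show ?thesis using fg add_T[OF fg(1) F_closed(2)[OF fg(2)]] by simp
qed

text \<open>An induction principle in the form of an inclusion: it suffices to treat the tensors
  \<open>1 \<otimes> n\<close> and the vector space operations.\<close>

lemma T_subset:
  assumes "\<zero>\<^bsub>T\<^esub> \<in> S" "\<And>s t. s \<in> S \<Longrightarrow> t \<in> S \<Longrightarrow> s \<oplus>\<^bsub>T\<^esub> t \<in> S" "\<And>a s. s \<in> S \<Longrightarrow> a \<odot>\<^bsub>T\<^esub> s \<in> S"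
    "\<And>n. n \<in> carrier N \<Longrightarrow> tns 1 n \<in> S"
  shows "carrier T \<subseteq> S"
proof -
  have "cls f \<in> S" if "f \<in> carrier F" for f
    using that
  proof (induction f rule: F_induct)
    case zero
    then show ?case using assms(1) by (simp add: zero_T)
  next
    case (diff f g)
    then show ?case using assms(2,3) by (simp add: cls_diff del: F_simps)
  next
    case (of a n)
    then show ?case using assms(3)[OF assms(4)[OF of], of a] by (metis tns_def tns_eq_smult)
  qed
  then show ?thesis by (auto simp: carrier_T simp del: F_simps)
qed

end

subsection \<open>Coordinates on the tensor product\<close>

text \<open>A criterion for the \<open>b i\<close> to give a basis of \<open>A \<otimes> N\<close>.
  The functionals \<open>C\<close> are dual to the \<open>b i\<close>, which yields independence.
  For spanning, \<open>generated\<close> asks that \<open>N\<close> be the closure of the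
  \<open>b i\<close> under addition, polynomials and division by nonzero polynomials; division is
  admissible because \<open>\<phi> p\<close> is invertible in \<open>A\<close>. Torsion elements are
  reached by dividing 0.\<close>

locale tensor_basis = tensor_product \<phi> N + poly_embedding \<phi>
  for \<phi> :: "complex poly \<Rightarrow> 'a::field" and N :: "(complex poly, 'n) module" +
  fixes C :: "'n \<Rightarrow> nat \<Rightarrow> 'a" and r :: nat and b :: "nat \<Rightarrow> 'n"
  assumes C_add: "n \<in> carrier N \<Longrightarrow> n' \<in> carrier N \<Longrightarrow> C (n \<oplus>\<^bsub>N\<^esub> n') k = C n k + C n' k"
    and C_smult: "n \<in> carrier N \<Longrightarrow> C (p \<odot>\<^bsub>N\<^esub> n) k = \<phi> p * C n k"
    and b_closed: "i < r \<Longrightarrow> b i \<in> carrier N"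
    and C_b: "i < r \<Longrightarrow> k < r \<Longrightarrow> C (b i) k = (if i = k then 1 else 0)"
    and generated: "\<And>S. (\<And>i. i < r \<Longrightarrow> b i \<in> S) \<Longrightarrow> \<zero>\<^bsub>N\<^esub> \<in> S \<Longrightarrow>
      (\<And>n n'. n \<in> carrier N \<Longrightarrow> n' \<in> carrier N \<Longrightarrow> n \<in> S \<Longrightarrow> n' \<in> S \<Longrightarrow> n \<oplus>\<^bsub>N\<^esub> n' \<in> S) \<Longrightarrow>
      (\<And>p n. n \<in> carrier N \<Longrightarrow> n \<in> S \<Longrightarrow> p \<odot>\<^bsub>N\<^esub> n \<in> S) \<Longrightarrow>
      (\<And>p n. n \<in> carrier N \<Longrightarrow> p \<noteq> 0 \<Longrightarrow> p \<odot>\<^bsub>N\<^esub> n \<in> S \<Longrightarrow> n \<in> S) \<Longrightarrow> carrier N \<subseteq> S"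
begin

text \<open>The additive map on the free group with \<open>a \<otimes> n \<mapsto> a C(n)\<close>.
  It kills the relations, so \<open>coord\<close> may evaluate it at an arbitrary
  representative.\<close>

definition ev :: "('a \<times> 'n \<Rightarrow>\<^sub>0 int) \<Rightarrow> nat \<Rightarrow> 'a" where
  "ev f k = (\<Sum>y\<in>Poly_Mapping.keys f. of_int (Poly_Mapping.lookup f y) * (fst y * C (snd y) k))"

lemma ev_superset:
  assumes "finite A" "Poly_Mapping.keys f \<subseteq> A"
  shows "ev f k = (\<Sum>y\<in>A. of_int (Poly_Mapping.lookup f y) * (fst y * C (snd y) k))"
  unfolding ev_def using assms by (intro sum.mono_neutral_left) (auto simp: in_keys_iff)

lemma ev_add: "ev (f + g) k = ev f k + ev g k"
proof -
  let ?A = "Poly_Mapping.keys f \<union> Poly_Mapping.keys g"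
  show ?thesis
    using ev_superset[of ?A "f + g" k] ev_superset[of ?A f k] ev_superset[of ?A g k] Poly_Mapping.keys_add[of f g]
    by (simp add: lookup_add distrib_right sum.distrib)
qed

lemma ev_uminus: "ev (- f) k = - ev f k"
  by (simp add: ev_def keys_minus sum_negf)

lemma ev_diff: "ev (f - g) k = ev f k - ev g k"
  using ev_add[of f "- g"] by (simp add: ev_uminus)

lemma ev_of [simp]: "ev (frag_of (a, n)) k = a * C n k"
  by (simp add: ev_def)

lemma ev_zero [simp]: "ev 0 k = 0"
  by (simp add: ev_def)

lemma ev_null: "z \<in> Z \<Longrightarrow> ev z k = 0"
  by (induction z rule: null_induct)
    (auto simp: ev_add ev_diff ev_uminus C_add C_smult algebra_simps)

definition coord :: "('a \<times> 'n \<Rightarrow>\<^sub>0 int) set \<Rightarrow> nat \<Rightarrow> 'a" where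
  "coord t = ev (SOME f. f \<in> t)"

lemma coord_cls [simp]: "coord (cls f) k = ev f k"
proof -
  have "(SOME g. g \<in> cls f) \<in> cls f"
    by (rule someI[of _ f]) (simp add: mem_cls null_zero)
  then show ?thesis
    using ev_null[of "(SOME g. g \<in> cls f) - f" k] by (simp add: mem_cls ev_diff coord_def)
qed

lemma coord_zero [simp]: "coord \<zero>\<^bsub>T\<^esub> k = 0"
  by (simp add: zero_T)

lemma coord_add: "s \<in> carrier T \<Longrightarrow> t \<in> carrier T \<Longrightarrow> coord (s \<oplus>\<^bsub>T\<^esub> t) k = coord s k + coord t k"
  unfolding carrier_T by (auto simp: add_T ev_add simp del: F_simps)

lemma coord_smult: "t \<in> carrier T \<Longrightarrow> coord (a \<odot>\<^bsub>T\<^esub> t) k = a * coord t k"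
proof -
  have "ev (frag_extend (scl a) f) k = a * ev f k" if "f \<in> carrier F" for f
    using that by (induction f rule: F_induct)
      (simp_all add: frag_extend_diff ev_diff right_diff_distrib scl_def mult.assoc)
  then show "t \<in> carrier T \<Longrightarrow> ?thesis" unfolding carrier_T by (auto simp: smult_T simp del: F_simps)
qed

lemma coord_tns [simp]: "coord (tns a n) k = a * C n k"
  by (simp add: tns_def)

lemma coord_finsum:
  assumes "\<And>i. i \<in> I \<Longrightarrow> t i \<in> carrier T"
  shows "coord (\<Oplus>\<^bsub>T\<^esub>i\<in>I. t i) k = (\<Sum>i\<in>I. coord (t i) k)"
  using assms
proof (induction I rule: infinite_finite_induct)
  case (insert i I)
  then have "t \<in> I \<rightarrow> carrier T" "t i \<in> carrier T" by auto
  with insert show ?case by (simp add: coord_add)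
qed auto

definition bas :: "('a \<times> 'n \<Rightarrow>\<^sub>0 int) set set" where
  "bas = (\<lambda>i. tns 1 (b i)) ` {..<r}"

lemma bas_closed: "bas \<subseteq> carrier T"
  by (auto simp: bas_def b_closed)

lemma finite_bas: "finite bas"
  by (simp add: bas_def)

lemma inj_bas: "inj_on (\<lambda>i. tns 1 (b i)) {..<r}"
proof
  fix i j assume ij: "i \<in> {..<r}" "j \<in> {..<r}" "tns 1 (b i) = tns 1 (b j)"
  have "C (b i) i = C (b j) i" using arg_cong[OF ij(3), of "\<lambda>t. coord t i"] by simp
  then show "i = j" using ij(1,2) by (auto simp: C_b split: if_splits)
qed

lemma T_subset_bas:
  assumes "\<zero>\<^bsub>T\<^esub> \<in> S" "\<And>s t. s \<in> S \<Longrightarrow> t \<in> S \<Longrightarrow> s \<oplus>\<^bsub>T\<^esub> t \<in> S" "\<And>a s. s \<in> S \<Longrightarrow> a \<odot>\<^bsub>T\<^esub> s \<in> S"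
    "\<And>i. i < r \<Longrightarrow> tns 1 (b i) \<in> S"
  shows "carrier T \<subseteq> S"
proof (rule T_subset)
  have "carrier N \<subseteq> {n. tns 1 n \<in> S}"
  proof (rule generated)
    show "\<zero>\<^bsub>N\<^esub> \<in> {n. tns 1 n \<in> S}" using assms by (simp add: tns_zero)
    fix n n' assume "n \<in> carrier N" "n' \<in> carrier N" "n \<in> {n. tns 1 n \<in> S}" "n' \<in> {n. tns 1 n \<in> S}"
    then show "n \<oplus>\<^bsub>N\<^esub> n' \<in> {n. tns 1 n \<in> S}" using assms by (simp add: tns_add_right)
  next
    fix p n assume "n \<in> carrier N" "n \<in> {n. tns 1 n \<in> S}"
    then show "p \<odot>\<^bsub>N\<^esub> n \<in> {n. tns 1 n \<in> S}"
      using assms(3)[of "tns 1 n" "\<phi> p"] by (simp add: tns_smult smult_tns)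
  next
    fix p n assume "n \<in> carrier N" "p \<noteq> 0" "p \<odot>\<^bsub>N\<^esub> n \<in> {n. tns 1 n \<in> S}"
    then have "tns (\<phi> p) n \<in> S" by (simp add: tns_smult)
    then have "tns (inverse (\<phi> p) * \<phi> p) n \<in> S"
      using assms(3)[of "tns (\<phi> p) n" "inverse (\<phi> p)"] by (simp add: smult_tns)
    then show "n \<in> {n. tns 1 n \<in> S}" using \<open>p \<noteq> 0\<close> by (simp add: hom_eq_0_iff)
  qed (use assms in auto)
  then show "\<And>n. n \<in> carrier N \<Longrightarrow> tns 1 n \<in> S" by blast
qed (use assms in auto)

lemma span_bas: "T.span bas = carrier T"
proof
  interpret sub: submodule class_ring "T.span bas" T
    by (rule T.span_is_submodule[OF bas_closed])
  show "carrier T \<subseteq> T.span bas"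
  proof (rule T_subset_bas)
    show "tns 1 (b i) \<in> T.span bas" if "i < r" for i
      using T.in_own_span[OF bas_closed] that by (auto simp: bas_def)
  qed (simp_all add: sub.zero_closed sub.m_closed sub.smult_closed)
  show "T.span bas \<subseteq> carrier T" by (rule T.span_is_subset2[OF bas_closed])
qed

lemma coord_lincomb_bas:
  assumes "i < r"
  shows "coord (T.lincomb a bas) i = a (tns 1 (b i))"
proof -
  have "coord (T.lincomb a bas) i = (\<Sum>v\<in>bas. coord (a v \<odot>\<^bsub>T\<^esub> v) i)"
    unfolding T.lincomb_def using bas_closed by (intro coord_finsum) auto
  also have "\<dots> = (\<Sum>v\<in>bas. a v * coord v i)"
    using bas_closed by (intro sum.cong) (auto simp: coord_smult)
  also have "\<dots> = (\<Sum>j<r. a (tns 1 (b j)) * coord (tns 1 (b j)) i)"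
    unfolding bas_def by (simp add: sum.reindex[OF inj_bas])
  also have "\<dots> = (\<Sum>j<r. if j = i then a (tns 1 (b j)) else 0)"
    using assms by (intro sum.cong) (auto simp: C_b)
  finally show ?thesis using assms by simp
qed

lemma basis_bas: "T.basis bas"
  unfolding T.basis_def
proof (intro conjI bas_closed span_bas)
  show "T.lin_indpt bas"
  proof (rule T.finite_lin_indpt2[OF finite_bas bas_closed])
    fix a assume "T.lincomb a bas = \<zero>\<^bsub>T\<^esub>"
    then have "a (tns 1 (b i)) = 0" if "i < r" for i
      using coord_lincomb_bas[OF that, of a] by simp
    then show "\<forall>v\<in>bas. a v = \<zero>\<^bsub>class_ring\<^esub>" by (auto simp: bas_def)
  qed
qed

lemma fin_dim_T: "T.fin_dim"
  unfolding T.fin_dim_def using finite_bas bas_closed span_bas by blast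

lemma dim_T: "T.dim = r"
  using T.dim_basis[OF finite_bas basis_bas] card_image[OF inj_bas] by (simp add: bas_def)

lemma coord_eq_0_imp:
  assumes "t \<in> carrier T" "\<And>i. i < r \<Longrightarrow> coord t i = 0"
  shows "t = \<zero>\<^bsub>T\<^esub>"
proof -
  obtain a where a: "t = T.lincomb a bas"
    using T.finite_in_span[OF finite_bas bas_closed, of t] assms(1) span_bas by auto
  have "a (tns 1 (b i)) = 0" if "i < r" for i
    using coord_lincomb_bas[OF that, of a] assms(2)[OF that] a by simp
  then have "a v = 0" if "v \<in> bas" for v using that by (auto simp: bas_def)
  then have "T.lincomb a bas = (\<Oplus>\<^bsub>T\<^esub>v\<in>bas. \<zero>\<^bsub>T\<^esub>)"
    unfolding T.lincomb_def using bas_closed T.smult_l_null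
    by (intro T.finsum_cong') (auto simp: subset_iff)
  then show ?thesis using a by simp
qed

text \<open>Serves to recognise an element of the Laurent extension, and thereby its membership in a
  lattice, from its coordinates.\<close>

lemma coord_inj:
  assumes "s \<in> carrier T" "t \<in> carrier T" "\<And>i. i < r \<Longrightarrow> coord s i = coord t i"
  shows "s = t"
proof -
  have m: "(- 1) \<odot>\<^bsub>T\<^esub> t \<in> carrier T" using assms by (simp add: T.smult_closed)
  have "s \<oplus>\<^bsub>T\<^esub> (- 1) \<odot>\<^bsub>T\<^esub> t = \<zero>\<^bsub>T\<^esub>"
    using assms m by (intro coord_eq_0_imp) (auto simp: coord_add coord_smult)
  moreover have "(- 1) \<odot>\<^bsub>T\<^esub> t = \<ominus>\<^bsub>T\<^esub> t"
    using T.smult_l_minus[of 1 t] T.smult_one[of t] assms by (simp add: class_ring_simps)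
  ultimately show ?thesis
    using assms by (metis T.minus_equality T.minus_minus T.a_inv_closed)
qed

end

section \<open>Modules of finite rank over the polynomial ring\<close>

text \<open>The laws are demanded on the image of \<open>\<phi>\<close> only, since the ring acting
  on \<open>M\<close> may be the noncommutative Weyl algebra. Applied to
  \<open>\<complex>[x]\<close> and \<open>\<complex>\<close> inside the Weyl algebra and to
  \<open>\<complex>[[x]]\<close> inside \<open>\<complex>((x))\<close>.\<close>

lemma module_restrict_scalars:
  fixes \<phi> :: "'a::comm_ring_1 \<Rightarrow> 'b" and M :: "('b, 'm) module" (structure)
  assumes "abelian_group M"
    and "\<And>a x. x \<in> carrier M \<Longrightarrow> \<phi> a \<odot> x \<in> carrier M"
    and "\<And>a b x. x \<in> carrier M \<Longrightarrow> \<phi> (a + b) \<odot> x = \<phi> a \<odot> x \<oplus> \<phi> b \<odot> x"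
    and "\<And>a x y. x \<in> carrier M \<Longrightarrow> y \<in> carrier M \<Longrightarrow> \<phi> a \<odot> (x \<oplus> y) = \<phi> a \<odot> x \<oplus> \<phi> a \<odot> y"
    and "\<And>a b x. x \<in> carrier M \<Longrightarrow> \<phi> (a * b) \<odot> x = \<phi> a \<odot> (\<phi> b \<odot> x)"
    and "\<And>x. x \<in> carrier M \<Longrightarrow> \<phi> 1 \<odot> x = x"
  shows "module class_ring (restrict_scalars \<phi> M)"
proof (rule moduleI)
  interpret abelian_group M by fact
  show "cring (class_ring :: 'a ring)" ..
  show "abelian_group (restrict_scalars \<phi> M)"
  proof (rule abelian_groupI)
    fix x assume "x \<in> carrier (restrict_scalars \<phi> M)"
    then show "\<exists>y\<in>carrier (restrict_scalars \<phi> M). y \<oplus>\<^bsub>restrict_scalars \<phi> M\<^esub> x = \<zero>\<^bsub>restrict_scalars \<phi> M\<^esub>"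
      by (intro bexI[of _ "\<ominus> x"]) (auto simp: restrict_scalars_def l_neg)
  qed (auto simp: restrict_scalars_def a_ac)
qed (use assms in \<open>auto simp: restrict_scalars_def\<close>)

locale poly_module = module "class_ring :: complex poly ring" N
  for N :: "(complex poly, 'n) module" (structure)
begin

lemma sm_closed: "x \<in> carrier N \<Longrightarrow> p \<odot> x \<in> carrier N"
  by simp

lemma sm_add: "x \<in> carrier N \<Longrightarrow> (p + q) \<odot> x = p \<odot> x \<oplus> q \<odot> x"
  using smult_l_distr[of p q x] by simp

lemma sm_mult: "x \<in> carrier N \<Longrightarrow> (p * q) \<odot> x = p \<odot> (q \<odot> x)"
  using smult_assoc1[of p q x] by simp

lemma sm_one: "x \<in> carrier N \<Longrightarrow> 1 \<odot> x = x"
  using smult_one[of x] by simp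

lemma sm_zero: "x \<in> carrier N \<Longrightarrow> 0 \<odot> x = \<zero>"
  using smult_l_null[of x] by simp

lemma sm_uminus: "x \<in> carrier N \<Longrightarrow> (- p) \<odot> x = \<ominus> (p \<odot> x)"
  using smult_l_minus[of p x] by (simp add: class_ring_simps)

definition lc :: "nat \<Rightarrow> (nat \<Rightarrow> complex poly) \<Rightarrow> (nat \<Rightarrow> 'n) \<Rightarrow> 'n" where
  "lc r q v = (\<Oplus>i\<in>{..<r}. q i \<odot> v i)"

definition indep :: "nat \<Rightarrow> (nat \<Rightarrow> 'n) \<Rightarrow> bool" where
  "indep r v \<longleftrightarrow> (\<forall>i<r. v i \<in> carrier N) \<and> (\<forall>q. lc r q v = \<zero> \<longrightarrow> (\<forall>i<r. q i = 0))"

lemma lc_closed: "(\<And>i. i < r \<Longrightarrow> v i \<in> carrier N) \<Longrightarrow> lc r q v \<in> carrier N"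
  unfolding lc_def by (intro finsum_closed) auto

lemma lc_add:
  assumes "\<And>i. i < r \<Longrightarrow> v i \<in> carrier N"
  shows "lc r (\<lambda>i. p i + q i) v = lc r p v \<oplus> lc r q v"
proof -
  have "lc r (\<lambda>i. p i + q i) v = (\<Oplus>i\<in>{..<r}. p i \<odot> v i \<oplus> q i \<odot> v i)"
    unfolding lc_def using assms by (intro finsum_cong') (auto simp: sm_add)
  also have "\<dots> = lc r p v \<oplus> lc r q v"
    unfolding lc_def using assms by (intro finsum_addf) auto
  finally show ?thesis .
qed

lemma lc_smult:
  assumes "\<And>i. i < r \<Longrightarrow> v i \<in> carrier N"
  shows "lc r (\<lambda>i. p * q i) v = p \<odot> lc r q v"
proof -
  have "p \<odot> lc r q v = (\<Oplus>i\<in>{..<r}. p \<odot> (q i \<odot> v i))"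
    unfolding lc_def using assms by (intro finsum_smult_ldistr) auto
  also have "\<dots> = lc r (\<lambda>i. p * q i) v"
    unfolding lc_def using assms by (intro finsum_cong') (auto simp: sm_mult)
  finally show ?thesis by simp
qed

lemma lc_diff:
  assumes "\<And>i. i < r \<Longrightarrow> v i \<in> carrier N"
  shows "lc r (\<lambda>i. p i - q i) v = lc r p v \<ominus> lc r q v"
  using lc_add[where r = r and v = v and p = p and q = "\<lambda>i. - 1 * q i", OF assms]
    lc_smult[where r = r and v = v and p = "- 1" and q = q, OF assms] lc_closed[of r v q] assms
  by (simp add: sm_uminus sm_one a_minus_def)

lemma lc_Suc:
  assumes "\<And>i. i < Suc r \<Longrightarrow> v i \<in> carrier N"
  shows "lc (Suc r) q v = lc r q v \<oplus> q r \<odot> v r"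
proof -
  have "v r \<in> carrier N" "(\<lambda>i. q i \<odot> v i) \<in> {..<r} \<rightarrow> carrier N" using assms by auto
  then show ?thesis
    unfolding lc_def lessThan_Suc by (simp add: a_comm)
qed

lemma lc_cong:
  assumes "\<And>i. i < r \<Longrightarrow> q i = q' i" "\<And>i. i < r \<Longrightarrow> v i = v' i" "\<And>i. i < r \<Longrightarrow> v' i \<in> carrier N"
  shows "lc r q v = lc r q' v'"
  unfolding lc_def using assms by (intro finsum_cong') auto

lemma lc_delta:
  assumes "\<And>i. i < r \<Longrightarrow> v i \<in> carrier N" "j < r"
  shows "lc r (\<lambda>i. if i = j then 1 else 0) v = v j"
proof -
  have "lc r (\<lambda>i. if i = j then 1 else 0) v = (\<Oplus>i\<in>{..<r}. if j = i then v i else \<zero>)"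
    unfolding lc_def using assms by (intro finsum_cong') (auto simp: sm_one sm_zero)
  also have "\<dots> = v j"
    using assms by (intro finsum_singleton) auto
  finally show ?thesis .
qed

lemma sm_shift:
  assumes "x \<in> carrier N" "y \<in> carrier N" "x \<oplus> p \<odot> y = \<zero>"
  shows "(- p) \<odot> y = x"
  using assms by (metis sm_closed sm_uminus minus_equality)

text \<open>Appending \<open>x\<close> to a family of maximal length produces a relation; the
  coefficient of \<open>x\<close> in it cannot vanish, because the family itself is
  independent.\<close>

lemma indep_extends:
  assumes v: "indep r v" "\<And>r' v'. indep r' v' \<Longrightarrow> r' \<le> r" and x: "x \<in> carrier N"
  shows "\<exists>p q. p \<noteq> 0 \<and> p \<odot> x = lc r q v"
proof -
  let ?v = "v(r := x)"
  have vc: "\<And>i. i < r \<Longrightarrow> v i \<in> carrier N" using v(1) by (auto simp: indep_def)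
  have vc': "\<And>i. i < Suc r \<Longrightarrow> ?v i \<in> carrier N" using vc x by (auto simp: less_Suc_eq)
  have "\<not> indep (Suc r) ?v" using v(2)[of "Suc r" ?v] by auto
  then obtain q where q: "lc (Suc r) q ?v = \<zero>" "\<exists>i<Suc r. q i \<noteq> 0"
    using vc' unfolding indep_def by blast
  have "lc r q ?v = lc r q v" using vc by (intro lc_cong) auto
  then have eq: "lc r q v \<oplus> q r \<odot> x = \<zero>" using q(1) lc_Suc[where r = r and v = ?v and q = q, OF vc'] by simp
  have "q r \<noteq> 0"
  proof
    assume "q r = 0"
    then have "lc r q v = \<zero>" using eq x lc_closed[where r = r and v = v and q = q, OF vc] by (simp add: sm_zero)
    then have "\<forall>i<r. q i = 0" using v(1) unfolding indep_def by blast
    with q(2) \<open>q r = 0\<close> show False by (auto simp: less_Suc_eq)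
  qed
  then show ?thesis
    using sm_shift[OF lc_closed[OF vc] x eq] by (intro exI[of _ "- q r"] exI[of _ q]) auto
qed

lemma maximal_indep_exists:
  assumes "\<And>r v. indep r v \<Longrightarrow> r \<le> B"
  shows "\<exists>r v. indep r v \<and> (\<forall>r' v'. indep r' v' \<longrightarrow> r' \<le> r)"
proof -
  let ?P = "\<lambda>r. \<exists>v. indep r v"
  have "?P 0" by (simp add: indep_def)
  moreover have "\<forall>r. ?P r \<longrightarrow> r \<le> B" using assms by blast
  ultimately have G: "?P (Greatest ?P)" "\<And>r'. ?P r' \<Longrightarrow> r' \<le> Greatest ?P"
    using GreatestI_nat[of ?P 0 B] Greatest_le_nat[of ?P _ B] by auto
  from G(1) obtain v where "indep (Greatest ?P) v" ..
  with G(2) show ?thesis by (intro exI[of _ "Greatest ?P"] exI[of _ v]) auto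
qed

end

locale finite_rank_module = poly_module N
  for N :: "(complex poly, 'n) module" (structure) +
  fixes n :: nat and b :: "nat \<Rightarrow> 'n"
  assumes indep_b: "indep n b"
    and maximal_b: "indep r v \<Longrightarrow> r \<le> n"
begin

lemma b_closed: "i < n \<Longrightarrow> b i \<in> carrier N"
  using indep_b by (auto simp: indep_def)

text \<open>The coordinates of \<open>1 \<otimes> x\<close> in
  \<open>\<complex>(x) \<otimes> N\<close> with respect to \<open>b\<close>, read off from an
  equation \<open>p x = q\<^sub>0 b\<^sub>0 + ...\<close> in \<open>N\<close>. Independence of
  \<open>b\<close> makes the fractions \<open>q k / p\<close> unique, and vectors with zero
  coordinates are exactly the torsion elements.\<close>

definition rat_coords :: "'n \<Rightarrow> nat \<Rightarrow> complex poly fract" where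
  "rat_coords x = (SOME c. \<exists>p q. p \<noteq> 0 \<and> p \<odot> x = lc n q b \<and>
     c = (\<lambda>k. if k < n then to_fract (q k) / to_fract p else 0))"

lemma coords_ex: "x \<in> carrier N \<Longrightarrow> \<exists>p q. p \<noteq> 0 \<and> p \<odot> x = lc n q b"
  by (rule indep_extends[OF indep_b maximal_b])

lemma coords_eqI:
  assumes x: "x \<in> carrier N" and pq: "p \<noteq> 0" "p \<odot> x = lc n q b"
  shows "rat_coords x k = (if k < n then to_fract (q k) / to_fract p else 0)"
proof -
  let ?P = "\<lambda>c. \<exists>p q. p \<noteq> 0 \<and> p \<odot> x = lc n q b \<and>
     c = (\<lambda>k. if k < n then to_fract (q k) / to_fract p else 0)"
  have "?P (\<lambda>k. if k < n then to_fract (q k) / to_fract p else 0)" using pq by blast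
  then have "?P (rat_coords x)" unfolding rat_coords_def by (rule someI[of ?P])
  then obtain p' q' where pq': "p' \<noteq> 0" "p' \<odot> x = lc n q' b"
    "rat_coords x = (\<lambda>k. if k < n then to_fract (q' k) / to_fract p' else 0)" by blast
  have "lc n (\<lambda>i. p' * q i - p * q' i) b = p' \<odot> (p \<odot> x) \<ominus> p \<odot> (p' \<odot> x)"
    using b_closed by (simp add: lc_diff lc_smult pq(2) pq'(2))
  also have "p' \<odot> (p \<odot> x) = p \<odot> (p' \<odot> x)"
    using x by (metis sm_mult mult.commute)
  finally have "lc n (\<lambda>i. p' * q i - p * q' i) b = \<zero>"
    using x by (simp add: a_minus_def r_neg)
  then have "p' * q k = p * q' k" if "k < n"
    using that indep_b unfolding indep_def by (auto dest!: spec[of _ "\<lambda>i. p' * q i - p * q' i"])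
  then have "to_fract p' * to_fract (q k) = to_fract p * to_fract (q' k)" if "k < n"
    using that by (metis to_fract_mult)
  then show ?thesis using pq' pq by (auto simp: field_simps)
qed

lemma coords_support: "x \<in> carrier N \<Longrightarrow> n \<le> k \<Longrightarrow> rat_coords x k = 0"
  using coords_ex coords_eqI by (metis linorder_not_less)

lemma coords_add:
  assumes x: "x \<in> carrier N" and y: "y \<in> carrier N"
  shows "rat_coords (x \<oplus> y) k = rat_coords x k + rat_coords y k"
proof -
  obtain p q where pq: "p \<noteq> 0" "p \<odot> x = lc n q b" using coords_ex[OF x] by blast
  obtain p' q' where pq': "p' \<noteq> 0" "p' \<odot> y = lc n q' b" using coords_ex[OF y] by blast
  have "(p * p') \<odot> (x \<oplus> y) = p' \<odot> (p \<odot> x) \<oplus> p \<odot> (p' \<odot> y)"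
    using x y sm_mult[of x p' p] sm_mult[of y p p'] by (simp add: smult_r_distr mult.commute)
  also have "\<dots> = lc n (\<lambda>i. p' * q i + p * q' i) b"
    using b_closed by (simp add: lc_add lc_smult pq(2) pq'(2))
  finally have "(p * p') \<odot> (x \<oplus> y) = lc n (\<lambda>i. p' * q i + p * q' i) b" .
  from coords_eqI[OF _ _ this] coords_eqI[OF x pq] coords_eqI[OF y pq'] x y pq(1) pq'(1)
  show ?thesis by (simp add: add_frac_eq mult.commute)
qed

lemma coords_smult:
  assumes x: "x \<in> carrier N"
  shows "rat_coords (r \<odot> x) k = to_fract r * rat_coords x k"
proof -
  obtain p q where pq: "p \<noteq> 0" "p \<odot> x = lc n q b" using coords_ex[OF x] by blast
  have "p \<odot> (r \<odot> x) = r \<odot> (p \<odot> x)" using x by (metis sm_mult mult.commute)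
  also have "\<dots> = lc n (\<lambda>i. r * q i) b" using b_closed by (simp add: lc_smult pq(2))
  finally have "p \<odot> (r \<odot> x) = lc n (\<lambda>i. r * q i) b" .
  from coords_eqI[OF sm_closed[OF x] pq(1) this] coords_eqI[OF x pq]
  show ?thesis by simp
qed

lemma coords_b: "i < n \<Longrightarrow> rat_coords (b i) k = (if k = i then 1 else 0)"
proof -
  assume i: "i < n"
  have "1 \<odot> b i = lc n (\<lambda>j. if j = i then 1 else 0) b"
    using i b_closed by (simp add: lc_delta sm_one)
  from coords_eqI[OF b_closed[OF i] _ this] i show ?thesis by auto
qed

lemma coords_zero: "rat_coords \<zero> k = 0"
  using coords_smult[of \<zero> 0 k] by simp

lemma coords_eq_0_imp_torsion:
  assumes x: "x \<in> carrier N" and 0: "\<And>k. k < n \<Longrightarrow> rat_coords x k = 0"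
  shows "\<exists>p. p \<noteq> 0 \<and> p \<odot> x = \<zero>"
proof -
  obtain p q where pq: "p \<noteq> 0" "p \<odot> x = lc n q b" using coords_ex[OF x] by blast
  have "q k = 0" if "k < n" for k
    using coords_eqI[OF x pq, of k] 0[OF that] that pq(1) by simp
  then have "lc n q b = lc n (\<lambda>_. 0 * 0) b" using b_closed by (intro lc_cong) auto
  also have "\<dots> = 0 \<odot> lc n (\<lambda>_. 0) b" using b_closed by (intro lc_smult) auto
  also have "\<dots> = \<zero>" using b_closed by (intro sm_zero lc_closed)
  finally show ?thesis using pq by auto
qed

text \<open>The rational coordinates, pushed along the extension of \<open>\<phi>\<close>, are dual
  to \<open>b\<close>. Every element of \<open>N\<close> has a nonzero multiple that is a
  combination of \<open>b\<close>, hence lies in the closure under division.\<close>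

lemma tensor_basis_coords:
  assumes "poly_embedding \<phi>"
  shows "tensor_basis \<phi> N (\<lambda>x k. fract_ext \<phi> (rat_coords x k)) n b"
proof -
  interpret poly_embedding \<phi> by fact
  show ?thesis
  proof
    show "fract_ext \<phi> (rat_coords (b i) k) = (if i = k then 1 else 0)" if "i < n" "k < n" for i k
      using that by (auto simp: coords_b)
    fix S assume S: "\<And>i. i < n \<Longrightarrow> b i \<in> S" "\<zero> \<in> S"
      "\<And>x y. x \<in> carrier N \<Longrightarrow> y \<in> carrier N \<Longrightarrow> x \<in> S \<Longrightarrow> y \<in> S \<Longrightarrow> x \<oplus> y \<in> S"
      "\<And>p x. x \<in> carrier N \<Longrightarrow> x \<in> S \<Longrightarrow> p \<odot> x \<in> S"
      "\<And>p x. x \<in> carrier N \<Longrightarrow> p \<noteq> 0 \<Longrightarrow> p \<odot> x \<in> S \<Longrightarrow> x \<in> S"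
    have "lc r q b \<in> S" if "r \<le> n" for r q
      using that
    proof (induction r)
      case 0
      then show ?case using S(2) by (simp add: lc_def)
    next
      case (Suc r)
      have b: "\<And>i. i < Suc r \<Longrightarrow> b i \<in> carrier N" using b_closed Suc.prems by auto
      have c: "lc r q b \<in> carrier N" using b by (intro lc_closed) auto
      have "q r \<odot> b r \<in> S" using Suc.prems b by (intro S(4) S(1)) auto
      then have "lc r q b \<oplus> q r \<odot> b r \<in> S"
        using Suc b c by (intro S(3)) auto
      then show ?case by (simp add: lc_Suc[OF b])
    qed
    then have lcS: "lc n q b \<in> S" for q by simp
    show "carrier N \<subseteq> S"
    proof
      fix x assume x: "x \<in> carrier N"
      then obtain p q where "p \<noteq> 0" "p \<odot> x = lc n q b" using coords_ex by blast
      then show "x \<in> S" using S(5)[OF x, of p] lcS[of q] by simp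
    qed
  qed (simp_all add: coords_add coords_smult b_closed)
qed

end

section \<open>The Weyl algebra and its V-filtration\<close>

lemma laurent_induct [case_names single sum]:
  fixes f :: laurent
  assumes "\<And>n c. P (Poly_Mapping.single n c)" "\<And>f g. P f \<Longrightarrow> P g \<Longrightarrow> P (f + g)"
  shows "P f"
proof (induction f rule: update_induct)
  case const
  then show ?case using assms(1)[of 0 0] by simp
next
  case (update f a b)
  have "Poly_Mapping.update a b f = f + Poly_Mapping.single a b"
    using update.hyps by (intro poly_mapping_eqI)
      (auto simp: lookup_update lookup_add lookup_single when_def in_keys_iff)
  then show ?case using assms update.IH by simp
qed

lemma lookup_single_times:
  fixes g :: laurent
  shows "Poly_Mapping.lookup (Poly_Mapping.single a c * g) k = c * Poly_Mapping.lookup g (k - a)"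
proof (induction g rule: laurent_induct)
  case (single n d)
  then show ?case by (auto simp: mult_single lookup_single when_def)
next
  case (sum f g)
  then show ?case by (simp add: distrib_left lookup_add)
qed

abbreviation euler_op :: "laurent \<Rightarrow> laurent" ("\<theta>") where "\<theta> \<equiv> x_op \<circ> d_op"

lemma lookup_const_op [simp]: "Poly_Mapping.lookup (const_op c f) k = c * Poly_Mapping.lookup f k"
  by (simp add: const_op_def lookup_single_times)

lemma lookup_x_op [simp]: "Poly_Mapping.lookup (x_op f) k = Poly_Mapping.lookup f (k - 1)"
  by (simp add: x_op_def lookup_single_times)

lemma lookup_d_op [simp]:
  "Poly_Mapping.lookup (d_op f) k = of_int (k + 1) * Poly_Mapping.lookup f (k + 1)"
proof -
  have "Poly_Mapping.lookup (d_op f) k =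
    (\<Sum>n\<in>Poly_Mapping.keys f. if n = k + 1 then of_int n * Poly_Mapping.lookup f n else 0)"
    unfolding d_op_def lookup_sum by (intro sum.cong) (auto simp: lookup_single when_def)
  then show ?thesis by (simp add: in_keys_iff)
qed

lemma lookup_x_op_funpow [simp]:
  "Poly_Mapping.lookup ((x_op ^^ a) f) k = Poly_Mapping.lookup f (k - int a)"
  by (induction a arbitrary: k) (auto simp: algebra_simps)

text \<open>A normally ordered monomial shifts exponents by \<open>a - b\<close> and rescales. Only
  the shift matters for the V-filtration, so the scalar is left as an unspecified
  \<open>g\<close>.\<close>

lemma x_op_d_op_homogeneous:
  "\<exists>g. \<forall>f k. Poly_Mapping.lookup ((x_op ^^ a) ((d_op ^^ b) f)) k = g k * Poly_Mapping.lookup f (k - int a + int b)"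
proof -
  have "\<exists>g. \<forall>f k. Poly_Mapping.lookup ((d_op ^^ b) f) k = g k * Poly_Mapping.lookup f (k + int b)"
  proof (induction b)
    case 0
    then show ?case by (intro exI[of _ "\<lambda>_. 1"]) auto
  next
    case (Suc b)
    then obtain g where "\<forall>f k. Poly_Mapping.lookup ((d_op ^^ b) f) k = g k * Poly_Mapping.lookup f (k + int b)" by blast
    then show ?case by (intro exI[of _ "\<lambda>k. of_int (k + 1) * g (k + 1)"]) (auto simp: algebra_simps)
  qed
  then obtain g where "\<forall>f k. Poly_Mapping.lookup ((d_op ^^ b) f) k = g k * Poly_Mapping.lookup f (k + int b)" by blast
  then show ?thesis by (intro exI[of _ "\<lambda>k. g (k - int a)"]) auto
qed

lemma laurent_of_poly_lookup:
  "Poly_Mapping.lookup (laurent_of_poly p) k = (if k \<ge> 0 then coeff p (nat k) else 0)"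
proof -
  have "Poly_Mapping.lookup (laurent_of_poly p) k = (\<Sum>n\<le>degree p. if int n = k then coeff p n else 0)"
    unfolding laurent_of_poly_def lookup_sum by (intro sum.cong) (auto simp: lookup_single when_def)
  also have "\<dots> = (\<Sum>n\<in>{..degree p} \<inter> {n. int n = k}. coeff p n)"
    by (simp add: sum.If_cases)
  also have "\<dots> = (if k \<ge> 0 then coeff p (nat k) else 0)"
  proof (cases "k \<ge> 0 \<and> nat k \<le> degree p")
    case True
    then have "{..degree p} \<inter> {n. int n = k} = {nat k}" by auto
    with True show ?thesis by simp
  next
    case False
    then have "{..degree p} \<inter> {n. int n = k} = {}" by auto
    with False show ?thesis by (auto simp: coeff_eq_0)
  qed
  finally show ?thesis .
qed

lemma laurent_of_poly_add: "laurent_of_poly (p + q) = laurent_of_poly p + laurent_of_poly q"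
  by (intro poly_mapping_eqI) (simp add: laurent_of_poly_lookup lookup_add)

lemma laurent_of_poly_pCons:
  "laurent_of_poly (pCons a p) = Poly_Mapping.single 0 a + Poly_Mapping.single 1 1 * laurent_of_poly p"
proof (intro poly_mapping_eqI)
  fix k :: int
  show "Poly_Mapping.lookup (laurent_of_poly (pCons a p)) k =
    Poly_Mapping.lookup (Poly_Mapping.single 0 a + Poly_Mapping.single 1 1 * laurent_of_poly p) k"
    by (cases "k \<ge> 0"; cases "nat k")
      (auto simp: laurent_of_poly_lookup lookup_add lookup_single_times lookup_single when_def coeff_pCons
        nat_diff_distrib split: nat.splits)
qed

lemma laurent_of_poly_0: "laurent_of_poly 0 = 0"
  by (intro poly_mapping_eqI) (simp add: laurent_of_poly_lookup)

lemma laurent_of_poly_mult: "laurent_of_poly (p * q) = laurent_of_poly p * laurent_of_poly q"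
proof (induction p)
  case (pCons a p)
  have "laurent_of_poly (Polynomial.smult a q) = Poly_Mapping.single 0 a * laurent_of_poly q"
    by (intro poly_mapping_eqI) (simp add: laurent_of_poly_lookup lookup_single_times)
  moreover have "laurent_of_poly (pCons 0 (p * q)) = Poly_Mapping.single 1 1 * laurent_of_poly (p * q)"
    by (simp add: laurent_of_poly_pCons)
  ultimately show ?case
    using pCons.IH by (simp add: mult_pCons_left laurent_of_poly_add laurent_of_poly_pCons distrib_right mult.assoc)
qed (simp add: laurent_of_poly_0)

lemma laurent_of_poly_1: "laurent_of_poly 1 = 1"
  by (intro poly_mapping_eqI) (auto simp: laurent_of_poly_lookup lookup_one when_def)

lemma poly_op_add: "poly_op (p + q) = (\<lambda>f. poly_op p f + poly_op q f)"
  by (simp add: poly_op_def laurent_of_poly_add distrib_right fun_eq_iff)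

lemma poly_op_mult: "poly_op (p * q) = poly_op p \<circ> poly_op q"
  by (simp add: poly_op_def laurent_of_poly_mult mult.assoc fun_eq_iff)

lemma poly_op_1: "poly_op 1 = id"
  by (simp add: poly_op_def laurent_of_poly_1 fun_eq_iff)

lemma poly_op_const: "poly_op [:c:] = const_op c"
  by (simp add: poly_op_def const_op_def laurent_of_poly_pCons laurent_of_poly_0 fun_eq_iff)

lemma poly_op_X: "poly_op poly_X = x_op"
  by (simp add: poly_op_def x_op_def laurent_of_poly_pCons laurent_of_poly_0 fun_eq_iff)

lemma poly_op_weyl: "poly_op p \<in> weyl_ops"
proof (induction p)
  case 0
  have "poly_op 0 = const_op 0" using poly_op_const[of 0] by simp
  then show ?case by (simp add: weyl_ops.const)
next
  case (pCons a p)
  have "pCons a p = [:a:] + poly_X * p" by simp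
  then have "poly_op (pCons a p) = (\<lambda>f. const_op a f + (x_op \<circ> poly_op p) f)"
    by (simp only: poly_op_add poly_op_mult poly_op_const poly_op_X)
  then show ?case
    using weyl_ops.add[OF weyl_ops.const[of a] weyl_ops.comp[OF weyl_ops.x pCons(2)]] by simp
qed

lemma poly_op_X_power: "poly_op (poly_X ^ j) = x_op ^^ j"
  by (induction j) (simp_all only: power_0 poly_op_1 power_Suc poly_op_mult poly_op_X funpow.simps)

subsection \<open>Normally ordered operators\<close>

text \<open>Operators in normal form with exponent pairs from \<open>I\<close>. The V-filtration,
  the complement of one of its steps and the Bernstein filtration are all obtained by the choice of
  \<open>I\<close>, and the inductive form avoids rearranging double sums.\<close>

inductive_set xd_span :: "(nat \<times> nat) set \<Rightarrow> (laurent \<Rightarrow> laurent) set" for I where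
  zero: "(\<lambda>f. 0) \<in> xd_span I"
| step: "P \<in> xd_span I \<Longrightarrow> (a, b) \<in> I \<Longrightarrow>
    (\<lambda>f. P f + const_op c ((x_op ^^ a) ((d_op ^^ b) f))) \<in> xd_span I"

lemma xd_span_add: "P \<in> xd_span I \<Longrightarrow> Q \<in> xd_span I \<Longrightarrow> (\<lambda>f. P f + Q f) \<in> xd_span I"
proof (induction P rule: xd_span.induct)
  case (step P a b c)
  then have "(\<lambda>f. (P f + Q f) + const_op c ((x_op ^^ a) ((d_op ^^ b) f))) \<in> xd_span I"
    by (intro xd_span.step) auto
  then show ?case by (simp add: add_ac)
qed simp

lemma xd_span_mono: "P \<in> xd_span I \<Longrightarrow> I \<subseteq> J \<Longrightarrow> P \<in> xd_span J"
  by (induction P rule: xd_span.induct) (auto intro: xd_span.intros)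

lemma xd_span_monomial: "(a, b) \<in> I \<Longrightarrow> (\<lambda>f. const_op c ((x_op ^^ a) ((d_op ^^ b) f))) \<in> xd_span I"
  using xd_span.step[OF xd_span.zero, of a b I c] by simp

lemma const_op_add: "const_op c (f + g) = const_op c f + const_op c g"
  by (simp add: const_op_def distrib_left)

lemma x_op_add: "x_op (f + g) = x_op f + x_op g"
  by (simp add: x_op_def distrib_left)

lemma d_op_add: "d_op (f + g) = d_op f + d_op g"
  by (intro poly_mapping_eqI) (simp add: lookup_add distrib_left)

lemma op_zero [simp]: "const_op c 0 = 0" "x_op 0 = 0" "d_op 0 = 0"
  by (simp_all add: const_op_def x_op_def d_op_def)

lemma const_op_const_op: "const_op c (const_op d f) = const_op (c * d) f"
  by (intro poly_mapping_eqI) simp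

lemma x_op_const_op: "x_op (const_op c f) = const_op c (x_op f)"
  by (intro poly_mapping_eqI) simp

lemma d_op_const_op: "d_op (const_op c f) = const_op c (d_op f)"
  by (intro poly_mapping_eqI) simp

text \<open>The commutation rule of the Weyl algebra. For \<open>a = 0\<close> the truncated
  exponent \<open>a - 1\<close> is harmless, as its coefficient is 0.\<close>

lemma d_op_x_op_funpow:
  "d_op ((x_op ^^ a) f) = (x_op ^^ a) (d_op f) + const_op (of_nat a) ((x_op ^^ (a - 1)) f)"
  by (intro poly_mapping_eqI, cases a) (auto simp: lookup_add algebra_simps)

lemma xd_span_const: "P \<in> xd_span I \<Longrightarrow> const_op c \<circ> P \<in> xd_span I"
  by (induction P rule: xd_span.induct)
    (auto simp: o_def const_op_add const_op_const_op intro: xd_span.intros)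

lemma xd_span_x:
  assumes "P \<in> xd_span I" "\<And>a b. (a, b) \<in> I \<Longrightarrow> (Suc a, b) \<in> J"
  shows "x_op \<circ> P \<in> xd_span J"
  using assms(1)
proof (induction P rule: xd_span.induct)
  case (step P a b c)
  then show ?case using xd_span.step[OF step.IH assms(2)[OF step.hyps(2)], of c]
    by (simp add: o_def x_op_add x_op_const_op)
qed (simp add: o_def xd_span.zero)

lemma xd_span_d:
  assumes "P \<in> xd_span I" "\<And>a b. (a, b) \<in> I \<Longrightarrow> (a, Suc b) \<in> J \<and> (a - 1, b) \<in> J"
  shows "d_op \<circ> P \<in> xd_span J"
  using assms(1)
proof (induction P rule: xd_span.induct)
  case (step P a b c)
  have "(\<lambda>f. ((d_op \<circ> P) f + const_op c ((x_op ^^ a) ((d_op ^^ (Suc b)) f)))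
      + const_op (c * of_nat a) ((x_op ^^ (a - 1)) ((d_op ^^ b) f))) \<in> xd_span J"
    using step assms(2)[of a b] by (intro xd_span.step) auto
  then show ?case
    by (simp add: o_def d_op_add d_op_const_op d_op_x_op_funpow const_op_add const_op_const_op add_ac)
qed (simp add: o_def xd_span.zero)

lemma xd_span_additive:
  assumes "P \<in> xd_span I"
  shows "P (f + g) = P f + P g" "P (const_op c f) = const_op c (P f)"
proof -
  have x: "(x_op ^^ a) (f + g) = (x_op ^^ a) f + (x_op ^^ a) g" "(d_op ^^ a) (f + g) = (d_op ^^ a) f + (d_op ^^ a) g"
    "(x_op ^^ a) (const_op c f) = const_op c ((x_op ^^ a) f)" "(d_op ^^ a) (const_op c f) = const_op c ((d_op ^^ a) f)"
    for a c f g
    by (induction a) (simp_all add: x_op_add d_op_add x_op_const_op d_op_const_op)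
  show "P (f + g) = P f + P g" "P (const_op c f) = const_op c (P f)"
    using assms
    by (induction P rule: xd_span.induct)
      (simp_all add: x const_op_add const_op_const_op mult.commute add_ac)
qed

text \<open>Normal ordering. Left composition with each generator preserves the span of the
  monomials; the claim is made for all right factors \<open>Q\<close> so that it passes to
  composites, and is then applied to \<open>id\<close>.\<close>

lemma weyl_ops_eq_xd_span: "weyl_ops = xd_span UNIV"
proof
  have "\<forall>Q\<in>xd_span UNIV. P \<circ> Q \<in> xd_span UNIV" if "P \<in> weyl_ops" for P
    using that
  proof (induction P rule: weyl_ops.induct)
    case (add P Q)
    then show ?case using xd_span_add by (fastforce simp: o_def)
  next
    case (comp P Q)
    then show ?case by (metis comp_assoc)
  next
    case (const c)
    show ?case using xd_span_const by blast
  next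
    case x
    show ?case using xd_span_x by blast
  next
    case d
    show ?case using xd_span_d by blast
  qed
  moreover have "id \<in> xd_span UNIV"
    using xd_span_monomial[of 0 0 UNIV 1] by (simp add: const_op_def id_def)
  ultimately show "weyl_ops \<subseteq> xd_span UNIV" by (metis comp_id subsetI)
next
  have xd: "x_op ^^ a \<in> weyl_ops" "d_op ^^ a \<in> weyl_ops" for a
    using poly_op_weyl[of 1] by (induction a) (auto simp: poly_op_1 id_def intro: weyl_ops.intros)
  show "xd_span UNIV \<subseteq> weyl_ops"
  proof
    fix P assume "P \<in> xd_span UNIV"
    then show "P \<in> weyl_ops"
    proof (induction P rule: xd_span.induct)
      case zero
      then show ?case using weyl_ops.const[of 0] by (simp add: const_op_def)
    next
      case (step P a b c)
      have "const_op c \<circ> ((x_op ^^ a) \<circ> (d_op ^^ b)) \<in> weyl_ops"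
        by (intro weyl_ops.comp weyl_ops.const xd)
      from weyl_ops.add[OF step.IH this] show ?case by simp
    qed
  qed
qed

lemma x_ideal_iff: "f \<in> x_ideal p \<longleftrightarrow> (\<forall>m<p. Poly_Mapping.lookup f m = 0)"
proof
  assume "f \<in> x_ideal p"
  then obtain q where "f = Poly_Mapping.single p 1 * laurent_of_poly q"
    by (auto simp: x_ideal_def mult.commute)
  then show "\<forall>m<p. Poly_Mapping.lookup f m = 0"
    by (simp add: lookup_single_times laurent_of_poly_lookup)
next
  assume f: "\<forall>m<p. Poly_Mapping.lookup f m = 0"
  define q where "q = (\<Sum>m\<in>Poly_Mapping.keys f. monom (Poly_Mapping.lookup f m) (nat (m - p)))"
  have "Poly_Mapping.lookup f k = Poly_Mapping.lookup (laurent_of_poly q * Poly_Mapping.single p 1) k" for k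
  proof (cases "k < p")
    case False
    have "coeff q (nat (k - p)) = (\<Sum>m\<in>Poly_Mapping.keys f. if m = k then Poly_Mapping.lookup f m else 0)"
      unfolding q_def coeff_sum
    proof (intro sum.cong refl)
      fix m assume "m \<in> Poly_Mapping.keys f"
      then have "\<not> m < p" using f by (auto simp: in_keys_iff)
      then show "coeff (monom (Poly_Mapping.lookup f m) (nat (m - p))) (nat (k - p)) = (if m = k then Poly_Mapping.lookup f m else 0)"
        using False by auto
    qed
    then show ?thesis using False
      by (simp add: mult.commute[of "laurent_of_poly q"] lookup_single_times laurent_of_poly_lookup in_keys_iff)
  qed (use f in \<open>simp add: mult.commute[of "laurent_of_poly q"] lookup_single_times laurent_of_poly_lookup\<close>)
  then show "f \<in> x_ideal p" unfolding x_ideal_def by (blast intro: poly_mapping_eqI)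
qed

section \<open>The V-filtration in normal form\<close>

definition V_pairs :: "int \<Rightarrow> (nat \<times> nat) set" where
  "V_pairs k = {(a, b). int b - int a \<le> k}"

lemma V_pairs_homogeneous:
  assumes "P \<in> xd_span (V_pairs k)" "f \<in> x_ideal p"
  shows "P f \<in> x_ideal (p - k)"
  using assms(1)
proof (induction P rule: xd_span.induct)
  case (step P a b c)
  obtain g where "\<forall>f k. Poly_Mapping.lookup ((x_op ^^ a) ((d_op ^^ b) f)) k = g k * Poly_Mapping.lookup f (k - int a + int b)"
    using x_op_d_op_homogeneous by blast
  with step assms(2) show ?case by (auto simp: x_ideal_iff lookup_add V_pairs_def)
qed (simp add: x_ideal_iff)

lemma V_complement_homogeneous:
  assumes "P \<in> xd_span (- V_pairs k)" "n - k \<le> m"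
  shows "Poly_Mapping.lookup (P (Poly_Mapping.single n 1)) m = 0"
  using assms(1)
proof (induction P rule: xd_span.induct)
  case (step P a b c)
  obtain g where "\<forall>f k. Poly_Mapping.lookup ((x_op ^^ a) ((d_op ^^ b) f)) k = g k * Poly_Mapping.lookup f (k - int a + int b)"
    using x_op_d_op_homogeneous by blast
  with step assms(2) show ?case by (auto simp: lookup_add lookup_single V_pairs_def when_def)
qed simp

lemma xd_span_split:
  assumes "P \<in> xd_span UNIV"
  shows "\<exists>P1\<in>xd_span I. \<exists>P2\<in>xd_span (- I). P = (\<lambda>f. P1 f + P2 f)"
  using assms
proof (induction P rule: xd_span.induct)
  case zero
  then show ?case by (intro bexI[of _ "\<lambda>f. 0"]) (auto intro: xd_span.zero)
next
  case (step P a b c)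
  then obtain P1 P2 where P: "P1 \<in> xd_span I" "P2 \<in> xd_span (- I)" "P = (\<lambda>f. P1 f + P2 f)" by blast
  show ?case
  proof (cases "(a, b) \<in> I")
    case True
    from xd_span.step[OF P(1) this, of c] P(2,3) show ?thesis
      by (intro bexI[of _ "\<lambda>f. P1 f + const_op c ((x_op ^^ a) ((d_op ^^ b) f))"] bexI[of _ P2]) (auto simp: add_ac)
  next
    case False
    then have "(a, b) \<in> - I" by simp
    from xd_span.step[OF P(2) this, of c] P(1,3) show ?thesis
      by (intro bexI[of _ P1] bexI[of _ "\<lambda>f. P2 f + const_op c ((x_op ^^ a) ((d_op ^^ b) f))"]) (auto simp: add_ac)
  qed
qed

text \<open>The normal form of \<open>P\<close> is split into the part \<open>P1\<close> with pairs
  in \<open>V_pairs k\<close> and the rest \<open>P2\<close>. Applied to \<open>x\<^sup>n\<close>,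
  both \<open>P\<close> and \<open>P1\<close> have no terms below exponent \<open>n - k\<close>,
  while \<open>P2\<close> has none from \<open>n - k\<close> on. So \<open>P2\<close> kills every
  \<open>x\<^sup>n\<close>.\<close>

lemma V_weyl_eq: "V_weyl k = xd_span (V_pairs k)"
proof
  show "xd_span (V_pairs k) \<subseteq> V_weyl k"
    using V_pairs_homogeneous xd_span_mono[of _ "V_pairs k" UNIV]
    by (auto simp: V_weyl_def weyl_def weyl_ops_eq_xd_span)
next
  show "V_weyl k \<subseteq> xd_span (V_pairs k)"
  proof
    fix P assume P: "P \<in> V_weyl k"
    then obtain P1 P2 where P12: "P1 \<in> xd_span (V_pairs k)" "P2 \<in> xd_span (- V_pairs k)" "P = (\<lambda>f. P1 f + P2 f)"
      using xd_span_split[of P "V_pairs k"] by (auto simp: V_weyl_def weyl_def weyl_ops_eq_xd_span)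
    have s: "P2 (Poly_Mapping.single n 1) = 0" for n
    proof (rule poly_mapping_eqI)
      fix m
      show "Poly_Mapping.lookup (P2 (Poly_Mapping.single n 1)) m = Poly_Mapping.lookup 0 m"
      proof (cases "n - k \<le> m")
        case False
        have n: "Poly_Mapping.single n 1 \<in> x_ideal n"
          by (simp add: x_ideal_iff lookup_single)
        then have "P (Poly_Mapping.single n 1) \<in> x_ideal (n - k)" using P by (auto simp: V_weyl_def)
        with V_pairs_homogeneous[OF P12(1) n] False show ?thesis
          by (auto simp: x_ideal_iff P12(3) lookup_add)
      qed (simp add: V_complement_homogeneous[OF P12(2)])
    qed
    have "P2 f = 0" for f
    proof (induction f rule: laurent_induct)
      case (single n c)
      have "Poly_Mapping.single n c = const_op c (Poly_Mapping.single n 1)"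
        by (simp add: const_op_def mult_single)
      then show ?case using xd_span_additive(2)[OF P12(2), of c "Poly_Mapping.single n 1"] by (simp add: s)
    next
      case (sum f g)
      then show ?case by (simp add: xd_span_additive(1)[OF P12(2)])
    qed
    then have "P = P1" using P12(3) by auto
    then show "P \<in> xd_span (V_pairs k)" using P12 by simp
  qed
qed

lemma V_weyl_subset: "V_weyl k \<subseteq> weyl_ops"
  by (auto simp: V_weyl_def weyl_def)

lemma V_weyl_add: "P \<in> V_weyl k \<Longrightarrow> Q \<in> V_weyl k \<Longrightarrow> (\<lambda>f. P f + Q f) \<in> V_weyl k"
  unfolding V_weyl_eq by (rule xd_span_add)

lemma V_weyl_zero: "(\<lambda>f. 0) \<in> V_weyl k"
  unfolding V_weyl_eq by (rule xd_span.zero)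

lemma V_weyl_mono: "P \<in> V_weyl k \<Longrightarrow> k \<le> k' \<Longrightarrow> P \<in> V_weyl k'"
  unfolding V_weyl_eq by (erule xd_span_mono) (auto simp: V_pairs_def)

lemma V_weyl_comp: "P \<in> V_weyl j \<Longrightarrow> Q \<in> V_weyl k \<Longrightarrow> P \<circ> Q \<in> V_weyl (j + k)"
  unfolding V_weyl_def weyl_def by (fastforce intro: weyl_ops.comp simp: diff_diff_eq add.commute)

lemma V_weyl_const: "const_op c \<in> V_weyl 0"
  by (auto simp: V_weyl_def weyl_def x_ideal_iff weyl_ops.const)

lemma V_weyl_x: "x_op \<in> V_weyl (- 1)"
  by (auto simp: V_weyl_def weyl_def x_ideal_iff weyl_ops.x)

lemma V_weyl_theta: "\<theta> \<in> V_weyl 0"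
  by (auto simp: V_weyl_def weyl_def x_ideal_iff weyl_ops.intros)

lemma V_weyl_poly_op: "poly_op p \<in> V_weyl 0"
proof (induction p)
  case 0
  have "poly_op 0 = const_op 0" using poly_op_const[of 0] by simp
  then show ?case by (simp add: V_weyl_const)
next
  case (pCons a p)
  have "pCons a p = [:a:] + poly_X * p" by simp
  then have "poly_op (pCons a p) = (\<lambda>f. const_op a f + (x_op \<circ> poly_op p) f)"
    by (simp only: poly_op_add poly_op_mult poly_op_const poly_op_X)
  moreover have "x_op \<circ> poly_op p \<in> V_weyl 0"
    using V_weyl_mono[OF V_weyl_comp[OF V_weyl_x pCons(2)]] by simp
  ultimately show ?case using V_weyl_add[OF V_weyl_const[of a]] by metis
qed

lemma V_weyl_exhausts: "P \<in> weyl_ops \<Longrightarrow> \<exists>k. P \<in> V_weyl k"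
  unfolding weyl_ops_eq_xd_span
proof (induction P rule: xd_span.induct)
  case (step P a b c)
  then obtain k where "P \<in> V_weyl k" by blast
  then have "P \<in> xd_span (V_pairs (max k (int b)))"
    using V_weyl_mono[of P k "max k (int b)"] by (simp add: V_weyl_eq)
  moreover have "(a, b) \<in> V_pairs (max k (int b))" by (auto simp: V_pairs_def)
  ultimately show ?case unfolding V_weyl_eq by (blast intro: xd_span.step)
qed (blast intro: V_weyl_zero)

text \<open>For \<open>k \<le> 0\<close> all monomials of \<open>V_weyl (k - 1)\<close> have
  \<open>b - a < 0\<close>, hence \<open>a > 0\<close>, and a factor \<open>x\<close> splits off on
  the left.\<close>

lemma V_weyl_divide_x:
  assumes "P \<in> V_weyl (k - 1)" "k \<le> 0"
  shows "\<exists>Q\<in>V_weyl k. P = x_op \<circ> Q"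
  using assms(1) unfolding V_weyl_eq
proof (induction P rule: xd_span.induct)
  case zero
  then show ?case by (intro bexI[of _ "\<lambda>f. 0"]) (auto intro: xd_span.zero)
next
  case (step P a b c)
  then obtain Q where Q: "Q \<in> xd_span (V_pairs k)" "P = x_op \<circ> Q" by blast
  from step assms(2) obtain a' where a: "a = Suc a'" by (cases a) (auto simp: V_pairs_def)
  then have "(a', b) \<in> V_pairs k" using step by (auto simp: V_pairs_def)
  from xd_span.step[OF Q(1) this, of c] show ?case
    by (intro bexI) (auto simp: Q(2) a x_op_add x_op_const_op)
qed

text \<open>The recursion behind \<open>x\<^sup>b \<partial>\<^sup>b = \<theta> (\<theta> - 1) ...
  (\<theta> - b + 1)\<close>. It shows that \<open>V_weyl 0\<close> is generated by
  \<open>\<complex>[x]\<close> and \<open>\<theta>\<close>.\<close>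

lemma x_d_power_Suc:
  "(x_op ^^ Suc b) ((d_op ^^ Suc b) f) =
    \<theta> ((x_op ^^ b) ((d_op ^^ b) f)) + const_op (- of_nat b) ((x_op ^^ b) ((d_op ^^ b) f))"
  by (intro poly_mapping_eqI) (simp add: lookup_add algebra_simps del: funpow.simps(2) add: funpow.simps(2)[of b d_op])


subsection \<open>Modules with a good V-filtration\<close>

locale weyl_mod = left_module weyl M for M :: "'m weyl_module" (structure)
begin

lemma act_closed: "P \<in> weyl_ops \<Longrightarrow> u \<in> carrier M \<Longrightarrow> P \<odot> u \<in> carrier M"
  using smult_closed[of P u] by (simp add: weyl_def)

lemma act_add: "P \<in> weyl_ops \<Longrightarrow> Q \<in> weyl_ops \<Longrightarrow> u \<in> carrier M \<Longrightarrow> (\<lambda>f. P f + Q f) \<odot> u = P \<odot> u \<oplus> Q \<odot> u"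
  using smult_l_distr[of P Q u] by (simp add: weyl_def)

lemma act_comp: "P \<in> weyl_ops \<Longrightarrow> Q \<in> weyl_ops \<Longrightarrow> u \<in> carrier M \<Longrightarrow> (P \<circ> Q) \<odot> u = P \<odot> (Q \<odot> u)"
  using smult_assoc[of P Q u] by (simp add: weyl_def)

lemma act_id: "u \<in> carrier M \<Longrightarrow> id \<odot> u = u"
  using smult_one[of u] by (simp add: weyl_def)

lemma act_r_add: "P \<in> weyl_ops \<Longrightarrow> u \<in> carrier M \<Longrightarrow> v \<in> carrier M \<Longrightarrow> P \<odot> (u \<oplus> v) = P \<odot> u \<oplus> P \<odot> v"
  using smult_r_distr[of P u v] by (simp add: weyl_def)

lemma zero_op_weyl: "(\<lambda>f. 0) \<in> weyl_ops"
  unfolding weyl_ops_eq_xd_span by (rule xd_span.zero)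

lemma act_zero_op: "u \<in> carrier M \<Longrightarrow> (\<lambda>f. 0) \<odot> u = \<zero>"
  using act_add[OF zero_op_weyl zero_op_weyl, of u] act_closed[OF zero_op_weyl, of u] by simp

lemma act_r_zero: "P \<in> weyl_ops \<Longrightarrow> P \<odot> \<zero> = \<zero>"
  using act_r_add[of P \<zero> \<zero>] act_closed[of P \<zero>] by simp

lemma act_finsum:
  assumes "P \<in> weyl_ops" "finite I" "\<And>i. i \<in> I \<Longrightarrow> u i \<in> carrier M"
  shows "P \<odot> (\<Oplus>i\<in>I. u i) = (\<Oplus>i\<in>I. P \<odot> u i)"
  using assms(2,3)
proof (induction I rule: finite_induct)
  case (insert i I)
  then have "u \<in> I \<rightarrow> carrier M" "u i \<in> carrier M" "(\<lambda>i. P \<odot> u i) \<in> I \<rightarrow> carrier M" "P \<odot> u i \<in> carrier M"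
    using assms(1) act_closed by auto
  with insert assms(1) show ?case by (simp add: act_r_add)
qed (simp add: act_r_zero assms)

lemma op_sums_closed:
  assumes "\<And>l. l < s \<Longrightarrow> m l \<in> carrier M" "\<And>l. l < s \<Longrightarrow> W l \<subseteq> weyl_ops"
  shows "op_sums M s m W \<subseteq> carrier M"
proof
  fix u assume "u \<in> op_sums M s m W"
  then obtain P where P: "\<forall>l<s. P l \<in> W l" "u = (\<Oplus>l\<in>{..<s}. P l \<odot> m l)" by (auto simp: op_sums_def)
  then show "u \<in> carrier M"
    using assms by (auto intro!: finsum_closed act_closed)
qed

lemma op_sums_add:
  assumes "\<And>l. l < s \<Longrightarrow> m l \<in> carrier M" "\<And>l. l < s \<Longrightarrow> W l \<subseteq> weyl_ops"
    and "\<And>l P Q. l < s \<Longrightarrow> P \<in> W l \<Longrightarrow> Q \<in> W l \<Longrightarrow> (\<lambda>f. P f + Q f) \<in> W l"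
    and "u \<in> op_sums M s m W" "v \<in> op_sums M s m W"
  shows "u \<oplus> v \<in> op_sums M s m W"
proof -
  obtain P where P: "\<forall>l<s. P l \<in> W l" "u = (\<Oplus>l\<in>{..<s}. P l \<odot> m l)"
    using assms(4) by (auto simp: op_sums_def)
  obtain Q where Q: "\<forall>l<s. Q l \<in> W l" "v = (\<Oplus>l\<in>{..<s}. Q l \<odot> m l)"
    using assms(5) by (auto simp: op_sums_def)
  have PQ: "P l \<in> weyl_ops" "Q l \<in> weyl_ops" if "l < s" for l using assms(2) P Q that by blast+
  have "u \<oplus> v = (\<Oplus>l\<in>{..<s}. P l \<odot> m l \<oplus> Q l \<odot> m l)"
    unfolding P(2) Q(2) using assms(1) PQ by (intro finsum_addf[symmetric]) (auto intro!: act_closed)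
  also have "\<dots> = (\<Oplus>l\<in>{..<s}. (\<lambda>f. P l f + Q l f) \<odot> m l)"
    using assms(1) PQ by (intro finsum_cong') (auto simp: act_add intro!: act_closed weyl_ops.add)
  finally show ?thesis
    unfolding op_sums_def using assms(3) P(1) Q(1) by (auto intro!: exI[of _ "\<lambda>l f. P l f + Q l f"])
qed

lemma op_sums_act:
  assumes "\<And>l. l < s \<Longrightarrow> m l \<in> carrier M" "\<And>l. l < s \<Longrightarrow> W l \<subseteq> weyl_ops"
    and "Q \<in> weyl_ops" "\<And>l P. l < s \<Longrightarrow> P \<in> W l \<Longrightarrow> Q \<circ> P \<in> W' l" "u \<in> op_sums M s m W"
  shows "Q \<odot> u \<in> op_sums M s m W'"
proof -
  obtain P where P: "\<forall>l<s. P l \<in> W l" "u = (\<Oplus>l\<in>{..<s}. P l \<odot> m l)"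
    using assms(5) by (auto simp: op_sums_def)
  have PW: "P l \<in> weyl_ops" if "l < s" for l using assms(2) P that by blast
  have "Q \<odot> u = (\<Oplus>l\<in>{..<s}. Q \<odot> (P l \<odot> m l))"
    unfolding P(2) using assms(1,3) PW by (intro act_finsum) (auto intro!: act_closed)
  also have "\<dots> = (\<Oplus>l\<in>{..<s}. (Q \<circ> P l) \<odot> m l)"
    using assms(1,3) PW by (intro finsum_cong') (auto simp: act_comp intro!: act_closed weyl_ops.comp)
  finally show ?thesis
    unfolding op_sums_def using assms(4) P(1) by (auto intro!: exI[of _ "\<lambda>l. Q \<circ> P l"])
qed

lemma op_sums_factor:
  assumes "\<And>l. l < s \<Longrightarrow> m l \<in> carrier M" "\<And>l. l < s \<Longrightarrow> W l \<subseteq> weyl_ops"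
    and "Q \<in> weyl_ops" "\<And>l P. l < s \<Longrightarrow> P \<in> W' l \<Longrightarrow> \<exists>P'\<in>W l. P = Q \<circ> P'" "u \<in> op_sums M s m W'"
  shows "\<exists>v\<in>op_sums M s m W. u = Q \<odot> v"
proof -
  obtain P where P: "\<forall>l<s. P l \<in> W' l" "u = (\<Oplus>l\<in>{..<s}. P l \<odot> m l)"
    using assms(5) by (auto simp: op_sums_def)
  have "\<forall>l. \<exists>P'. l < s \<longrightarrow> P' \<in> W l \<and> P l = Q \<circ> P'" using assms(4) P(1) by blast
  then obtain P' where P': "\<And>l. l < s \<Longrightarrow> P' l \<in> W l" "\<And>l. l < s \<Longrightarrow> P l = Q \<circ> P' l" by metis
  have PW: "P' l \<in> weyl_ops" if "l < s" for l using assms(2) P' that by blast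
  have "Q \<odot> (\<Oplus>l\<in>{..<s}. P' l \<odot> m l) = (\<Oplus>l\<in>{..<s}. Q \<odot> (P' l \<odot> m l))"
    using assms(1,3) PW by (intro act_finsum) (auto intro!: act_closed)
  also have "\<dots> = u" unfolding P(2)
    using assms(1,3) PW by (intro finsum_cong') (auto simp: P'(2) act_comp intro!: act_closed weyl_ops.comp)
  finally show ?thesis unfolding op_sums_def using P'(1) by blast
qed

lemma op_sums_zero:
  assumes "\<And>l. l < s \<Longrightarrow> m l \<in> carrier M" "\<And>l. l < s \<Longrightarrow> (\<lambda>f. 0) \<in> W l"
  shows "\<zero> \<in> op_sums M s m W"
proof -
  have "(\<Oplus>l\<in>{..<s}. (\<lambda>f. 0) \<odot> m l) = (\<Oplus>l\<in>{..<s}. \<zero>)"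
    using assms(1) by (intro finsum_cong') (auto simp: act_zero_op)
  then show ?thesis unfolding op_sums_def using assms(2) by (auto intro!: exI[of _ "\<lambda>_ f. 0"])
qed

lemma op_sums_least:
  assumes "\<zero> \<in> S" "\<And>u v. u \<in> S \<Longrightarrow> v \<in> S \<Longrightarrow> u \<oplus> v \<in> S" "S \<subseteq> carrier M"
    and "\<And>l P. l < s \<Longrightarrow> P \<in> W l \<Longrightarrow> P \<odot> m l \<in> S"
  shows "op_sums M s m W \<subseteq> S"
proof
  fix u assume "u \<in> op_sums M s m W"
  then obtain P where P: "\<forall>l<s. P l \<in> W l" "u = (\<Oplus>l\<in>{..<s}. P l \<odot> m l)" by (auto simp: op_sums_def)
  have "(\<Oplus>l\<in>{..<j}. P l \<odot> m l) \<in> S" if "j \<le> s" for j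
    using that
  proof (induction j)
    case (Suc j)
    have c: "P l \<odot> m l \<in> S" if "l < Suc j" for l using that Suc.prems assms(4) P(1) by simp
    then have "(\<lambda>l. P l \<odot> m l) \<in> {..<j} \<rightarrow> carrier M" "P j \<odot> m j \<in> carrier M" using assms(3) by auto
    then have "(\<Oplus>l\<in>{..<Suc j}. P l \<odot> m l) = P j \<odot> m j \<oplus> (\<Oplus>l\<in>{..<j}. P l \<odot> m l)"
      unfolding lessThan_Suc by simp
    then show ?case using Suc c assms(2) by simp
  qed (simp add: assms)
  then show "u \<in> S" using P(2) by blast
qed

lemma op_sums_mono: "(\<And>l. l < s \<Longrightarrow> W l \<subseteq> W' l) \<Longrightarrow> op_sums M s m W \<subseteq> op_sums M s m W'"
  unfolding op_sums_def by blast

definition poly_mod :: "(complex poly, 'm) module" where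
  "poly_mod = restrict_scalars poly_op M"

lemma poly_mod_simps [simp]:
  "carrier poly_mod = carrier M" "add poly_mod = add M" "\<zero>\<^bsub>poly_mod\<^esub> = \<zero>"
  "p \<odot>\<^bsub>poly_mod\<^esub> u = poly_op p \<odot> u"
  by (simp_all add: poly_mod_def restrict_scalars_def)

lemma poly_module_poly_mod: "poly_module poly_mod"
  unfolding poly_module_def poly_mod_def
proof (rule module_restrict_scalars)
  show "abelian_group M" ..
qed (auto simp: act_closed poly_op_weyl poly_op_add act_add act_r_add poly_op_mult act_comp poly_op_1 act_id)

end

locale V_filtered_module = weyl_mod M for M :: "'m weyl_module" (structure) +
  fixes U :: "int \<Rightarrow> 'm set" and s :: nat and m :: "nat \<Rightarrow> 'm" and e :: "nat \<Rightarrow> int"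
  assumes gen_closed: "l < s \<Longrightarrow> m l \<in> carrier M"
    and gen: "op_sums M s m (\<lambda>_. carrier weyl) = carrier M"
    and U_eq: "U k = op_sums M s m (\<lambda>l. V_weyl (k - e l))"
begin

lemma U_subset: "U k \<subseteq> carrier M"
  unfolding U_eq by (intro op_sums_closed gen_closed V_weyl_subset)

lemma U_closed: "u \<in> U k \<Longrightarrow> u \<in> carrier M"
  using U_subset by blast

lemma U_add: "u \<in> U k \<Longrightarrow> v \<in> U k \<Longrightarrow> u \<oplus> v \<in> U k"
  unfolding U_eq by (rule op_sums_add[OF gen_closed V_weyl_subset V_weyl_add])

lemma U_zero: "\<zero> \<in> U k"
  unfolding U_eq by (rule op_sums_zero[OF gen_closed V_weyl_zero])

lemma U_act:
  assumes "Q \<in> V_weyl j" "u \<in> U k"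
  shows "Q \<odot> u \<in> U (k + j)"
  unfolding U_eq
proof (rule op_sums_act[OF gen_closed V_weyl_subset])
  show "Q \<circ> P \<in> V_weyl (k + j - e l)" if "P \<in> V_weyl (k - e l)" for P l
    using V_weyl_comp[OF assms(1) that] by (simp add: algebra_simps)
qed (use assms V_weyl_subset in \<open>auto simp: U_eq\<close>)

lemma U_poly: "u \<in> U k \<Longrightarrow> poly_op p \<odot> u \<in> U k"
  using U_act[OF V_weyl_poly_op, of u k] by simp

lemma U_theta: "u \<in> U k \<Longrightarrow> \<theta> \<odot> u \<in> U k"
  using U_act[OF V_weyl_theta, of u k] by simp

lemma U_x: "u \<in> U k \<Longrightarrow> x_op \<odot> u \<in> U (k - 1)"
  using U_act[OF V_weyl_x, of u k] by simp

lemma U_mono: "k \<le> k' \<Longrightarrow> U k \<subseteq> U k'"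
  unfolding U_eq by (intro op_sums_mono subsetI) (erule V_weyl_mono, simp)

lemma U_exhausts:
  assumes "u \<in> carrier M"
  shows "\<exists>k. u \<in> U k"
proof -
  obtain P where P: "\<forall>l<s. P l \<in> weyl_ops" "u = (\<Oplus>l\<in>{..<s}. P l \<odot> m l)"
    using assms unfolding gen[symmetric] by (auto simp: op_sums_def weyl_def)
  have "\<exists>K. \<forall>l\<in>{..<s}. P l \<in> V_weyl (K - e l)"
  proof (rule common_bound)
    fix l assume "l \<in> {..<s}"
    then obtain k where "P l \<in> V_weyl k" using P V_weyl_exhausts by blast
    then show "\<exists>K. P l \<in> V_weyl (K - e l)" by (intro exI[of _ "k + e l"]) simp
  qed (auto elim: V_weyl_mono)
  then obtain K where "\<forall>l<s. P l \<in> V_weyl (K - e l)" by blast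
  then have "u \<in> U K" unfolding U_eq op_sums_def P(2) by blast
  then show ?thesis by blast
qed

text \<open>For \<open>k \<le> k0\<close> all indices \<open>k - e l\<close> are at most 0, which is
  the range where \<open>V_weyl_divide_x\<close> applies. The inserted 0 gives a value when there
  are no generators.\<close>

definition k0 :: int where "k0 = Min (insert 0 (e ` {..<s}))"

lemma k0_le: "l < s \<Longrightarrow> k0 \<le> e l"
  unfolding k0_def by (intro Min_le) auto

lemma U_divide_x:
  assumes "k \<le> k0" "u \<in> U (k - 1)"
  shows "\<exists>v\<in>U k. u = x_op \<odot> v"
  unfolding U_eq
proof (rule op_sums_factor[OF gen_closed V_weyl_subset])
  show "\<exists>P'\<in>V_weyl (k - e l). P = x_op \<circ> P'" if "l < s" "P \<in> V_weyl (k - 1 - e l)" for l P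
    using V_weyl_divide_x[of P "k - e l"] that assms(1) k0_le[OF that(1)] by (simp add: algebra_simps)
qed (use assms(2) weyl_ops.x in \<open>auto simp: U_eq\<close>)

text \<open>At level \<open>k0\<close> the generators are acted on by operators of
  \<open>V_weyl 0\<close> only, so closure under \<open>\<complex>[x]\<close> and
  \<open>\<theta>\<close> suffices and \<open>\<partial>\<close> itself never occurs. The lemma is
  applied to the elements that a power of \<open>x\<close> carries into a stable lattice.\<close>

lemma U_k0_least:
  assumes S: "\<zero> \<in> S" "\<And>u v. u \<in> S \<Longrightarrow> v \<in> S \<Longrightarrow> u \<oplus> v \<in> S" "S \<subseteq> carrier M"
    and poly: "\<And>p u. u \<in> S \<Longrightarrow> poly_op p \<odot> u \<in> S"
    and theta: "\<And>u. u \<in> S \<Longrightarrow> \<theta> \<odot> u \<in> S"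
    and gens: "\<And>l. l < s \<Longrightarrow> m l \<in> S"
  shows "U k0 \<subseteq> S"
  unfolding U_eq
proof (rule op_sums_least[OF S])
  have xd_weyl: "x_op ^^ a \<in> weyl_ops" "d_op ^^ a \<in> weyl_ops" for a
    using poly_op_weyl[of 1] by (induction a) (auto simp: poly_op_1 id_def intro: weyl_ops.intros)
  have power: "((x_op ^^ b) \<circ> (d_op ^^ b)) \<odot> u \<in> S" if "u \<in> S" for u b
  proof (induction b)
    case 0
    then show ?case using that S(3) act_id by (auto simp: id_def)
  next
    case (Suc b)
    let ?Q = "(x_op ^^ b) \<circ> (d_op ^^ b)"
    have Q: "?Q \<in> weyl_ops" by (intro weyl_ops.comp xd_weyl)
    have u: "u \<in> carrier M" using that S(3) by blast
    have "(x_op ^^ Suc b) \<circ> (d_op ^^ Suc b) = (\<lambda>f. (\<theta> \<circ> ?Q) f + (const_op (- of_nat b) \<circ> ?Q) f)"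
      by (rule ext) (simp only: o_apply x_d_power_Suc)
    then have "((x_op ^^ Suc b) \<circ> (d_op ^^ Suc b)) \<odot> u
      = \<theta> \<odot> (?Q \<odot> u) \<oplus> poly_op [:- of_nat b:] \<odot> (?Q \<odot> u)"
      using u Q by (simp only: act_add act_comp weyl_ops.intros poly_op_const)
    then show ?case using S(2)[OF theta[OF Suc] poly[OF Suc]] by (simp only:)
  qed
  fix l P assume l: "l < s" and "P \<in> V_weyl (k0 - e l)"
  then have "P \<in> xd_span (V_pairs 0)"
    using V_weyl_mono[of P "k0 - e l" 0] k0_le[OF l] by (simp add: V_weyl_eq)
  then show "P \<odot> m l \<in> S"
  proof (induction P rule: xd_span.induct)
    case zero
    then show ?case using S(1) gen_closed[OF l] by (simp add: act_zero_op)
  next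
    case (step P a b c)
    have "P \<in> weyl_ops" using step.hyps(1) xd_span_mono weyl_ops_eq_xd_span by blast
    have ab: "b \<le> a" using step.hyps by (auto simp: V_pairs_def)
    \<comment> \<open>Since \<open>b \<le> a\<close>, the monomial factors as
      \<open>c x ^ (a - b)\<close> times \<open>x\<^sup>b \<partial>\<^sup>b\<close>, and the latter
      is a polynomial in \<open>\<theta>\<close>.\<close>
    let ?Q = "(x_op ^^ b) \<circ> (d_op ^^ b)" and ?p = "[:c:] * poly_X ^ (a - b)"
    have Q: "?Q \<in> weyl_ops" by (intro weyl_ops.comp xd_weyl)
    have "(x_op ^^ a) f = (x_op ^^ (a - b)) ((x_op ^^ b) f)" for f
      using ab by (metis comp_apply funpow_add le_add_diff_inverse2)
    then have "(\<lambda>f. P f + const_op c ((x_op ^^ a) ((d_op ^^ b) f))) = (\<lambda>f. P f + (poly_op ?p \<circ> ?Q) f)"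
      by (simp only: poly_op_mult poly_op_const poly_op_X_power o_apply)
    moreover have "(\<lambda>f. P f + (poly_op ?p \<circ> ?Q) f) \<odot> m l = P \<odot> m l \<oplus> poly_op ?p \<odot> (?Q \<odot> m l)"
      using act_add[OF \<open>P \<in> weyl_ops\<close> weyl_ops.comp[OF poly_op_weyl Q] gen_closed[OF l]]
        act_comp[OF poly_op_weyl Q gen_closed[OF l]] by simp
    ultimately show ?case using S(2)[OF step.IH poly[OF power[OF gens[OF l]]]] by (simp only:)
  qed
qed

end

section \<open>The rank of the associated graded module\<close>

locale reduction_basis = rational_submodule W n for W n +
  fixes r :: nat and g :: "nat \<Rightarrow> nat \<Rightarrow> complex poly fract"
  assumes basis_g: "mod_basis r g"
begin

text \<open>The coordinates of the class of \<open>w\<close> in \<open>W/xW\<close> with respect to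
  \<open>g\<close>. Entries from \<open>r\<close> on are unspecified, whence the conditions
  \<open>i < r\<close> below.\<close>

definition red :: "(nat \<Rightarrow> complex poly fract) \<Rightarrow> nat \<Rightarrow> complex" where
  "red w = (SOME c. \<exists>v\<in>W. \<forall>k. w k = (\<Sum>i<r. cst (c i) * g i k) + rat_X * v k)"

lemma g_mem: "i < r \<Longrightarrow> g i \<in> W"
  using basis_g by (auto simp: mod_basis_def mod_indep_def)

lemma red_ex:
  assumes "w \<in> W"
  shows "\<exists>v\<in>W. \<forall>k. w k = (\<Sum>i<r. cst (red w i) * g i k) + rat_X * v k"
proof -
  have "\<exists>c. \<exists>v\<in>W. \<forall>k. w k = (\<Sum>i<r. cst (c i) * g i k) + rat_X * v k"
    using basis_g assms unfolding mod_basis_def by blast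
  then show ?thesis unfolding red_def by (rule someI_ex)
qed

lemma red_eqI:
  assumes "v \<in> W" "\<And>k. w k = (\<Sum>i<r. cst (c i) * g i k) + rat_X * v k" "i < r"
  shows "red w i = c i"
proof -
  \<comment> \<open>\<open>v\<close> is treated as a vector with index \<open>r\<close> and
    coefficient \<open>x\<close>, so that membership in \<open>W\<close> follows from
    \<open>sum_mem\<close>.\<close>
  have "w = (\<lambda>k. \<Sum>j\<in>{..r}. to_fract (if j < r then [:c j:] else poly_X) * (if j < r then g j k else v k))"
    using assms(2) by (auto simp: fun_eq_iff lessThan_Suc_atMost[symmetric])
  moreover have "\<dots> \<in> W"
    using sum_mem[of "{..r}" "\<lambda>j. if j < r then g j else v" "\<lambda>j. if j < r then [:c j:] else poly_X"] g_mem assms(1)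
    by (auto simp: if_distrib[of "\<lambda>f. f _"] cong: if_cong)
  ultimately have "w \<in> W" by simp
  then obtain v' where v': "v' \<in> W" "\<forall>k. w k = (\<Sum>i<r. cst (red w i) * g i k) + rat_X * v' k"
    using red_ex by blast
  have "(\<Sum>i<r. cst (red w i - c i) * g i k) = rat_X * (v k + - v' k)" for k
  proof -
    have "cst (red w i - c i) = cst (red w i) - cst (c i)" for i by (simp flip: to_fract_diff)
    then have s: "(\<Sum>i<r. cst (red w i - c i) * g i k) = (\<Sum>i<r. cst (red w i) * g i k) - (\<Sum>i<r. cst (c i) * g i k)"
      by (simp only: left_diff_distrib sum_subtractf)
    have gen: "a + b = d + e \<Longrightarrow> d - a = b - e" for a b d e :: "complex poly fract"
      by (simp add: algebra_simps)
    have "(\<Sum>i<r. cst (c i) * g i k) + rat_X * v k = (\<Sum>i<r. cst (red w i) * g i k) + rat_X * v' k"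
      using v'(2) assms(2) by metis
    from gen[OF this] show ?thesis unfolding s by (simp add: right_diff_distrib)
  qed
  moreover have "(\<lambda>k. v k + - v' k) \<in> W" by (intro add_mem uminus_mem assms v')
  ultimately have "\<forall>i<r. red w i - c i = 0"
    using basis_g unfolding mod_basis_def mod_indep_def by (auto dest!: spec[of _ "\<lambda>i. red w i - c i"])
  then show ?thesis using assms(3) by simp
qed

lemma red_add:
  assumes "v \<in> W" "w \<in> W" "i < r"
  shows "red (\<lambda>k. v k + w k) i = red v i + red w i"
proof -
  obtain v' where v': "v' \<in> W" "\<forall>k. v k = (\<Sum>i<r. cst (red v i) * g i k) + rat_X * v' k" using red_ex[OF assms(1)] by blast
  obtain w' where w': "w' \<in> W" "\<forall>k. w k = (\<Sum>i<r. cst (red w i) * g i k) + rat_X * w' k" using red_ex[OF assms(2)] by blast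
  have cst_add: "cst (a + b) = cst a + cst b" for a b by (simp flip: to_fract_add)
  show ?thesis
  proof (rule red_eqI[OF add_mem[OF v'(1) w'(1)] _ assms(3)])
    fix k
    show "v k + w k = (\<Sum>i<r. cst (red v i + red w i) * g i k) + rat_X * (v' k + w' k)"
      using v'(2)[rule_format, of k] w'(2)[rule_format, of k]
      by (simp only: cst_add distrib_right distrib_left sum.distrib) (simp only: add_ac)
  qed
qed

lemma red_const:
  assumes "w \<in> W" "i < r"
  shows "red (\<lambda>k. cst a * w k) i = a * red w i"
proof -
  obtain w' where w': "w' \<in> W" "\<forall>k. w k = (\<Sum>i<r. cst (red w i) * g i k) + rat_X * w' k" using red_ex[OF assms(1)] by blast
  have cst_mult: "cst (a * b) = cst a * cst b" for a b by (simp flip: to_fract_mult)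
  show ?thesis
  proof (rule red_eqI[OF smult_mem[OF w'(1)] _ assms(2)])
    fix k
    show "cst a * w k = (\<Sum>i<r. cst (a * red w i) * g i k) + rat_X * (cst a * w' k)"
      using w'(2)[rule_format, of k]
      by (simp only: cst_mult mult.assoc sum_distrib_left[symmetric] distrib_left) (simp only: mult.left_commute)
  qed
qed

lemma red_X:
  assumes "v \<in> W" "i < r"
  shows "red (\<lambda>k. rat_X * v k) i = 0"
  by (rule red_eqI[OF assms(1) _ assms(2)]) simp

lemma red_zero: "i < r \<Longrightarrow> red (\<lambda>k. 0) i = 0"
  using red_X[OF zero_mem] by simp

lemma red_g:
  assumes "j < r" "i < r"
  shows "red (g j) i = (if j = i then 1 else 0)"
proof (rule red_eqI[OF zero_mem _ assms(2)])
  fix k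
  have "(\<Sum>i<r. cst (if j = i then 1 else 0) * g i k) = (\<Sum>i<r. if j = i then g i k else 0)"
    by (intro sum.cong) (auto simp: one_pCons[symmetric])
  then show "g j k = (\<Sum>i<r. cst (if j = i then 1 else 0) * g i k) + rat_X * 0"
    using assms by simp
qed

lemma red_sum:
  assumes "finite J" "\<And>j. j \<in> J \<Longrightarrow> w j \<in> W" "i < r"
  shows "red (\<lambda>k. \<Sum>j\<in>J. cst (a j) * w j k) i = (\<Sum>j\<in>J. a j * red (w j) i)"
  using assms(1,2)
proof (induction J rule: finite_induct)
  case (insert j J)
  have "(\<lambda>k. \<Sum>j\<in>J. cst (a j) * w j k) \<in> W" using insert by (intro sum_mem) auto
  moreover have "(\<lambda>k. cst (a j) * w j k) \<in> W" using insert by (intro smult_mem) auto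
  ultimately show ?case using insert assms(3) by (simp add: red_add red_const)
qed (simp add: red_zero assms)

end

locale finite_rank_V_module = V_filtered_module M U s m e +
  N: finite_rank_module "weyl_mod.poly_mod M" n b
  for M :: "'m weyl_module" (structure) and U :: "int \<Rightarrow> 'm set" and s m e n b
begin

section \<open>Rational coordinates and the image of the filtration\<close>

abbreviation crd :: "'m \<Rightarrow> nat \<Rightarrow> complex poly fract" where "crd \<equiv> N.rat_coords"

lemma crd_add: "u \<in> carrier M \<Longrightarrow> v \<in> carrier M \<Longrightarrow> crd (u \<oplus> v) k = crd u k + crd v k"
  using N.coords_add[of u v k] by simp

lemma crd_poly: "u \<in> carrier M \<Longrightarrow> crd (poly_op p \<odot> u) k = to_fract p * crd u k"
  using N.coords_smult[of u p k] by simp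

lemma crd_zero: "crd \<zero> k = 0"
  using N.coords_zero by simp

lemma crd_finsum:
  assumes "\<And>i. i \<in> I \<Longrightarrow> u i \<in> carrier M"
  shows "crd (\<Oplus>i\<in>I. u i) k = (\<Sum>i\<in>I. crd (u i) k)"
  using assms
proof (induction I rule: infinite_finite_induct)
  case (insert i I)
  then have "u \<in> I \<rightarrow> carrier M" "u i \<in> carrier M" by auto
  with insert show ?case by (simp add: crd_add)
qed (auto simp: crd_zero)

lemma poly_closed: "u \<in> carrier M \<Longrightarrow> poly_op p \<odot> u \<in> carrier M"
  by (intro act_closed poly_op_weyl)

lemma poly_act_mult: "u \<in> carrier M \<Longrightarrow> poly_op (p * q) \<odot> u = poly_op p \<odot> (poly_op q \<odot> u)"
  by (simp only: poly_op_mult act_comp poly_op_weyl)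

lemma poly_act_one: "u \<in> carrier M \<Longrightarrow> poly_op 1 \<odot> u = u"
  by (simp add: poly_op_1 act_id)

lemma poly_act_add: "u \<in> carrier M \<Longrightarrow> poly_op (p + q) \<odot> u = poly_op p \<odot> u \<oplus> poly_op q \<odot> u"
  by (simp only: poly_op_add act_add poly_op_weyl)

lemma U_uminus:
  assumes u: "u \<in> U k"
  shows "\<ominus> u \<in> U k"
proof -
  have c: "u \<in> carrier M" by (rule U_closed[OF u])
  have "poly_op (- 1) \<odot> u \<oplus> poly_op 1 \<odot> u = poly_op 0 \<odot> u"
    using poly_act_add[OF c, of "- 1" 1] by simp
  then have "poly_op (- 1) \<odot> u \<oplus> u = \<zero>"
    using c poly_act_one[OF c] N.sm_zero[of u] by simp
  then have "\<ominus> u = poly_op (- 1) \<odot> u"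
    using c by (intro minus_equality poly_closed)
  then show ?thesis using U_poly[OF u] by simp
qed

lemma U_X_power: "u \<in> U k \<Longrightarrow> poly_op (poly_X ^ j) \<odot> u \<in> U (k - int j)"
proof (induction j arbitrary: k)
  case 0
  then show ?case using poly_act_one U_closed by simp
next
  case (Suc j)
  have "poly_op (poly_X ^ Suc j) \<odot> u = x_op \<odot> (poly_op (poly_X ^ j) \<odot> u)"
    using U_closed[OF Suc.prems] by (simp only: power_Suc poly_act_mult poly_op_X)
  then show ?case using U_x[OF Suc.IH[OF Suc.prems]] by (simp add: algebra_simps)
qed

lemma U_monom: "u \<in> U k \<Longrightarrow> poly_op (monom c j) \<odot> u \<in> U (k - int j)"
proof -
  assume u: "u \<in> U k"
  have "monom c j = [:c:] * poly_X ^ j" by (simp add: monom_altdef)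
  then have "poly_op (monom c j) \<odot> u = poly_op [:c:] \<odot> (poly_op (poly_X ^ j) \<odot> u)"
    using U_closed[OF u] by (simp only: poly_act_mult)
  then show ?thesis using U_poly[OF U_X_power[OF u]] by simp
qed

lemma U_divide_X_power:
  assumes "k \<le> k0" "u \<in> U (k - int j)"
  shows "\<exists>v\<in>U k. u = poly_op (poly_X ^ j) \<odot> v"
  using assms(2)
proof (induction j arbitrary: u)
  case 0
  then show ?case using U_closed poly_act_one by (intro bexI[of _ u]) auto
next
  case (Suc j)
  have "u \<in> U (k - int j - 1)" using Suc.prems by (simp add: algebra_simps)
  then obtain v where v: "v \<in> U (k - int j)" "u = x_op \<odot> v"
    using U_divide_x[of "k - int j" u] assms(1) by auto
  obtain w where w: "w \<in> U k" "v = poly_op (poly_X ^ j) \<odot> w" using Suc.IH[OF v(1)] by blast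
  have "u = poly_op (poly_X ^ Suc j) \<odot> w"
    using U_closed[OF w(1)] by (simp only: v(2) w(2) power_Suc poly_act_mult poly_op_X)
  then show ?case using w(1) by blast
qed

definition W :: "(nat \<Rightarrow> complex poly fract) set" where "W = crd ` U k0"

sublocale W: rational_submodule W n
proof
  show "(\<lambda>_. 0) \<in> W"
    unfolding W_def using U_zero[of k0] by (intro image_eqI[of _ _ \<zero>]) (auto simp: crd_zero fun_eq_iff)
  fix v w assume "v \<in> W" "w \<in> W"
  then obtain u u' where "v = crd u" "w = crd u'" "u \<in> U k0" "u' \<in> U k0" by (auto simp: W_def)
  then show "(\<lambda>i. v i + w i) \<in> W"
    unfolding W_def by (intro image_eqI[of _ _ "u \<oplus> u'"]) (auto simp: crd_add U_closed U_add fun_eq_iff)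
next
  fix w p assume "w \<in> W"
  then obtain u where "w = crd u" "u \<in> U k0" by (auto simp: W_def)
  then show "(\<lambda>i. to_fract p * w i) \<in> W"
    unfolding W_def by (intro image_eqI[of _ _ "poly_op p \<odot> u"]) (auto simp: crd_poly U_closed U_poly fun_eq_iff)
next
  fix w i assume "w \<in> W" "n \<le> i"
  then show "w i = 0" using N.coords_support U_closed by (auto simp: W_def)
qed

text \<open>Multiplication by \<open>x\<^bsup>k - k0\<^esup>\<close> moves \<open>U\<^sub>k\<close> to level \<open>k0\<close>. For \<open>k < k0\<close> this is a division, which is possible
  because \<open>U\<^sub>k = x\<^bsup>k0 - k\<^esup> U\<^bsub>k0\<^esub>\<close>. The induced map \<open>U\<^sub>k / U\<^bsub>k-1\<^esub> \<rightarrow> W / xW\<close> becomes an isomorphism after inverting \<open>x\<close>.\<close>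

definition lev :: "int \<Rightarrow> 'm \<Rightarrow> nat \<Rightarrow> complex poly fract" where
  "lev k u = (\<lambda>i. rat_X powi (k - k0) * crd u i)"

lemma rat_X_nz: "rat_X \<noteq> 0"
  by simp

lemma lev_mem:
  assumes "u \<in> U k"
  shows "lev k u \<in> W"
proof (cases "k \<ge> k0")
  case True
  then have "poly_op (poly_X ^ nat (k - k0)) \<odot> u \<in> U k0" using U_X_power[OF assms, of "nat (k - k0)"] by simp
  moreover have "crd (poly_op (poly_X ^ nat (k - k0)) \<odot> u) = lev k u"
    using True U_closed[OF assms] by (auto simp: lev_def crd_poly power_int_def fun_eq_iff rat_X_power)
  ultimately show ?thesis unfolding W_def by (metis imageI)
next
  case False
  then have "u \<in> U (k0 - int (nat (k0 - k)))" using assms by simp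
  then obtain v where v: "v \<in> U k0" "u = poly_op (poly_X ^ nat (k0 - k)) \<odot> v"
    using U_divide_X_power[of k0] by blast
  have "rat_X powi (k - k0) * (rat_X ^ nat (k0 - k) * z) = z" for z
  proof -
    have "inverse rat_X ^ j * rat_X ^ j = 1" for j
      by (simp only: power_mult_distrib[symmetric] left_inverse[OF rat_X_nz] power_one)
    then show ?thesis using False by (simp add: power_int_def mult.assoc[symmetric])
  qed
  then have "lev k u = crd v"
    using U_closed[OF v(1)] by (simp add: lev_def v(2) crd_poly fun_eq_iff rat_X_power)
  then show ?thesis using v(1) by (simp add: W_def)
qed

lemma lev_add: "u \<in> carrier M \<Longrightarrow> v \<in> carrier M \<Longrightarrow> lev k (u \<oplus> v) = (\<lambda>i. lev k u i + lev k v i)"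
  by (simp add: lev_def crd_add distrib_left)

text \<open>For \<open>u\<close> in \<open>U (k - 1)\<close> this exhibits \<open>lev k u\<close> as
  an element of \<open>xW\<close>, so \<open>lev k\<close> passes to the quotient by
  \<open>U (k - 1)\<close>.\<close>

lemma lev_lower: "lev k u i = rat_X * lev (k - 1) u i"
proof -
  have "rat_X powi (k - k0) = rat_X * rat_X powi (k - 1 - k0)"
    using power_int_add[of rat_X 1 "k - 1 - k0"] rat_X_nz by (simp only: power_int_1_right) simp
  then show ?thesis by (simp only: lev_def mult.assoc)
qed

section \<open>Cosets of consecutive steps of the filtration\<close>

definition vcoset :: "int \<Rightarrow> 'm \<Rightarrow> 'm set" where
  "vcoset k w = U (k - 1) +>\<^bsub>M\<^esub> w"

lemma vcoset_iff: "v \<in> vcoset k w \<longleftrightarrow> (\<exists>h\<in>U (k - 1). v = h \<oplus> w)"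
  by (auto simp: vcoset_def a_r_coset_def r_coset_def)

lemma vcoset_self: "w \<in> carrier M \<Longrightarrow> w \<in> vcoset k w"
  unfolding vcoset_iff using U_zero by (intro bexI[of _ \<zero>]) auto

lemma vcoset_eqI:
  assumes "h \<in> U (k - 1)" "w \<in> carrier M"
  shows "vcoset k (h \<oplus> w) = vcoset k w"
proof (rule Set.set_eqI, rule iffI)
  fix v assume "v \<in> vcoset k (h \<oplus> w)"
  then obtain h' where "h' \<in> U (k - 1)" "v = h' \<oplus> (h \<oplus> w)" by (auto simp: vcoset_iff)
  then show "v \<in> vcoset k w"
    using assms U_closed by (auto simp: vcoset_iff a_assoc intro!: bexI[of _ "h' \<oplus> h"] U_add)
next
  fix v assume "v \<in> vcoset k w"
  then obtain h' where h': "h' \<in> U (k - 1)" "v = h' \<oplus> w" by (auto simp: vcoset_iff)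
  have "v = (h' \<oplus> \<ominus> h) \<oplus> (h \<oplus> w)"
    using assms h' U_closed[of h "k - 1"] U_closed[of h' "k - 1"] by (simp add: a_assoc r_neg2 r_neg1)
  then show "v \<in> vcoset k (h \<oplus> w)"
    unfolding vcoset_iff using assms h' by (intro bexI[of _ "h' \<oplus> \<ominus> h"] U_add U_uminus) auto
qed

lemma vcoset_trivial: "w \<in> U (k - 1) \<Longrightarrow> vcoset k w = U (k - 1)"
proof -
  assume w: "w \<in> U (k - 1)"
  have "vcoset k w = vcoset k \<zero>" using vcoset_eqI[OF w, of \<zero>] U_closed[OF w] by simp
  also have "\<dots> = U (k - 1)"
    by (rule Set.set_eqI, unfold vcoset_iff) (metis U_closed r_zero)
  finally show ?thesis .
qed

lemma vcoset_add:
  assumes "v \<in> carrier M" "w \<in> carrier M"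
  shows "vcoset k v <+>\<^bsub>M\<^esub> vcoset k w = vcoset k (v \<oplus> w)"
proof (rule Set.set_eqI, rule iffI)
  fix z assume "z \<in> vcoset k v <+>\<^bsub>M\<^esub> vcoset k w"
  then obtain h h' where h: "h \<in> U (k - 1)" "h' \<in> U (k - 1)" "z = (h \<oplus> v) \<oplus> (h' \<oplus> w)"
    by (auto simp: set_add_def set_mult_def vcoset_iff)
  have "z = (h \<oplus> h') \<oplus> (v \<oplus> w)" using assms h U_closed by (simp add: a_ac)
  then show "z \<in> vcoset k (v \<oplus> w)" unfolding vcoset_iff using h U_add by blast
next
  fix z assume "z \<in> vcoset k (v \<oplus> w)"
  then obtain h where h: "h \<in> U (k - 1)" "z = h \<oplus> (v \<oplus> w)" by (auto simp: vcoset_iff)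
  then have "z = (h \<oplus> v) \<oplus> w" using assms U_closed by (simp add: a_assoc)
  moreover have "h \<oplus> v \<in> vcoset k v" using h by (auto simp: vcoset_iff)
  ultimately show "z \<in> vcoset k v <+>\<^bsub>M\<^esub> vcoset k w"
    using vcoset_self[OF assms(2), of k] by (auto simp: set_add_def set_mult_def)
qed

section \<open>The associated graded module over the polynomial ring\<close>

abbreviation G where "G \<equiv> restrict_scalars poly_op (gr M U)"
abbreviation gr_add (infixl "\<oplus>\<^sub>G" 65) where "u \<oplus>\<^sub>G v \<equiv> u \<oplus>\<^bsub>G\<^esub> v"
abbreviation gr_smult (infixr "\<odot>\<^sub>G" 70) where "p \<odot>\<^sub>G u \<equiv> p \<odot>\<^bsub>G\<^esub> u"
abbreviation gr_zero ("\<zero>\<^sub>G") where "\<zero>\<^sub>G \<equiv> \<zero>\<^bsub>G\<^esub>"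

lemma G_simps:
  "carrier G = {u. (\<forall>k. u k \<in> vcoset k ` U k) \<and> finite {k. u k \<noteq> U (k - 1)}}"
  "\<zero>\<^sub>G = (\<lambda>k. U (k - 1))"
  "u \<oplus>\<^sub>G v = (\<lambda>k. u k <+>\<^bsub>M\<^esub> v k)"
  "p \<odot>\<^sub>G u = poly_op p \<odot>\<^bsub>gr M U\<^esub> u"
  by (simp_all add: restrict_scalars_def gr_def vcoset_def)

text \<open>\<open>x\<close> has V-degree -1, so the component of \<open>p\<close> in V-degree
  \<open>k\<close> is its monomial of degree \<open>-k\<close>.\<close>

lemma hcomp_poly_op:
  "hcomp k (poly_op p) = (if k \<le> 0 then poly_op (monom (coeff p (nat (- k))) (nat (- k))) else (\<lambda>f. 0))"
proof
  fix f
  have l: "laurent_of_poly (monom c i) = Poly_Mapping.single (int i) c" for c i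
    by (intro poly_mapping_eqI) (auto simp: laurent_of_poly_lookup lookup_single when_def)
  have "Poly_Mapping.lookup (hcomp k (poly_op p) f) j =
    (\<Sum>i\<in>Poly_Mapping.keys f. if i = j + k then Poly_Mapping.lookup (laurent_of_poly p) (- k) * Poly_Mapping.lookup f i else 0)" for j
    unfolding hcomp_def lookup_sum
    by (intro sum.cong) (auto simp: lookup_single when_def poly_op_def mult.commute[of "laurent_of_poly p"] lookup_single_times)
  then have h: "Poly_Mapping.lookup (hcomp k (poly_op p) f) j = Poly_Mapping.lookup (laurent_of_poly p) (- k) * Poly_Mapping.lookup f (j + k)" for j
    by (simp add: in_keys_iff)
  show "hcomp k (poly_op p) f = (if k \<le> 0 then poly_op (monom (coeff p (nat (- k))) (nat (- k))) else (\<lambda>f. 0)) f"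
    by (intro poly_mapping_eqI, subst h) (auto simp: poly_op_def l lookup_single_times laurent_of_poly_lookup)
qed

lemma hcomp_support: "{k. hcomp k (poly_op p) \<noteq> \<zero>\<^bsub>weyl\<^esub>} = (\<lambda>i. - int i) ` {i. coeff p i \<noteq> 0}"
proof -
  have z: "poly_op (monom c i) = (\<lambda>f. 0) \<longleftrightarrow> c = 0" for c i
  proof
    assume "poly_op (monom c i) = (\<lambda>f. 0)"
    then have "Poly_Mapping.lookup (poly_op (monom c i) 1) (int i) = 0" by simp
    then show "c = 0" by (simp add: poly_op_def laurent_of_poly_lookup)
  next
    assume "c = 0"
    then show "poly_op (monom c i) = (\<lambda>f. 0)" by (simp add: poly_op_def laurent_of_poly_0)
  qed
  show ?thesis
  proof (rule Set.set_eqI, rule iffI)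
    fix k assume "k \<in> {k. hcomp k (poly_op p) \<noteq> \<zero>\<^bsub>weyl\<^esub>}"
    then have "k \<le> 0" "coeff p (nat (- k)) \<noteq> 0" by (auto simp: hcomp_poly_op z weyl_def split: if_splits)
    then show "k \<in> (\<lambda>i. - int i) ` {i. coeff p i \<noteq> 0}" by (intro image_eqI[of _ _ "nat (- k)"]) auto
  qed (auto simp: hcomp_poly_op z weyl_def)
qed

text \<open>A representative of the component of \<open>p u\<close> in degree \<open>j\<close>,
  provided that \<open>w i\<close> represents the component of \<open>u\<close> in degree
  \<open>j + i\<close>.\<close>

definition grs :: "complex poly \<Rightarrow> (nat \<Rightarrow> 'm) \<Rightarrow> 'm" where
  "grs p w = (\<Oplus>i\<in>{i. coeff p i \<noteq> 0}. poly_op (monom (coeff p i) i) \<odot> w i)"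

lemma finite_support_coeff: "finite {i. coeff p i \<noteq> 0}"
  by (rule finite_subset[of _ "{..degree p}"]) (auto intro: le_degree)

lemma U_finsum: "finite I \<Longrightarrow> (\<And>i. i \<in> I \<Longrightarrow> f i \<in> U k) \<Longrightarrow> (\<Oplus>i\<in>I. f i) \<in> U k"
proof (induction I rule: finite_induct)
  case (insert i I)
  then have "f \<in> I \<rightarrow> carrier M" "f i \<in> carrier M" using U_closed by auto
  with insert show ?case by (simp add: U_add)
qed (simp add: U_zero)

lemma grs_mem: "(\<And>i. w i \<in> U (j + int i)) \<Longrightarrow> grs p w \<in> U j"
  unfolding grs_def using U_monom[of "w i" "j + int i" "coeff p i" i for i]
  by (intro U_finsum finite_support_coeff) simp

text \<open>Two choices of representatives differ by elements \<open>h i\<close> of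
  \<open>U (j + i - 1)\<close>. A monomial of degree \<open>i\<close> lowers the level by
  \<open>i\<close>, so their total contribution lies in \<open>U (j - 1)\<close> and does not change
  the coset.\<close>

lemma G_smult_coset:
  assumes "u \<in> carrier G" "\<And>i. w i \<in> u (j + int i)"
  shows "(p \<odot>\<^sub>G u) j = vcoset j (grs p w)"
proof -
  have coset: "\<exists>z\<in>U k. u k = vcoset k z" for k using assms(1) by (auto simp: G_simps)
  have memU: "z \<in> U k" if z: "z \<in> u k" for z k
  proof -
    obtain y where y: "y \<in> U k" "u k = vcoset k y" using coset by blast
    then obtain h where "h \<in> U (k - 1)" "z = h \<oplus> y" using z by (auto simp: vcoset_iff)
    then show ?thesis using y U_add U_mono[of "k - 1" k] by auto
  qed
  have same: "vcoset j (\<Oplus>k\<in>{k. hcomp k (poly_op p) \<noteq> \<zero>\<^bsub>weyl\<^esub>}. hcomp k (poly_op p) \<odot> v k) = vcoset j (grs p w)"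
    if v: "\<And>k. v k \<in> u (j - k)" for v
  proof -
    define v' where "v' = (\<lambda>i. v (- int i))"
    have v'_mem: "v' i \<in> u (j + int i)" for i using v[of "- int i"] by (simp add: v'_def)
    have "(\<Oplus>k\<in>{k. hcomp k (poly_op p) \<noteq> \<zero>\<^bsub>weyl\<^esub>}. hcomp k (poly_op p) \<odot> v k)
      = (\<Oplus>i\<in>{i. coeff p i \<noteq> 0}. hcomp (- int i) (poly_op p) \<odot> v (- int i))"
      unfolding hcomp_support
    proof (rule finsum_reindex)
      show "(\<lambda>k. hcomp k (poly_op p) \<odot> v k) \<in> (\<lambda>i. - int i) ` {i. coeff p i \<noteq> 0} \<rightarrow> carrier M"
        using U_closed[OF memU[OF v]] by (auto simp: hcomp_poly_op intro!: poly_closed)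
    qed (auto simp: inj_on_def)
    also have "\<dots> = grs p v'"
      unfolding grs_def v'_def using U_closed[OF memU[OF v]]
      by (intro finsum_cong') (auto simp: hcomp_poly_op intro!: poly_closed)
    finally have e1: "(\<Oplus>k\<in>{k. hcomp k (poly_op p) \<noteq> \<zero>\<^bsub>weyl\<^esub>}. hcomp k (poly_op p) \<odot> v k) = grs p v'" .
    have "\<exists>h. h \<in> U (j + int i - 1) \<and> v' i = h \<oplus> w i" for i
    proof -
      obtain y where y: "y \<in> U (j + int i)" "u (j + int i) = vcoset (j + int i) y" using coset by blast
      obtain h1 where h1: "h1 \<in> U (j + int i - 1)" "v' i = h1 \<oplus> y" using v'_mem[of i] y by (auto simp: vcoset_iff)
      obtain h2 where h2: "h2 \<in> U (j + int i - 1)" "w i = h2 \<oplus> y" using assms(2)[of i] y by (auto simp: vcoset_iff)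
      have "v' i = (h1 \<oplus> \<ominus> h2) \<oplus> w i"
        using U_closed[OF h1(1)] U_closed[OF h2(1)] U_closed[OF y(1)] by (simp add: h1(2) h2(2) a_assoc r_neg1)
      then show ?thesis using U_add[OF h1(1) U_uminus[OF h2(1)]] by blast
    qed
    then obtain h where h: "\<And>i. h i \<in> U (j + int i - 1)" "\<And>i. v' i = h i \<oplus> w i" by metis
    have wc: "w i \<in> carrier M" "h i \<in> carrier M" for i using U_closed memU assms(2) h(1) by blast+
    have "grs p v' = (\<Oplus>i\<in>{i. coeff p i \<noteq> 0}. poly_op (monom (coeff p i) i) \<odot> h i \<oplus> poly_op (monom (coeff p i) i) \<odot> w i)"
      unfolding grs_def h(2) using wc
      by (intro finsum_cong') (auto simp: act_r_add poly_op_weyl intro!: poly_closed)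
    also have "\<dots> = grs p h \<oplus> grs p w"
      unfolding grs_def using wc by (intro finsum_addf) (auto intro!: poly_closed)
    finally have "grs p v' = grs p h \<oplus> grs p w" .
    moreover have "grs p h \<in> U (j - 1)" using h(1) by (intro grs_mem) (simp add: algebra_simps)
    moreover have "grs p w \<in> carrier M"
      unfolding grs_def using wc by (auto intro!: finsum_closed poly_closed)
    ultimately show ?thesis using e1 vcoset_eqI by simp
  qed
  \<comment> \<open>A family of representatives exists, so the union of equal cosets is not
    empty.\<close>
  have "\<forall>k. \<exists>z. z \<in> u (j - k)" using coset vcoset_self U_closed by metis
  then obtain v where v: "\<And>k. v k \<in> u (j - k)" by metis
  have "(p \<odot>\<^sub>G u) j = (\<Union>v\<in>{v. \<forall>k. v k \<in> u (j - k)}.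
     vcoset j (\<Oplus>k\<in>{k. hcomp k (poly_op p) \<noteq> \<zero>\<^bsub>weyl\<^esub>}. hcomp k (poly_op p) \<odot> v k))"
    by (simp add: restrict_scalars_def gr_def vcoset_def)
  also have "\<dots> = (\<Union>v\<in>{v. \<forall>k. v k \<in> u (j - k)}. vcoset j (grs p w))"
    by (intro SUP_cong refl same) auto
  also have "\<dots> = vcoset j (grs p w)" using v by auto
  finally show ?thesis .
qed


lemma G_coset: "u \<in> carrier G \<Longrightarrow> \<exists>w\<in>U k. u k = vcoset k w"
  by (auto simp: G_simps)

text \<open>Trivial components get the representative 0, so that finiteness of the support can be
  read off from the representatives.\<close>

lemma G_reps:
  assumes "u \<in> carrier G"
  shows "\<exists>w. \<forall>k. w k \<in> U k \<and> u k = vcoset k (w k) \<and> (u k = U (k - 1) \<longrightarrow> w k = \<zero>)"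
proof -
  have "\<forall>k. \<exists>w. w \<in> U k \<and> u k = vcoset k w \<and> (u k = U (k - 1) \<longrightarrow> w = \<zero>)"
  proof
    fix k
    show "\<exists>w. w \<in> U k \<and> u k = vcoset k w \<and> (u k = U (k - 1) \<longrightarrow> w = \<zero>)"
    proof (cases "u k = U (k - 1)")
      case True
      then show ?thesis using vcoset_trivial[OF U_zero] U_zero by (intro exI[of _ \<zero>]) auto
    next
      case False
      then show ?thesis using G_coset[OF assms, of k] by blast
    qed
  qed
  then show ?thesis by metis
qed

lemma G_zero_closed: "\<zero>\<^sub>G \<in> carrier G"
  using vcoset_trivial[OF U_zero] U_zero by (auto simp: G_simps intro!: image_eqI[of _ _ \<zero>])

lemma G_add_closed:
  assumes "u \<in> carrier G" "v \<in> carrier G"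
  shows "u \<oplus>\<^sub>G v \<in> carrier G"
proof -
  obtain w where w: "\<And>k. w k \<in> U k" "\<And>k. u k = vcoset k (w k)" "\<And>k. u k = U (k - 1) \<Longrightarrow> w k = \<zero>"
    using G_reps[OF assms(1)] by metis
  obtain z where z: "\<And>k. z k \<in> U k" "\<And>k. v k = vcoset k (z k)" "\<And>k. v k = U (k - 1) \<Longrightarrow> z k = \<zero>"
    using G_reps[OF assms(2)] by metis
  have eq: "(u \<oplus>\<^sub>G v) k = vcoset k (w k \<oplus> z k)" for k
    using vcoset_add[OF U_closed U_closed, OF w(1) z(1)] by (simp add: G_simps w(2) z(2))
  have "{k. (u \<oplus>\<^sub>G v) k \<noteq> U (k - 1)} \<subseteq> {k. u k \<noteq> U (k - 1)} \<union> {k. v k \<noteq> U (k - 1)}"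
  proof
    fix k assume "k \<in> {k. (u \<oplus>\<^sub>G v) k \<noteq> U (k - 1)}"
    then have "vcoset k (w k \<oplus> z k) \<noteq> U (k - 1)" by (simp add: eq)
    then have "\<not> (w k = \<zero> \<and> z k = \<zero>)" using vcoset_trivial[OF U_zero] by auto
    then show "k \<in> {k. u k \<noteq> U (k - 1)} \<union> {k. v k \<noteq> U (k - 1)}" using w(3) z(3) by auto
  qed
  moreover have "finite ({k. u k \<noteq> U (k - 1)} \<union> {k. v k \<noteq> U (k - 1)})"
    using assms by (auto simp: G_simps)
  ultimately have "finite {k. (u \<oplus>\<^sub>G v) k \<noteq> U (k - 1)}" by (rule finite_subset)
  moreover have "(u \<oplus>\<^sub>G v) k \<in> vcoset k ` U k" for k
    unfolding eq by (intro imageI U_add w(1) z(1))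
  ultimately show ?thesis unfolding G_simps(1) by blast
qed

lemma grs_zero: "(\<And>i. coeff p i \<noteq> 0 \<Longrightarrow> w i = \<zero>) \<Longrightarrow> grs p w = \<zero>"
proof -
  assume w: "\<And>i. coeff p i \<noteq> 0 \<Longrightarrow> w i = \<zero>"
  have "grs p w = (\<Oplus>i\<in>{i. coeff p i \<noteq> 0}. \<zero>)"
    unfolding grs_def by (intro finsum_cong') (auto simp: w act_r_zero poly_op_weyl)
  then show ?thesis by simp
qed

lemma G_smult_reps:
  assumes "u \<in> carrier G" "\<And>k. w k \<in> U k" "\<And>k. u k = vcoset k (w k)"
  shows "(p \<odot>\<^sub>G u) j = vcoset j (grs p (\<lambda>i. w (j + int i)))"
  using assms vcoset_self[OF U_closed[OF assms(2)]] by (intro G_smult_coset) auto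

definition G_support :: "(int \<Rightarrow> 'm set) \<Rightarrow> int set" where
  "G_support u = {k. u k \<noteq> U (k - 1)}"

text \<open>Gives the finiteness of the support of a product and, later, the common range of
  summation in \<open>gr_coords_smult\<close>.\<close>

lemma G_smult_support:
  assumes "u \<in> carrier G"
  shows "G_support (p \<odot>\<^sub>G u) \<subseteq> (\<lambda>(k, i). k - int i) ` (G_support u \<times> {..degree p})"
proof
  fix j assume j: "j \<in> G_support (p \<odot>\<^sub>G u)"
  obtain w where w: "\<And>k. w k \<in> U k" "\<And>k. u k = vcoset k (w k)" "\<And>k. u k = U (k - 1) \<Longrightarrow> w k = \<zero>"
    using G_reps[OF assms] by metis
  have "grs p (\<lambda>i. w (j + int i)) \<noteq> \<zero>"
  proof
    assume "grs p (\<lambda>i. w (j + int i)) = \<zero>"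
    then have "(p \<odot>\<^sub>G u) j = vcoset j \<zero>"
      using G_smult_reps[OF assms w(1,2), of p j] by (simp only:)
    then show False
      using j vcoset_trivial[OF U_zero, of j] by (simp only: G_support_def mem_Collect_eq)
  qed
  then obtain i where "coeff p i \<noteq> 0" "w (j + int i) \<noteq> \<zero>"
    using grs_zero[of p "\<lambda>i. w (j + int i)"] by blast
  then have "j + int i \<in> G_support u" "i \<le> degree p" using w(3) by (auto simp: G_support_def le_degree)
  then show "j \<in> (\<lambda>(k, i). k - int i) ` (G_support u \<times> {..degree p})"
    by (intro image_eqI[of _ _ "(j + int i, i)"]) auto
qed

lemma finite_G_support: "u \<in> carrier G \<Longrightarrow> finite (G_support u)"
  by (simp add: G_simps G_support_def)

lemma G_smult_closed:
  assumes "u \<in> carrier G"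
  shows "p \<odot>\<^sub>G u \<in> carrier G"
proof -
  obtain w where w: "\<And>k. w k \<in> U k" "\<And>k. u k = vcoset k (w k)"
    using G_reps[OF assms] by metis
  have "finite (G_support (p \<odot>\<^sub>G u))"
    using G_smult_support[OF assms] by (rule finite_subset) (simp add: finite_G_support assms)
  moreover have "(p \<odot>\<^sub>G u) j \<in> vcoset j ` U j" for j
    unfolding G_smult_reps[OF assms w] by (intro imageI grs_mem w)
  ultimately show ?thesis unfolding G_simps(1) G_support_def by blast
qed

subsection \<open>Homogeneous elements\<close>

definition homog :: "int \<Rightarrow> 'm \<Rightarrow> int \<Rightarrow> 'm set" where
  "homog k w = (\<lambda>j. if j = k then vcoset k w else U (j - 1))"

lemma hom_closed: "w \<in> U k \<Longrightarrow> homog k w \<in> carrier G"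
proof -
  assume w: "w \<in> U k"
  have "{j. homog k w j \<noteq> U (j - 1)} \<subseteq> {k}" by (auto simp: homog_def)
  then have "finite {j. homog k w j \<noteq> U (j - 1)}" by (rule finite_subset) simp
  moreover have "homog k w j \<in> vcoset j ` U j" for j
    using w vcoset_trivial[OF U_zero, of j] U_zero[of j] by (auto simp: homog_def intro: image_eqI[of _ _ \<zero>])
  ultimately show ?thesis unfolding G_simps(1) by blast
qed

lemma hom_zero: "w \<in> U (k - 1) \<Longrightarrow> homog k w = \<zero>\<^sub>G"
  by (auto simp: homog_def G_simps vcoset_trivial fun_eq_iff)

lemma trivial_add: "U (k - 1) <+>\<^bsub>M\<^esub> vcoset k w = vcoset k w" if "w \<in> carrier M"
  using vcoset_add[of \<zero> w k] vcoset_trivial[OF U_zero, of k] that by simp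

lemma hom_add: "v \<in> U k \<Longrightarrow> w \<in> U k \<Longrightarrow> homog k v \<oplus>\<^sub>G homog k w = homog k (v \<oplus> w)"
proof (rule ext)
  fix j
  assume vw: "v \<in> U k" "w \<in> U k"
  have "U (j - 1) <+>\<^bsub>M\<^esub> U (j - 1) = U (j - 1)"
    using trivial_add[of \<zero> j] vcoset_trivial[OF U_zero, of j] by simp
  then show "(homog k v \<oplus>\<^sub>G homog k w) j = homog k (v \<oplus> w) j"
    using vcoset_add[OF U_closed[OF vw(1)] U_closed[OF vw(2)], of k] by (simp add: homog_def G_simps)
qed

lemma hom_monom:
  assumes "w \<in> U k"
  shows "monom c i \<odot>\<^sub>G homog k w = homog (k - int i) (poly_op (monom c i) \<odot> w)"
proof
  fix j
  define z where "z = (\<lambda>k'. if k' = k then w else \<zero>)"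
  have z: "z k' \<in> U k'" "homog k w k' = vcoset k' (z k')" for k'
    using assms vcoset_trivial[OF U_zero] U_zero by (auto simp: z_def homog_def)
  have "(monom c i \<odot>\<^sub>G homog k w) j = vcoset j (grs (monom c i) (\<lambda>i. z (j + int i)))"
    by (rule G_smult_reps[OF hom_closed[OF assms] z])
  also have "grs (monom c i) (\<lambda>i. z (j + int i)) = poly_op (monom c i) \<odot> z (j + int i)"
  proof (cases "c = 0")
    case True
    then have "grs (monom c i) (\<lambda>i. z (j + int i)) = \<zero>" by (intro grs_zero) simp
    moreover have "poly_op (monom c i) \<odot> z (j + int i) = \<zero>"
      using True N.sm_zero[of "z (j + int i)"] U_closed[OF z(1)] by simp
    ultimately show ?thesis by simp
  next
    case False
    then have "{i'. coeff (monom c i) i' \<noteq> 0} = {i}" by auto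
    moreover have "poly_op (monom c i) \<odot> z (j + int i) \<in> carrier M"
      using U_closed[OF z(1)] by (intro poly_closed)
    ultimately show ?thesis unfolding grs_def by simp
  qed
  finally have eq: "(monom c i \<odot>\<^sub>G homog k w) j = vcoset j (poly_op (monom c i) \<odot> z (j + int i))" .
  show "(monom c i \<odot>\<^sub>G homog k w) j = homog (k - int i) (poly_op (monom c i) \<odot> w) j"
  proof (cases "j = k - int i")
    case True
    then show ?thesis unfolding eq by (simp add: z_def homog_def)
  next
    case False
    then have "z (j + int i) = \<zero>" by (simp add: z_def)
    then show ?thesis
      using False vcoset_trivial[OF U_zero] unfolding eq by (simp add: homog_def act_r_zero poly_op_weyl)
  qed
qed

text \<open>One nontrivial component is split off at a time, by induction on their number.\<close>

lemma G_hom_induct: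
  assumes "u \<in> carrier G" "\<zero>\<^sub>G \<in> S"
    and add: "\<And>u v. u \<in> carrier G \<Longrightarrow> v \<in> carrier G \<Longrightarrow> u \<in> S \<Longrightarrow> v \<in> S \<Longrightarrow> u \<oplus>\<^sub>G v \<in> S"
    and homog: "\<And>k w. w \<in> U k \<Longrightarrow> homog k w \<in> S"
  shows "u \<in> S"
  using assms(1)
proof (induction "card (G_support u)" arbitrary: u)
  case 0
  then have "G_support u = {}" using finite_G_support by auto
  then have "u = \<zero>\<^sub>G" by (auto simp: G_support_def G_simps)
  then show ?case using assms(2) by simp
next
  case (Suc c)
  have fin: "finite (G_support u)" using Suc.prems by (rule finite_G_support)
  from Suc.hyps(2) obtain k where k: "k \<in> G_support u" by (metis card.empty ex_in_conv nat.distinct(1))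
  define v where "v = u(k := U (k - 1))"
  have supp: "G_support v = G_support u - {k}" by (auto simp: v_def G_support_def)
  have v: "v \<in> carrier G"
  proof -
    have "v j \<in> vcoset j ` U j" for j
      using G_coset[OF Suc.prems, of j] vcoset_trivial[OF U_zero, of j] U_zero[of j]
      by (auto simp: v_def intro: image_eqI[of _ _ \<zero>])
    moreover have "finite (G_support v)" using fin supp by simp
    ultimately show ?thesis unfolding G_simps(1) G_support_def by blast
  qed
  obtain w where w: "w \<in> U k" "u k = vcoset k w" using G_coset[OF Suc.prems] by blast
  have "u j = (v \<oplus>\<^sub>G homog k w) j" for j
  proof (cases "j = k")
    case True
    then show ?thesis using w trivial_add U_closed by (simp add: G_simps v_def homog_def)
  next
    case False
    obtain z where z: "z \<in> U j" "u j = vcoset j z" using G_coset[OF Suc.prems] by blast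
    then show ?thesis
      using False vcoset_add[of z \<zero> j] vcoset_trivial[OF U_zero, of j] U_closed by (simp add: G_simps v_def homog_def)
  qed
  then have "u = v \<oplus>\<^sub>G homog k w" by blast
  moreover have "v \<in> S" using Suc.hyps v supp fin k by simp
  ultimately show ?case using add[OF v hom_closed[OF w(1)] _ homog[OF w(1)]] by simp
qed

section \<open>Coordinates on the associated graded module and its rank\<close>

context
  fixes r :: nat and g :: "nat \<Rightarrow> nat \<Rightarrow> complex poly fract"
  assumes basis: "W.mod_basis r g"
begin

interpretation R: reduction_basis W n r g
  by unfold_locales (rule basis)

text \<open>The map from \<open>U k / U (k - 1)\<close> to \<open>W/xW\<close> induced by
  \<open>lev k\<close>, in the coordinates given by \<open>g\<close>, with its complex values
  regarded as constants of \<open>\<complex>(x)\<close>.\<close>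

definition dl :: "int \<Rightarrow> 'm set \<Rightarrow> nat \<Rightarrow> complex poly fract" where
  "dl k A i = cst (R.red (lev k (SOME w. w \<in> A)) i)"

lemma red_lev_lower: "h \<in> U (k - 1) \<Longrightarrow> i < r \<Longrightarrow> R.red (lev k h) i = 0"
proof -
  assume h: "h \<in> U (k - 1)" "i < r"
  have "lev k h = (\<lambda>j. rat_X * lev (k - 1) h j)" using lev_lower by blast
  then show ?thesis using R.red_X[OF lev_mem[OF h(1)] h(2)] by simp
qed

lemma dl_vcoset:
  assumes "w \<in> U k" "i < r"
  shows "dl k (vcoset k w) i = cst (R.red (lev k w) i)"
proof -
  have "(SOME v. v \<in> vcoset k w) \<in> vcoset k w"
    by (rule someI[of _ w]) (rule vcoset_self[OF U_closed[OF assms(1)]])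
  then obtain h where h: "h \<in> U (k - 1)" "(SOME v. v \<in> vcoset k w) = h \<oplus> w" by (auto simp: vcoset_iff)
  have "h \<in> U k" using h(1) U_mono[of "k - 1" k] by auto
  then have "R.red (lev k (h \<oplus> w)) i = R.red (lev k h) i + R.red (lev k w) i"
    using assms U_closed by (simp add: lev_add R.red_add lev_mem)
  then show ?thesis by (simp add: dl_def h(2) red_lev_lower[OF h(1) assms(2)])
qed

lemma dl_trivial: "i < r \<Longrightarrow> dl k (U (k - 1)) i = 0"
  using dl_vcoset[OF U_zero, of i k] red_lev_lower[OF U_zero, of i k] vcoset_trivial[OF U_zero, of k] by simp

text \<open>The factor \<open>x ^ (k0 - k)\<close> undoes the shift built into \<open>lev k\<close>.
  It is needed for linearity: multiplication by \<open>x\<close> lowers the degree by 1 but leaves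
  the reduced component unchanged, so the action of \<open>x\<close> has to be recorded by the
  degree.\<close>

definition gr_coords :: "(int \<Rightarrow> 'm set) \<Rightarrow> nat \<Rightarrow> complex poly fract" where
  "gr_coords u i = (if i < r then \<Sum>k\<in>G_support u. rat_X powi (k0 - k) * dl k (u k) i else 0)"

lemma gr_coords_superset:
  assumes "finite J" "G_support u \<subseteq> J" "i < r"
  shows "gr_coords u i = (\<Sum>k\<in>J. rat_X powi (k0 - k) * dl k (u k) i)"
  unfolding gr_coords_def using assms
  by (simp, intro sum.mono_neutral_left) (auto simp: G_support_def dl_trivial)

lemma gr_coords_add:
  assumes "u \<in> carrier G" "v \<in> carrier G"
  shows "gr_coords (u \<oplus>\<^sub>G v) i = gr_coords u i + gr_coords v i"
proof (cases "i < r")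
  case True
  let ?J = "G_support u \<union> G_support v \<union> G_support (u \<oplus>\<^sub>G v)"
  have "dl k ((u \<oplus>\<^sub>G v) k) i = dl k (u k) i + dl k (v k) i" for k
  proof -
    obtain w where w: "w \<in> U k" "u k = vcoset k w" using G_coset[OF assms(1)] by blast
    obtain z where z: "z \<in> U k" "v k = vcoset k z" using G_coset[OF assms(2)] by blast
    have "(u \<oplus>\<^sub>G v) k = vcoset k (w \<oplus> z)" using w z U_closed by (simp add: G_simps vcoset_add)
    moreover have "cst (a + a') = cst a + cst a'" for a a' by (simp flip: to_fract_add)
    ultimately show ?thesis
      using w z True U_closed by (simp only: dl_vcoset U_add lev_add R.red_add lev_mem)
  qed
  moreover have fin: "finite ?J" using assms G_add_closed finite_G_support by auto
  ultimately show ?thesis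
    using gr_coords_superset[OF fin _ True, of u, OF le_supI1[OF Un_upper1]]
      gr_coords_superset[OF fin _ True, of v, OF le_supI1[OF Un_upper2]]
      gr_coords_superset[OF fin _ True, of "u \<oplus>\<^sub>G v", OF Un_upper2]
    by (simp add: distrib_left sum.distrib)
qed (simp add: gr_coords_def)

text \<open>The normalisation of \<open>lev\<close> absorbs \<open>x\<^sup>i\<close> entirely; only
  the constant \<open>c\<close> remains.\<close>

lemma lev_poly_monom:
  assumes "w \<in> carrier M"
  shows "lev j (poly_op (monom c i) \<odot> w) = (\<lambda>l. cst c * lev (j + int i) w l)"
proof -
  have "to_fract (monom c i) = cst c * rat_X ^ i"
  proof -
    have "monom c i = [:c:] * poly_X ^ i" by (simp add: monom_altdef)
    then show ?thesis by (simp only: rat_X_power to_fract_mult)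
  qed
  moreover have "rat_X powi (j + int i - k0) = rat_X powi (j - k0) * rat_X ^ i"
    using power_int_add[of rat_X "j - k0" "int i"] rat_X_nz by (simp add: algebra_simps)
  ultimately show ?thesis using assms
    by (simp only: lev_def crd_poly mult.assoc mult.left_commute fun_eq_iff) simp
qed

lemma dl_smult:
  assumes u: "u \<in> carrier G" and i: "i < r"
  shows "dl j ((p \<odot>\<^sub>G u) j) i = (\<Sum>l\<le>degree p. cst (coeff p l) * dl (j + int l) (u (j + int l)) i)"
proof -
  obtain w where w: "\<And>k. w k \<in> U k" "\<And>k. u k = vcoset k (w k)"
    using G_reps[OF u] by metis
  have wc: "w k \<in> carrier M" for k by (rule U_closed[OF w(1)])
  let ?I = "{l. coeff p l \<noteq> 0}"
  have mem: "grs p (\<lambda>l. w (j + int l)) \<in> U j" by (intro grs_mem w)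
  have "lev j (grs p (\<lambda>l. w (j + int l))) = (\<lambda>k. \<Sum>l\<in>?I. cst (coeff p l) * lev (j + int l) (w (j + int l)) k)"
  proof
    fix k
    have "lev j (grs p (\<lambda>l. w (j + int l))) k = (\<Sum>l\<in>?I. lev j (poly_op (monom (coeff p l) l) \<odot> w (j + int l)) k)"
      unfolding lev_def grs_def using wc by (subst crd_finsum) (auto simp: sum_distrib_left intro!: poly_closed)
    also have "\<dots> = (\<Sum>l\<in>?I. cst (coeff p l) * lev (j + int l) (w (j + int l)) k)"
      by (simp only: lev_poly_monom[OF wc])
    finally show "lev j (grs p (\<lambda>l. w (j + int l))) k = (\<Sum>l\<in>?I. cst (coeff p l) * lev (j + int l) (w (j + int l)) k)" .
  qed
  then have "R.red (lev j (grs p (\<lambda>l. w (j + int l)))) i = (\<Sum>l\<in>?I. coeff p l * R.red (lev (j + int l) (w (j + int l))) i)"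
    using R.red_sum[OF finite_support_coeff _ i, of p "\<lambda>l. lev (j + int l) (w (j + int l))" "coeff p"] lev_mem[OF w(1)]
    by simp
  moreover have "dl j ((p \<odot>\<^sub>G u) j) i = cst (R.red (lev j (grs p (\<lambda>l. w (j + int l)))) i)"
    unfolding G_smult_reps[OF u w] by (rule dl_vcoset[OF mem i])
  moreover have "cst (\<Sum>l\<in>A. f l * h l) = (\<Sum>l\<in>A. cst (f l) * cst (h l))" for A and f h :: "nat \<Rightarrow> complex"
  proof (induction A rule: infinite_finite_induct)
    case (insert a A)
    have "cst (f a * h a + b) = cst (f a) * cst (h a) + cst b" for b
      by (simp flip: to_fract_add to_fract_mult)
    then show ?case using insert by simp
  qed auto
  ultimately have "dl j ((p \<odot>\<^sub>G u) j) i = (\<Sum>l\<in>?I. cst (coeff p l) * dl (j + int l) (u (j + int l)) i)"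
    by (simp only: w(2) dl_vcoset[OF w(1) i])
  also have "\<dots> = (\<Sum>l\<le>degree p. cst (coeff p l) * dl (j + int l) (u (j + int l)) i)"
    by (intro sum.mono_neutral_left) (auto intro: le_degree)
  finally show ?thesis .
qed

lemma to_fract_eq_sum: "to_fract p = (\<Sum>l\<le>degree p. cst (coeff p l) * rat_X ^ l)"
proof -
  have "to_fract p = to_fract (\<Sum>l\<le>degree p. monom (coeff p l) l)" by (simp only: poly_as_sum_of_monoms)
  also have "\<dots> = (\<Sum>l\<le>degree p. cst (coeff p l) * rat_X ^ l)"
    unfolding to_fract_sum
    by (intro sum.cong refl) (simp only: rat_X_power to_fract_mult[symmetric], simp add: monom_altdef)
  finally show ?thesis .
qed

lemma gr_coords_smult:
  assumes u: "u \<in> carrier G"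
  shows "gr_coords (p \<odot>\<^sub>G u) i = to_fract p * gr_coords u i"
proof (cases "i < r")
  case i: True
  define J where "J = (\<lambda>(k, l). k - int l) ` (G_support u \<times> {..degree p})"
  have finJ: "finite J" unfolding J_def using finite_G_support[OF u] by simp
  have "gr_coords (p \<odot>\<^sub>G u) i = (\<Sum>j\<in>J. rat_X powi (k0 - j) * dl j ((p \<odot>\<^sub>G u) j) i)"
    using G_smult_support[OF u] by (intro gr_coords_superset finJ i) (simp add: J_def)
  also have "\<dots> = (\<Sum>l\<le>degree p. \<Sum>j\<in>J. rat_X powi (k0 - j) * (cst (coeff p l) * dl (j + int l) (u (j + int l)) i))"
    unfolding dl_smult[OF u i] sum_distrib_left by (rule sum.swap)
  also have "\<dots> = (\<Sum>l\<le>degree p. cst (coeff p l) * rat_X ^ l * gr_coords u i)"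
  proof (intro sum.cong refl)
    fix l assume l: "l \<in> {..degree p}"
    \<comment> \<open>Passing from the weight of degree \<open>j + l\<close> to that of degree
      \<open>j\<close> produces exactly the factor \<open>x\<^sup>l\<close> of the monomial.\<close>
    have shift: "rat_X powi (k0 - j) = rat_X ^ l * rat_X powi (k0 - (j + int l))" for j
      using power_int_add[of rat_X "int l" "k0 - (j + int l)"] rat_X_nz by simp
    have "(\<Sum>j\<in>J. rat_X powi (k0 - j) * (cst (coeff p l) * dl (j + int l) (u (j + int l)) i))
      = (\<Sum>j\<in>J. (cst (coeff p l) * rat_X ^ l) * (rat_X powi (k0 - (j + int l)) * dl (j + int l) (u (j + int l)) i))"
      by (intro sum.cong refl, subst shift) (simp only: mult_ac)
    also have "\<dots> = (cst (coeff p l) * rat_X ^ l) * (\<Sum>j\<in>J. rat_X powi (k0 - (j + int l)) * dl (j + int l) (u (j + int l)) i)"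
      by (rule sum_distrib_left[symmetric])
    also have "(\<Sum>j\<in>J. rat_X powi (k0 - (j + int l)) * dl (j + int l) (u (j + int l)) i)
      = (\<Sum>k\<in>(\<lambda>j. j + int l) ` J. rat_X powi (k0 - k) * dl k (u k) i)"
      by (subst sum.reindex) (auto simp: inj_on_def)
    also have "\<dots> = gr_coords u i"
    proof (rule gr_coords_superset[symmetric])
      show "G_support u \<subseteq> (\<lambda>j. j + int l) ` J"
      proof
        fix k assume "k \<in> G_support u"
        then have "k - int l \<in> J" unfolding J_def using l by (intro image_eqI[of _ _ "(k, l)"]) auto
        then show "k \<in> (\<lambda>j. j + int l) ` J" by (intro image_eqI[of _ _ "k - int l"]) auto
      qed
    qed (use finJ i in auto)
    finally show "(\<Sum>j\<in>J. rat_X powi (k0 - j) * (cst (coeff p l) * dl (j + int l) (u (j + int l)) i))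
      = cst (coeff p l) * rat_X ^ l * gr_coords u i" .
  qed
  also have "\<dots> = to_fract p * gr_coords u i"
    by (subst to_fract_eq_sum) (simp only: sum_distrib_right)
  finally show ?thesis .
qed (simp add: gr_coords_def)

lemma gr_coords_hom:
  assumes "w \<in> U k0" "i < r"
  shows "gr_coords (homog k0 w) i = cst (R.red (crd w) i)"
proof -
  have "G_support (homog k0 w) \<subseteq> {k0}" by (auto simp: G_support_def homog_def)
  then have "gr_coords (homog k0 w) i = (\<Sum>k\<in>{k0}. rat_X powi (k0 - k) * dl k (homog k0 w k) i)"
    by (intro gr_coords_superset assms) auto
  also have "\<dots> = cst (R.red (lev k0 w) i)" using dl_vcoset[OF assms] by (simp add: homog_def)
  also have "lev k0 w = crd w" by (simp add: lev_def)
  finally show ?thesis .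
qed

text \<open>Duality is immediate from \<open>red_g\<close>; the work lies in generation. In degree
  \<open>k0\<close> an element is a combination of the lifts \<open>w i\<close> modulo
  \<open>x U\<^sub>k\<^sub>0\<close> only up to torsion of \<open>M\<close>, which is treated
  separately. The other degrees are reached from \<open>k0\<close> by multiplication and division by
  powers of \<open>x\<close>.\<close>

lemma gr_tensor_basis:
  assumes w: "\<And>i. i < r \<Longrightarrow> w i \<in> U k0" "\<And>i. i < r \<Longrightarrow> g i = crd (w i)"
  shows "tensor_basis to_fract G gr_coords r (\<lambda>i. homog k0 (w i))"
proof
  show "\<zero>\<^sub>G \<oplus>\<^sub>G \<zero>\<^sub>G = \<zero>\<^sub>G"
    using hom_add[OF U_zero U_zero, of 0] hom_zero[OF U_zero, of 0] by simp
  show "gr_coords (homog k0 (w i)) k = (if i = k then 1 else 0)" if "i < r" "k < r" for i k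
    using gr_coords_hom[OF w(1) that(2)] R.red_g that w(2) by (simp add: one_pCons[symmetric])
  fix S assume base: "\<And>i. i < r \<Longrightarrow> homog k0 (w i) \<in> S" and zero: "\<zero>\<^sub>G \<in> S"
    and add: "\<And>u v. u \<in> carrier G \<Longrightarrow> v \<in> carrier G \<Longrightarrow> u \<in> S \<Longrightarrow> v \<in> S \<Longrightarrow> u \<oplus>\<^sub>G v \<in> S"
    and smult: "\<And>p u. u \<in> carrier G \<Longrightarrow> u \<in> S \<Longrightarrow> p \<odot>\<^sub>G u \<in> S"
    and divide: "\<And>p u. u \<in> carrier G \<Longrightarrow> p \<noteq> 0 \<Longrightarrow> p \<odot>\<^sub>G u \<in> S \<Longrightarrow> u \<in> S"
  \<comment> \<open>Write \<open>p = x\<^sup>d q\<close> with \<open>q = q0 + x q'\<close> and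
    \<open>q0 \<noteq> 0\<close>. Then \<open>p t = 0\<close> puts \<open>q0 x\<^sup>d t\<close>
    into \<open>U (k0 - d - 1)\<close>, one level below the expected \<open>k0 - d\<close>; so the
    monomial \<open>q0 x\<^sup>d\<close> kills the class of \<open>t\<close>.\<close>
  have tors: "homog k0 t \<in> S" if t: "t \<in> U k0" and p: "p \<noteq> 0" "poly_op p \<odot> t = \<zero>" for t p
  proof -
    have tc: "t \<in> carrier M" by (rule U_closed[OF t])
    obtain d q where q: "p = poly_X ^ d * q" "poly q 0 \<noteq> 0"
      using divide_power_X[of "{()}" "()" "\<lambda>_. p"] p(1) by auto
    obtain q0 q' where q0: "q = pCons q0 q'" by (cases q)
    have "q0 \<noteq> 0" using q(2) q0 by simp
    have "p = monom q0 d + poly_X ^ Suc d * q'"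
      by (simp add: q(1) q0 monom_altdef algebra_simps flip: smult_monom)
    then have "poly_op (monom q0 d) \<odot> t \<oplus> poly_op (poly_X ^ Suc d * q') \<odot> t = \<zero>"
      using p(2) poly_act_add[OF tc] by simp
    then have "poly_op (monom q0 d) \<odot> t = \<ominus> (poly_op (poly_X ^ Suc d * q') \<odot> t)"
      using tc poly_closed by (metis minus_equality)
    moreover have "poly_op (poly_X ^ Suc d * q') \<odot> t \<in> U (k0 - int d - 1)"
      using U_X_power[OF U_poly[OF t], of "Suc d" q'] tc by (simp only: poly_act_mult) (simp add: algebra_simps)
    ultimately have "poly_op (monom q0 d) \<odot> t \<in> U (k0 - int d - 1)" by (simp add: U_uminus)
    then have "monom q0 d \<odot>\<^sub>G homog k0 t = \<zero>\<^sub>G"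
      using hom_monom[OF t] hom_zero by simp
    then show ?thesis
      using divide[OF hom_closed[OF t], of "monom q0 d"] zero \<open>q0 \<noteq> 0\<close> by simp
  qed
  \<comment> \<open>\<open>u\<close> has the same coordinates as \<open>y = x + x_op v'\<close>,
    where \<open>x\<close> is a constant combination of the lifts, so \<open>u\<close> and
    \<open>y\<close> differ by torsion. The class of \<open>x_op v'\<close> in degree
    \<open>k0\<close> is 0.\<close>
  have level0: "homog k0 u \<in> S" if u: "u \<in> U k0" for u
  proof -
    have "crd u \<in> W" unfolding W_def using u by simp
    then obtain v where v: "v \<in> W" "\<forall>k. crd u k = (\<Sum>i<r. cst (R.red (crd u) i) * g i k) + rat_X * v k"
      using R.red_ex by blast
    obtain v' where v': "v' \<in> U k0" "v = crd v'" using v(1) by (auto simp: W_def)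
    define c where "c = R.red (crd u)"
    define x where "x = (\<Oplus>i\<in>{..<r}. poly_op (monom (c i) 0) \<odot> w i)"
    have wc: "w i \<in> carrier M" if "i < r" for i using U_closed[OF w(1)[OF that]] .
    have sums: "homog k0 (\<Oplus>i\<in>{..<j}. poly_op (monom (c i) 0) \<odot> w i) \<in> S \<and> (\<Oplus>i\<in>{..<j}. poly_op (monom (c i) 0) \<odot> w i) \<in> U k0"
      if "j \<le> r" for j
      using that
    proof (induction j)
      case 0
      then show ?case using hom_zero[OF U_zero] zero U_zero by simp
    next
      case (Suc j)
      let ?s = "\<Oplus>i\<in>{..<j}. poly_op (monom (c i) 0) \<odot> w i" and ?t = "poly_op (monom (c j) 0) \<odot> w j"
      have t: "?t \<in> U k0" using U_poly w(1) Suc.prems by simp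
      have "homog k0 ?t = monom (c j) 0 \<odot>\<^sub>G homog k0 (w j)"
        using hom_monom[of "w j" k0 "c j" 0] w(1) Suc.prems by simp
      then have tS: "homog k0 ?t \<in> S" using smult[OF hom_closed base] w(1) Suc.prems by simp
      have "(\<lambda>i. poly_op (monom (c i) 0) \<odot> w i) \<in> {..<j} \<rightarrow> carrier M"
        using wc Suc.prems by (auto intro!: poly_closed)
      then have eq: "(\<Oplus>i\<in>{..<Suc j}. poly_op (monom (c i) 0) \<odot> w i) = ?t \<oplus> ?s"
        unfolding lessThan_Suc using U_closed[OF t] by simp
      have s: "homog k0 ?s \<in> S" "?s \<in> U k0" using Suc by auto
      have "homog k0 (?t \<oplus> ?s) \<in> S"
        using add[OF hom_closed[OF t] hom_closed[OF s(2)] tS s(1)] hom_add[OF t s(2)] by simp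
      then show ?case unfolding eq using U_add[OF t s(2)] by blast
    qed
    have x: "homog k0 x \<in> S" "x \<in> U k0" using sums[of r] by (auto simp: x_def)
    have Xv: "x_op \<odot> v' \<in> U (k0 - 1)" by (rule U_x[OF v'(1)])
    then have Xv0: "x_op \<odot> v' \<in> U k0" using U_mono[of "k0 - 1" k0] by auto
    define y where "y = x \<oplus> x_op \<odot> v'"
    have y: "y \<in> U k0" unfolding y_def by (intro U_add x Xv0)
    have "crd y k = crd u k" for k
    proof -
      have "crd x k = (\<Sum>i<r. crd (poly_op (monom (c i) 0) \<odot> w i) k)"
        unfolding x_def using wc by (intro crd_finsum) (auto intro!: poly_closed)
      also have "\<dots> = (\<Sum>i<r. cst (c i) * g i k)"
        by (intro sum.cong refl) (simp add: crd_poly wc w(2) monom_0)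
      finally show ?thesis
        using v(2) v' crd_poly[OF U_closed[OF v'(1)], of poly_X k] x(2) Xv0 U_closed
        by (simp add: y_def crd_add c_def poly_op_X)
    qed
    then have "crd (poly_op (- 1) \<odot> y \<oplus> u) k = 0" for k
      using U_closed[OF y] U_closed[OF u] by (simp add: crd_add crd_poly poly_closed)
    then obtain p where p: "p \<noteq> 0" "poly_op p \<odot> (poly_op (- 1) \<odot> y \<oplus> u) = \<zero>"
      using N.coords_eq_0_imp_torsion[of "poly_op (- 1) \<odot> y \<oplus> u"] U_closed[OF y] U_closed[OF u]
      by (auto simp: poly_closed)
    have t: "poly_op (- 1) \<odot> y \<oplus> u \<in> U k0" by (intro U_add U_poly y u)
    have "poly_op (- 1) \<odot> y = \<ominus> y"
      using N.sm_uminus[of y 1] U_closed[OF y] poly_act_one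
    proof -
      have "poly_op (- 1) \<odot> y \<oplus> y = \<zero>"
        using poly_act_add[OF U_closed[OF y], of "- 1" 1] poly_act_one[OF U_closed[OF y]] N.sm_zero[of y] U_closed[OF y] by simp
      then show ?thesis using U_closed[OF y] poly_closed by (metis minus_equality)
    qed
    then have u_eq: "u = (x \<oplus> x_op \<odot> v') \<oplus> (poly_op (- 1) \<odot> y \<oplus> u)"
      using U_closed[OF y] U_closed[OF u] by (simp add: y_def[symmetric] r_neg2)
    have "homog k0 y \<in> S"
    proof -
      have "homog k0 y = homog k0 x \<oplus>\<^sub>G \<zero>\<^sub>G"
        using hom_add[OF x(2) Xv0] hom_zero[OF Xv] by (simp add: y_def)
      then show ?thesis using add[OF hom_closed[OF x(2)] G_zero_closed x(1) zero] by simp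
    qed
    then have "homog k0 (y \<oplus> (poly_op (- 1) \<odot> y \<oplus> u)) \<in> S"
      using add[OF hom_closed[OF y] hom_closed[OF t] _ tors[OF t p]] hom_add[OF y t] by simp
    then show ?thesis using u_eq by (simp add: y_def)
  qed
  \<comment> \<open>Above \<open>k0\<close>, a power of \<open>x\<close> moves the class into degree
    \<open>k0\<close>, and division leads back. Below \<open>k0\<close>, the element is itself a
    power of \<open>x\<close> times an element of \<open>U k0\<close>.\<close>
  have "homog k u \<in> S" if u: "u \<in> U k" for k u
  proof (cases "k \<ge> k0")
    case True
    then have "poly_op (monom 1 (nat (k - k0))) \<odot> u \<in> U k0"
      using U_monom[OF u, of 1 "nat (k - k0)"] by simp
    then have "monom 1 (nat (k - k0)) \<odot>\<^sub>G homog k u \<in> S"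
      using hom_monom[OF u, of 1 "nat (k - k0)"] level0 True by simp
    then show ?thesis using divide[OF hom_closed[OF u], of "monom 1 (nat (k - k0))"] by simp
  next
    case False
    then have "u \<in> U (k0 - int (nat (k0 - k)))" using u by simp
    then obtain v where v: "v \<in> U k0" "u = poly_op (monom 1 (nat (k0 - k))) \<odot> v"
      using U_divide_X_power[of k0 u "nat (k0 - k)"] by (auto simp: monom_altdef)
    have "homog k u = monom 1 (nat (k0 - k)) \<odot>\<^sub>G homog k0 v"
      using hom_monom[OF v(1), of 1 "nat (k0 - k)"] False v(2) by simp
    then show ?thesis using smult[OF hom_closed[OF v(1)] level0[OF v(1)]] by simp
  qed
  then show "carrier G \<subseteq> S" using G_hom_induct[OF _ zero add] by blast
qed (use G_zero_closed G_add_closed G_smult_closed gr_coords_add gr_coords_smult hom_closed w in auto)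

lemma rank_gr: "rank (gr M U) = enat r"
proof -
  have "\<forall>i. \<exists>w. i < r \<longrightarrow> w \<in> U k0 \<and> g i = crd w" using R.g_mem by (auto simp: W_def)
  then obtain w where "\<And>i. i < r \<Longrightarrow> w i \<in> U k0" "\<And>i. i < r \<Longrightarrow> g i = crd (w i)" by metis
  then interpret B: tensor_basis to_fract G gr_coords r "\<lambda>i. homog k0 (w i)" by (rule gr_tensor_basis)
  show ?thesis unfolding rank_def rational_extension_def using B.fin_dim_T B.dim_T by simp
qed

end

lemma rank_M: "rank M = enat n"
proof -
  interpret B: tensor_basis to_fract poly_mod "\<lambda>x k. fract_ext to_fract (crd x k)" n b
    by (rule N.tensor_basis_coords) (rule rat.poly_embedding_axioms)
  show ?thesis
    unfolding rank_def rational_extension_def poly_mod_def[symmetric] using B.fin_dim_T B.dim_T by simp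
qed

end

section \<open>Regularity and lattices\<close>

lemma theta_lookup: "Poly_Mapping.lookup (\<theta> f) k = of_int k * Poly_Mapping.lookup f k"
  by simp

lemma theta_mult: "\<theta> (f * g) = \<theta> f * g + f * \<theta> g"
proof (induction f rule: laurent_induct)
  case (single n c)
  have s: "\<theta> (Poly_Mapping.single n c) = Poly_Mapping.single n (of_int n * c)"
    by (intro poly_mapping_eqI) (auto simp only: theta_lookup lookup_single when_def, auto)
  show ?case
    unfolding s
    by (intro poly_mapping_eqI) (simp only: theta_lookup lookup_add lookup_single_times, simp add: algebra_simps)
next
  case (sum f f')
  have "\<theta> (a + b) = \<theta> a + \<theta> b" for a b
    by (simp add: d_op_add x_op_add)
  with sum show ?case by (simp only: distrib_right distrib_left add_ac)
qed

text \<open>The commutator of \<open>\<theta>\<close> with \<open>p\<close> is \<open>x p'\<close>.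
  This is what makes the Euler operator compatible with moving \<open>p\<close> across the tensor
  sign.\<close>

lemma theta_poly_op:
  "\<theta> \<circ> poly_op p = (\<lambda>f. poly_op (poly_X * pderiv p) f + (poly_op p \<circ> \<theta>) f)"
proof -
  have "\<theta> (laurent_of_poly p) = laurent_of_poly (poly_X * pderiv p)"
  proof (rule poly_mapping_eqI)
    fix k :: int
    show "Poly_Mapping.lookup (\<theta> (laurent_of_poly p)) k = Poly_Mapping.lookup (laurent_of_poly (poly_X * pderiv p)) k"
    proof (cases "k > 0")
      case True
      then obtain j where j: "k = int (Suc j)" by (metis gr0_implies_Suc zero_less_imp_eq_int)
      then show ?thesis
        by (simp only: theta_lookup laurent_of_poly_lookup) (simp add: coeff_pderiv coeff_pCons nat_add_distrib)
    next
      case False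
      then have "k = 0 \<or> \<not> k \<ge> 0" by auto
      then show ?thesis by (auto simp only: theta_lookup laurent_of_poly_lookup) (auto simp: coeff_pCons)
    qed
  qed
  then have "\<theta> (laurent_of_poly p * f) = laurent_of_poly (poly_X * pderiv p) * f + laurent_of_poly p * \<theta> f" for f
    by (simp only: theta_mult)
  then show ?thesis by (simp add: poly_op_def fun_eq_iff)
qed

text \<open>Membership in \<open>x ^ (-e) \<complex>[[x]]\<close>, expressed by a power series
  rather than by the order, so that sums need no case distinction on cancellation.\<close>

definition fls_integral_part :: "nat \<Rightarrow> complex fls \<Rightarrow> bool" where
  "fls_integral_part e z \<longleftrightarrow> (\<exists>h. fls_X ^ e * z = fps_to_fls h)"

lemma fls_integral_part_add: "fls_integral_part e y \<Longrightarrow> fls_integral_part e z \<Longrightarrow> fls_integral_part e (y + z)"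
  unfolding fls_integral_part_def by (metis distrib_left fps_to_fls_plus)

lemma fls_integral_part_mult: "fls_integral_part e z \<Longrightarrow> fls_integral_part e (fps_to_fls h * z)"
  unfolding fls_integral_part_def by (metis fls_times_fps_to_fls mult.left_commute)

lemma fls_integral_part_zero: "fls_integral_part e 0"
  unfolding fls_integral_part_def by (intro exI[of _ 0]) simp

lemma fls_integral_part_mono:
  assumes "fls_integral_part e z" "e \<le> e'"
  shows "fls_integral_part e' z"
proof -
  obtain h where h: "fls_X ^ e * z = fps_to_fls h" using assms(1) by (auto simp: fls_integral_part_def)
  have "fls_X ^ e' * z = fls_X ^ (e' - e) * (fls_X ^ e * z)"
    using assms(2) by (simp add: mult.assoc[symmetric] power_add[symmetric])
  also have "\<dots> = fps_to_fls (fps_X ^ (e' - e) * h)"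
    by (simp add: h fls_times_fps_to_fls fps_to_fls_power)
  finally show ?thesis unfolding fls_integral_part_def by blast
qed

lemma fls_integral_part_ex: "\<exists>e. fls_integral_part e z"
proof -
  define e where "e = nat (- fls_subdegree z)"
  have "fls_X ^ e * z = fps_to_fls (fls_regpart (fls_X ^ e * z))"
  proof (rule fls_eqI)
    fix k
    have "fls_nth (fls_X ^ e * z) k = fls_nth z (k - int e)" by (simp add: fls_X_power_times_conv_shift)
    moreover have "fls_nth z (k - int e) = 0" if "k < 0" using that by (intro fls_eq0_below_subdegree) (simp add: e_def)
    ultimately show "fls_nth (fls_X ^ e * z) k = fls_nth (fps_to_fls (fls_regpart (fls_X ^ e * z))) k" by auto
  qed
  then show ?thesis unfolding fls_integral_part_def by blast
qed

lemma fls_integral_part_subdegree: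
  assumes "fls_integral_part e z" "z \<noteq> 0"
  shows "- int e \<le> fls_subdegree z"
proof -
  obtain h where h: "fls_X ^ e * z = fps_to_fls h" using assms(1) by (auto simp: fls_integral_part_def)
  have "fls_subdegree (fls_X ^ e * z) = int e + fls_subdegree z"
    using assms(2) by (simp add: fls_X_power_times_conv_shift)
  then show ?thesis using h fls_subdegree_fls_to_fps_gt0[of h] by simp
qed

section \<open>The Euler operator on the Laurent extension\<close>

context finite_rank_V_module
begin

abbreviation to_fls :: "complex poly \<Rightarrow> complex fls" where
  "to_fls \<equiv> \<lambda>p. fps_to_fls (fps_of_poly p)"

interpretation B: tensor_basis to_fls poly_mod "\<lambda>x k. to_laurent (crd x k)" n b
  by (rule N.tensor_basis_coords[OF laur.poly_embedding_axioms])

abbreviation tensor_add (infixl "\<oplus>\<^sub>T" 65) where "t \<oplus>\<^sub>T t' \<equiv> t \<oplus>\<^bsub>B.T\<^esub> t'"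
abbreviation tensor_smult (infixr "\<odot>\<^sub>T" 70) where "a \<odot>\<^sub>T t \<equiv> a \<odot>\<^bsub>B.T\<^esub> t"
abbreviation tensor_zero ("\<zero>\<^sub>T") where "\<zero>\<^sub>T \<equiv> \<zero>\<^bsub>B.T\<^esub>"

lemma laurent_extension_eq: "laurent_extension M = B.T"
  by (simp add: laurent_extension_def poly_mod_def)

definition leib :: "complex fls \<times> 'm \<Rightarrow> (complex fls \<times> 'm \<Rightarrow>\<^sub>0 int)" where
  "leib = (\<lambda>(f, u). frag_of (fls_X * fls_deriv f, u) + frag_of (f, \<theta> \<odot> u))"

lemma theta_weyl: "\<theta> \<in> weyl_ops"
  by (intro weyl_ops.intros)

lemma theta_closed: "u \<in> carrier M \<Longrightarrow> \<theta> \<odot> u \<in> carrier M"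
  by (intro act_closed theta_weyl)

lemma theta_poly_act:
  assumes "u \<in> carrier M"
  shows "\<theta> \<odot> (poly_op p \<odot> u) = poly_op (poly_X * pderiv p) \<odot> u \<oplus> poly_op p \<odot> (\<theta> \<odot> u)"
proof -
  have "\<theta> \<odot> (poly_op p \<odot> u) = (\<theta> \<circ> poly_op p) \<odot> u"
    by (simp only: act_comp[OF theta_weyl poly_op_weyl assms])
  also have "\<dots> = poly_op (poly_X * pderiv p) \<odot> u \<oplus> (poly_op p \<circ> \<theta>) \<odot> u"
    unfolding theta_poly_op by (intro act_add poly_op_weyl weyl_ops.comp[OF poly_op_weyl theta_weyl] assms)
  finally show ?thesis by (simp only: act_comp[OF poly_op_weyl theta_weyl assms])
qed

lemma to_fls_deriv: "fls_X * fls_deriv (to_fls p) = to_fls (poly_X * pderiv p)"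
proof -
  have "fps_of_poly poly_X = fps_X" by (simp add: fps_of_poly_pCons)
  then have "to_fls (poly_X * pderiv p) = fps_to_fls (fps_X * fps_deriv (fps_of_poly p))"
    by (simp only: fps_of_poly_mult fps_of_poly_pderiv)
  then show ?thesis by (simp add: fls_deriv_fps_to_fls fls_times_fps_to_fls)
qed

text \<open>Well-definedness of the Euler operator on the tensor product. The third family of
  relations is the substantial one: there the Leibniz rule in \<open>\<complex>((x))\<close> has to
  match the commutation of \<open>\<theta>\<close> with \<open>p\<close> on
  \<open>M\<close>.\<close>

lemma leib_null: "z \<in> B.Z \<Longrightarrow> frag_extend leib z \<in> B.Z"
proof (induction z rule: B.null_induct)
  case (rel1 a a' u)
  then have u: "u \<in> carrier M" by simp
  have "frag_extend leib (frag_of (a + a', u) - frag_of (a, u) - frag_of (a', u))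
    = (frag_of (fls_X * fls_deriv a + fls_X * fls_deriv a', u) - frag_of (fls_X * fls_deriv a, u) - frag_of (fls_X * fls_deriv a', u))
    + (frag_of (a + a', \<theta> \<odot> u) - frag_of (a, \<theta> \<odot> u) - frag_of (a', \<theta> \<odot> u))"
    by (simp add: frag_extend_diff leib_def distrib_left)
  then show ?case using B.null_add[OF B.null_rels(1) B.null_rels(1)] u theta_closed by simp
next
  case (rel2 a u u')
  then have u: "u \<in> carrier M" "u' \<in> carrier M" by simp_all
  have "frag_extend leib (frag_of (a, u \<oplus>\<^bsub>poly_mod\<^esub> u') - frag_of (a, u) - frag_of (a, u'))
    = (frag_of (fls_X * fls_deriv a, u \<oplus>\<^bsub>poly_mod\<^esub> u') - frag_of (fls_X * fls_deriv a, u) - frag_of (fls_X * fls_deriv a, u'))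
    + (frag_of (a, \<theta> \<odot> u \<oplus>\<^bsub>poly_mod\<^esub> \<theta> \<odot> u') - frag_of (a, \<theta> \<odot> u) - frag_of (a, \<theta> \<odot> u'))"
    using u by (simp add: frag_extend_diff leib_def act_r_add[OF theta_weyl])
  moreover have "frag_of (fls_X * fls_deriv a, u \<oplus>\<^bsub>poly_mod\<^esub> u') - frag_of (fls_X * fls_deriv a, u) - frag_of (fls_X * fls_deriv a, u') \<in> B.Z"
    using u by (intro B.null_rels(2)) simp_all
  moreover have "frag_of (a, \<theta> \<odot> u \<oplus>\<^bsub>poly_mod\<^esub> \<theta> \<odot> u') - frag_of (a, \<theta> \<odot> u) - frag_of (a, \<theta> \<odot> u') \<in> B.Z"
    using theta_closed[OF u(1)] theta_closed[OF u(2)] by (intro B.null_rels(2)) simp_all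
  ultimately show ?case using B.null_add by metis
next
  case (rel3 a p u)
  then have u: "u \<in> carrier M" by simp
  let ?t = "\<theta> \<odot> u" and ?q = "poly_X * pderiv p" and ?a = "fls_X * fls_deriv a"
  have t: "?t \<in> carrier M" by (rule theta_closed[OF u])
  have d: "fls_X * fls_deriv (a * to_fls p) = ?a * to_fls p + a * to_fls ?q"
    by (simp only: fls_deriv_mult distrib_left to_fls_deriv[symmetric]) (simp only: mult_ac add_ac)
  \<comment> \<open>Each of \<open>z1\<close>, ..., \<open>z5\<close> is a single relation:
    \<open>z1\<close> separates the two terms of the derivative of \<open>a p\<close>,
    \<open>z2\<close>, \<open>z3\<close> and \<open>z4\<close> move a polynomial across the tensor
    sign, and \<open>z5\<close> separates the two terms of \<open>\<theta> (p u)\<close>.\<close>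
  define z1 where "z1 = frag_of (?a * to_fls p + a * to_fls ?q, u) - frag_of (?a * to_fls p, u) - frag_of (a * to_fls ?q, u)"
  define z2 where "z2 = frag_of (?a * to_fls p, u) - frag_of (?a, poly_op p \<odot> u)"
  define z3 where "z3 = frag_of (a * to_fls ?q, u) - frag_of (a, poly_op ?q \<odot> u)"
  define z4 where "z4 = frag_of (a * to_fls p, ?t) - frag_of (a, poly_op p \<odot> ?t)"
  define z5 where "z5 = frag_of (a, poly_op ?q \<odot> u \<oplus> poly_op p \<odot> ?t) - frag_of (a, poly_op ?q \<odot> u) - frag_of (a, poly_op p \<odot> ?t)"
  have "z1 \<in> B.Z" "z2 \<in> B.Z" "z3 \<in> B.Z" "z4 \<in> B.Z" "z5 \<in> B.Z"
    unfolding z1_def z2_def z3_def z4_def z5_def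
    using B.null_rels(1)[of u "?a * to_fls p" "a * to_fls ?q"] B.null_rels(3)[of u ?a p]
      B.null_rels(3)[of u a ?q] B.null_rels(3)[of ?t a p] B.null_rels(2)[of "poly_op ?q \<odot> u" "poly_op p \<odot> ?t" a]
      u t poly_closed by (simp_all only: poly_mod_simps)
  then have "z1 + z2 + z3 + z4 - z5 \<in> B.Z" by (intro B.null_add B.null_diff)
  moreover have "frag_extend leib (frag_of (a * to_fls p, u) - frag_of (a, p \<odot>\<^bsub>poly_mod\<^esub> u)) = z1 + z2 + z3 + z4 - z5"
    unfolding poly_mod_simps frag_extend_diff frag_extend_of leib_def prod.case d theta_poly_act[OF u]
    unfolding z1_def z2_def z3_def z4_def z5_def by (simp only: algebra_simps)
  ultimately show ?case by simp
qed (auto simp: frag_extend_add frag_extend_minus B.null_add B.null_uminus B.null_zero)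

abbreviation euler where "euler \<equiv> laurent_euler M"

lemma euler_cls: "euler (B.cls f) = B.cls (frag_extend leib f)"
  unfolding laurent_euler_def poly_mod_def[symmetric] leib_def[symmetric]
  using leib_null by (rule B.tensor_map_cls)

lemma leib_closed: "f \<in> carrier B.F \<Longrightarrow> frag_extend leib f \<in> carrier B.F"
proof (rule B.frag_extend_closed)
  fix a u assume "u \<in> carrier poly_mod"
  then show "leib (a, u) \<in> carrier B.F"
    unfolding leib_def prod.case using theta_closed by (intro B.F_closed) simp_all
qed

lemma euler_closed: "t \<in> carrier B.T \<Longrightarrow> euler t \<in> carrier B.T"
  unfolding B.carrier_T by (auto simp: euler_cls leib_closed simp del: B.F_simps)

lemma euler_add: "t \<in> carrier B.T \<Longrightarrow> t' \<in> carrier B.T \<Longrightarrow> euler (t \<oplus>\<^sub>T t') = euler t \<oplus>\<^sub>T euler t'"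
  unfolding B.carrier_T
  by (auto simp: B.add_T euler_cls frag_extend_add leib_closed simp del: B.F_simps)

lemma euler_tns: "u \<in> carrier M \<Longrightarrow> euler (B.tns a u) = B.tns (fls_X * fls_deriv a) u \<oplus>\<^sub>T B.tns a (\<theta> \<odot> u)"
proof -
  assume u: "u \<in> carrier M"
  have "frag_of (fls_X * fls_deriv a, u) \<in> carrier B.F" "frag_of (a, \<theta> \<odot> u) \<in> carrier B.F"
    using u theta_closed[OF u] by (intro B.F_closed; simp)+
  from B.add_T[OF this] show ?thesis by (simp add: B.tns_def euler_cls leib_def)
qed

lemma euler_zero: "euler \<zero>\<^sub>T = \<zero>\<^sub>T"
  unfolding B.zero_T euler_cls by simp

text \<open>The vectors that satisfy the rule for all \<open>a\<close> form a subspace containing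
  every \<open>1 \<otimes> u\<close>. Quantifying over \<open>a\<close> inside the set is what makes
  it closed under scalars: the rule at \<open>c t\<close> uses the rule at \<open>t\<close> for
  \<open>a * c\<close> and for \<open>c\<close>.\<close>

lemma euler_smult:
  assumes "t \<in> carrier B.T"
  shows "euler (a \<odot>\<^sub>T t) = (fls_X * fls_deriv a) \<odot>\<^sub>T t \<oplus>\<^sub>T a \<odot>\<^sub>T euler t"
proof -
  let ?S = "{t \<in> carrier B.T. \<forall>a. euler (a \<odot>\<^sub>T t) = (fls_X * fls_deriv a) \<odot>\<^sub>T t \<oplus>\<^sub>T a \<odot>\<^sub>T euler t}"
  have sc: "a \<odot>\<^sub>T t \<in> carrier B.T" if "t \<in> carrier B.T" for a t
    using B.T.smult_closed[of a t] that by simp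
  have "carrier B.T \<subseteq> ?S"
  proof (rule B.T_subset)
    show "\<zero>\<^sub>T \<in> ?S"
      using B.T.smult_r_null by (simp add: euler_zero)
  next
    fix s t assume "s \<in> ?S" "t \<in> ?S"
    then show "s \<oplus>\<^sub>T t \<in> ?S"
      using B.T.smult_r_distr sc euler_closed by (simp add: euler_add B.T.a_ac)
  next
    fix c t assume "t \<in> ?S"
    then have t: "t \<in> carrier B.T" "\<And>a. euler (a \<odot>\<^sub>T t) = (fls_X * fls_deriv a) \<odot>\<^sub>T t \<oplus>\<^sub>T a \<odot>\<^sub>T euler t" by auto
    have assoc: "a \<odot>\<^sub>T (c \<odot>\<^sub>T s) = (a * c) \<odot>\<^sub>T s" if "s \<in> carrier B.T" for a c s
      using B.T.smult_assoc1[of a c s] that by simp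
    have distr: "(a + c) \<odot>\<^sub>T s = a \<odot>\<^sub>T s \<oplus>\<^sub>T c \<odot>\<^sub>T s" if "s \<in> carrier B.T" for a c s
      using B.T.smult_l_distr[of a c s] that by simp
    have rdistr: "a \<odot>\<^sub>T (s \<oplus>\<^sub>T s') = a \<odot>\<^sub>T s \<oplus>\<^sub>T a \<odot>\<^sub>T s'" if "s \<in> carrier B.T" "s' \<in> carrier B.T" for a s s'
      using B.T.smult_r_distr[of a s s'] that by simp
    have "euler (a \<odot>\<^sub>T (c \<odot>\<^sub>T t)) = (fls_X * fls_deriv a) \<odot>\<^sub>T (c \<odot>\<^sub>T t) \<oplus>\<^sub>T a \<odot>\<^sub>T euler (c \<odot>\<^sub>T t)" for a
    proof -
      have "fls_X * fls_deriv (a * c) = fls_X * fls_deriv a * c + a * (fls_X * fls_deriv c)"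
        by (simp only: fls_deriv_mult distrib_left) (simp only: mult_ac add_ac)
      then have "euler (a \<odot>\<^sub>T (c \<odot>\<^sub>T t)) = ((fls_X * fls_deriv a * c) \<odot>\<^sub>T t \<oplus>\<^sub>T (a * (fls_X * fls_deriv c)) \<odot>\<^sub>T t) \<oplus>\<^sub>T (a * c) \<odot>\<^sub>T euler t"
        by (simp only: assoc[OF t(1)] t(2) distr[OF t(1)])
      also have "\<dots> = (fls_X * fls_deriv a) \<odot>\<^sub>T (c \<odot>\<^sub>T t) \<oplus>\<^sub>T a \<odot>\<^sub>T ((fls_X * fls_deriv c) \<odot>\<^sub>T t \<oplus>\<^sub>T c \<odot>\<^sub>T euler t)"
        using t(1) euler_closed[OF t(1)] by (simp add: assoc rdistr sc B.T.a_assoc)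
      finally show ?thesis by (simp only: t(2))
    qed
    then show "c \<odot>\<^sub>T t \<in> ?S" using sc[OF t(1)] by blast
  next
    fix u assume "u \<in> carrier poly_mod"
    then have u: "u \<in> carrier M" by simp
    have 0: "B.tns 0 u = \<zero>\<^sub>T" using B.tns_eq_smult[of 0 u] B.T.smult_l_null[of "B.tns 1 u"] u by simp
    have tc: "B.tns a u \<in> carrier B.T" "B.tns a (\<theta> \<odot> u) \<in> carrier B.T" for a
      using u theta_closed[OF u] by simp_all
    have "euler (B.tns 1 u) = B.tns 1 (\<theta> \<odot> u)"
      using tc euler_tns[OF u, of 1] 0 by simp
    then show "B.tns 1 u \<in> ?S" using tc by (simp add: B.smult_tns euler_tns[OF u])
  qed
  then show ?thesis using assms by blast
qed

section \<open>Lattices in the Laurent extension\<close>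

abbreviation TO :: "(complex fps, (complex fls \<times> 'm \<Rightarrow>\<^sub>0 int) set) module" where
  "TO \<equiv> restrict_scalars fps_to_fls B.T"

lemma TO_simps [simp]:
  "carrier TO = carrier B.T" "add TO = add B.T" "\<zero>\<^bsub>TO\<^esub> = \<zero>\<^sub>T" "a \<odot>\<^bsub>TO\<^esub> t = fps_to_fls a \<odot>\<^sub>T t"
  by (simp_all add: restrict_scalars_def)

lemma module_TO: "module (class_ring :: complex fps ring) TO"
proof (rule module_restrict_scalars)
  show "abelian_group B.T" ..
  fix a c x assume x: "x \<in> carrier B.T"
  show "fps_to_fls (a * c) \<odot>\<^sub>T x = fps_to_fls a \<odot>\<^sub>T (fps_to_fls c \<odot>\<^sub>T x)"
    using B.T.smult_assoc1[of "fps_to_fls a" "fps_to_fls c" x] x by (simp add: fls_times_fps_to_fls)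
  show "fps_to_fls (a + c) \<odot>\<^sub>T x = fps_to_fls a \<odot>\<^sub>T x \<oplus>\<^sub>T fps_to_fls c \<odot>\<^sub>T x"
    using B.T.smult_l_distr[of "fps_to_fls a" "fps_to_fls c" x] x by simp
  show "fps_to_fls a \<odot>\<^sub>T x \<in> carrier B.T" using B.T.smult_closed[of "fps_to_fls a" x] x by simp
  show "fps_to_fls 1 \<odot>\<^sub>T x = x" using B.T.smult_one[of x] x by simp
  fix y assume "y \<in> carrier B.T"
  then show "fps_to_fls a \<odot>\<^sub>T (x \<oplus>\<^sub>T y) = fps_to_fls a \<odot>\<^sub>T x \<oplus>\<^sub>T fps_to_fls a \<odot>\<^sub>T y"
    using B.T.smult_r_distr[of "fps_to_fls a" x y] x by simp
qed

interpretation O: module "class_ring :: complex fps ring" TO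
  by (rule module_TO)

lemma TO_submoduleI:
  assumes "S \<subseteq> carrier B.T" "\<zero>\<^sub>T \<in> S" "\<And>s t. s \<in> S \<Longrightarrow> t \<in> S \<Longrightarrow> s \<oplus>\<^sub>T t \<in> S"
    "\<And>a s. s \<in> S \<Longrightarrow> fps_to_fls a \<odot>\<^sub>T s \<in> S"
  shows "submodule (class_ring :: complex fps ring) S TO"
  using assms by (auto simp: submodule_def module_TO)

lemma T_submoduleI:
  assumes "S \<subseteq> carrier B.T" "\<zero>\<^sub>T \<in> S" "\<And>s t. s \<in> S \<Longrightarrow> t \<in> S \<Longrightarrow> s \<oplus>\<^sub>T t \<in> S"
    "\<And>a s. s \<in> S \<Longrightarrow> a \<odot>\<^sub>T s \<in> S"
  shows "submodule class_ring S B.T"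
  using assms B.T.module_axioms by (auto simp: submodule_def)

lemma to_fls_X_power: "to_fls (poly_X ^ d) = fls_X ^ d"
  by (simp add: fps_of_poly_power fps_of_poly_pCons fps_to_fls_power)

lemma regular_imp_bounded:
  assumes "regular_at_0 M"
  shows "\<exists>e. \<forall>w\<in>W. \<forall>k. w k \<noteq> 0 \<longrightarrow> - int e \<le> fls_subdegree (to_laurent (w k))"
proof -
  obtain L where "lattice_in B.T L" and stable: "\<And>t. t \<in> L \<Longrightarrow> euler t \<in> L"
    using assms by (auto simp: regular_at_0_def laurent_extension_eq)
  then obtain A where A: "finite A" "A \<subseteq> carrier B.T" "L = O.span A" and spanL: "B.T.span L = carrier B.T"
    by (auto simp: lattice_in_def)
  have Asub: "A \<subseteq> carrier TO" using A by simp
  interpret L: submodule "class_ring :: complex fps ring" L TO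
    unfolding A(3) by (rule O.span_is_submodule[OF Asub])
  have L_sub: "L \<subseteq> carrier B.T" using L.subset by simp
  have L_add: "s \<oplus>\<^sub>T t \<in> L" if "s \<in> L" "t \<in> L" for s t using L.m_closed that by simp
  have L_smult: "fps_to_fls a \<odot>\<^sub>T t \<in> L" if "t \<in> L" for a t using L.smult_closed[of a t] that by simp
  have L_zero: "\<zero>\<^sub>T \<in> L" using L.zero_closed by simp
  have "\<exists>e. \<forall>x\<in>A \<times> {..<n}. fls_integral_part e (B.coord (fst x) (snd x))"
    by (rule common_bound) (use A(1) fls_integral_part_ex in \<open>auto intro: fls_integral_part_mono\<close>)
  then obtain e where AE: "fls_integral_part e (B.coord t k)" if "t \<in> A" "k < n" for t k by force
  \<comment> \<open>The vectors with coordinates in \<open>x ^ (-e) \<complex>[[x]]\<close> form a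
    \<open>\<complex>[[x]]\<close>-module; \<open>e\<close> was chosen so that it contains the
    generators of \<open>L\<close>.\<close>
  let ?S = "{t \<in> carrier B.T. \<forall>k<n. fls_integral_part e (B.coord t k)}"
  have "L \<subseteq> ?S" unfolding A(3)
  proof (rule O.span_is_subset)
    show "submodule class_ring ?S TO"
    proof (rule TO_submoduleI)
      show "fps_to_fls a \<odot>\<^sub>T s \<in> ?S" if "s \<in> ?S" for a s
        using that B.T.smult_closed[of "fps_to_fls a" s] by (auto simp: B.coord_smult fls_integral_part_mult)
    qed (auto simp: B.coord_add fls_integral_part_zero fls_integral_part_add)
    show "A \<subseteq> ?S" using A(2) AE by auto
  qed
  have X_pow: "fls_X ^ a \<odot>\<^sub>T t \<in> L" if "t \<in> L" for a t
    using L_smult[OF that, of "fps_X ^ a"] by (simp add: fps_to_fls_power)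
  have assoc: "a \<odot>\<^sub>T (c \<odot>\<^sub>T s) = (a * c) \<odot>\<^sub>T s" if "s \<in> carrier B.T" for a c :: "complex fls" and s
    using B.T.smult_assoc1[of a c s] that by simp
  have up: "fls_X ^ d' \<odot>\<^sub>T t \<in> L" if "fls_X ^ d \<odot>\<^sub>T t \<in> L" "d \<le> d'" "t \<in> carrier B.T" for d d' t
    using X_pow[OF that(1), of "d' - d"] that(2,3) by (simp add: assoc power_add[symmetric])
  \<comment> \<open>The vectors that some power of \<open>x\<close> carries into \<open>L\<close>
    form a \<open>\<complex>((x))\<close>-subspace containing \<open>L\<close>, hence are all of the
    space.\<close>
  let ?S' = "{t \<in> carrier B.T. \<exists>d. fls_X ^ d \<odot>\<^sub>T t \<in> L}"
  have "B.T.span L \<subseteq> ?S'"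
  proof (rule B.T.span_is_subset)
    show "L \<subseteq> ?S'" using X_pow L_sub by auto
    show "submodule class_ring ?S' B.T"
    proof (rule T_submoduleI)
      show "\<zero>\<^sub>T \<in> ?S'" using L_zero B.T.smult_r_null by simp
    next
      fix s t assume st: "s \<in> ?S'" "t \<in> ?S'"
      then obtain d d' where d: "fls_X ^ d \<odot>\<^sub>T s \<in> L" "fls_X ^ d' \<odot>\<^sub>T t \<in> L" by auto
      have "fls_X ^ max d d' \<odot>\<^sub>T (s \<oplus>\<^sub>T t) \<in> L"
        using B.T.smult_r_distr[of "fls_X ^ max d d'" s t] L_add[OF up[OF d(1), of "max d d'"] up[OF d(2), of "max d d'"]] st by simp
      then show "s \<oplus>\<^sub>T t \<in> ?S'" using st by auto
    next
      fix a :: "complex fls" and t assume t: "t \<in> ?S'"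
      then obtain d where d: "fls_X ^ d \<odot>\<^sub>T t \<in> L" by auto
      obtain d' h where h: "fls_X ^ d' * a = fps_to_fls h" using fls_integral_part_ex[of a] by (auto simp: fls_integral_part_def)
      have "fls_X ^ (d + d') \<odot>\<^sub>T (a \<odot>\<^sub>T t) = (fls_X ^ d' * a * fls_X ^ d) \<odot>\<^sub>T t"
        using t by (simp add: assoc power_add mult_ac)
      also have "\<dots> = fps_to_fls h \<odot>\<^sub>T (fls_X ^ d \<odot>\<^sub>T t)" using t by (simp add: assoc h)
      finally have "fls_X ^ (d + d') \<odot>\<^sub>T (a \<odot>\<^sub>T t) \<in> L" using L_smult[OF d] by simp
      then show "a \<odot>\<^sub>T t \<in> ?S'" using t B.T.smult_closed[of a t] by auto
    qed auto
  qed
  then have TS: "t \<in> ?S'" if "t \<in> carrier B.T" for t using spanL that by blast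
  \<comment> \<open>The conjunct \<open>l < s\<close> is carried along because
    \<open>common_bound\<close> demands monotonicity at every index, while \<open>m l\<close> is
    known to lie in \<open>M\<close> only for \<open>l < s\<close>.\<close>
  have "\<exists>d. \<forall>l\<in>{..<s}. fls_X ^ d \<odot>\<^sub>T B.tns 1 (m l) \<in> L \<and> l < s"
  proof (rule common_bound)
    show "\<exists>d. fls_X ^ d \<odot>\<^sub>T B.tns 1 (m l) \<in> L \<and> l < s" if "l \<in> {..<s}" for l
      using TS[of "B.tns 1 (m l)"] gen_closed that by simp
  qed (use up gen_closed in auto)
  then obtain d where d: "\<And>l. l < s \<Longrightarrow> B.tns (fls_X ^ d) (m l) \<in> L" by (auto simp: B.smult_tns)
  \<comment> \<open>The part of \<open>M\<close> inside \<open>x ^ (-d) L\<close>.\<close>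
  let ?U = "{u \<in> carrier M. B.tns (fls_X ^ d) u \<in> L}"
  have "U k0 \<subseteq> ?U"
  proof (rule U_k0_least)
    show "\<zero> \<in> ?U" using B.tns_zero L_zero by simp
  next
    fix u v assume "u \<in> ?U" "v \<in> ?U"
    then show "u \<oplus> v \<in> ?U" using B.tns_add_right[of u v "fls_X ^ d"] L_add by simp
  next
    fix p u assume u: "u \<in> ?U"
    then have "B.tns (fls_X ^ d) (poly_op p \<odot> u) = to_fls p \<odot>\<^sub>T B.tns (fls_X ^ d) u"
      using B.tns_smult[of u "fls_X ^ d" p] by (simp add: B.smult_tns mult.commute)
    then show "poly_op p \<odot> u \<in> ?U" using u L_smult poly_closed by auto
  next
    fix u assume u: "u \<in> ?U"
    then have uM: "u \<in> carrier M" by simp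
    let ?t = "B.tns (fls_X ^ d) (\<theta> \<odot> u)" and ?s = "B.tns (fls_X ^ d) u"
    have c: "?t \<in> carrier B.T" "?s \<in> carrier B.T" using uM theta_closed[OF uM] by simp_all
    \<comment> \<open>Twisting by \<open>x\<^sup>d\<close> preserves stability: the Euler operator
      sends \<open>x\<^sup>d \<otimes> u\<close> to \<open>d\<close> times itself plus
      \<open>x\<^sup>d \<otimes> \<theta> u\<close>, so the last term lies in \<open>L\<close> as
      well.\<close>
    have "fls_X * fls_deriv (fls_X ^ d) = of_nat d * (fls_X ^ d :: complex fls)"
      unfolding fls_deriv_X_power by (cases d) (simp_all add: mult.left_commute del: of_nat_Suc)
    then have "B.tns (fls_X * fls_deriv (fls_X ^ d)) u = of_nat d \<odot>\<^sub>T ?s" by (simp add: B.smult_tns)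
    then have eu: "euler ?s = of_nat d \<odot>\<^sub>T ?s \<oplus>\<^sub>T ?t" using euler_tns[OF uM, of "fls_X ^ d"] by simp
    have "(- of_nat d) \<odot>\<^sub>T ?s \<oplus>\<^sub>T euler ?s = ((- of_nat d) \<odot>\<^sub>T ?s \<oplus>\<^sub>T of_nat d \<odot>\<^sub>T ?s) \<oplus>\<^sub>T ?t"
      unfolding eu using c B.T.smult_closed[of _ ?s] by (simp add: B.T.a_assoc)
    also have "(- of_nat d) \<odot>\<^sub>T ?s \<oplus>\<^sub>T of_nat d \<odot>\<^sub>T ?s = \<zero>\<^sub>T"
      using B.T.smult_l_distr[of "- of_nat d" "of_nat d" ?s] B.T.smult_l_null[of ?s] c by simp
    finally have "?t = (- of_nat d) \<odot>\<^sub>T ?s \<oplus>\<^sub>T euler ?s"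
      by (simp only: B.T.l_zero[OF c(1)])
    moreover have "(- of_nat d) \<odot>\<^sub>T ?s \<in> L"
      using L_smult[of ?s "- of_nat d"] u by simp
    ultimately have "?t \<in> L" using L_add stable u by simp
    then show "\<theta> \<odot> u \<in> ?U" using theta_closed[OF uM] by simp
  next
    fix l assume l: "l < s"
    then show "m l \<in> ?U" using d gen_closed by simp
  qed auto
  have "- int (e + d) \<le> fls_subdegree (to_laurent (w k))" if w: "w \<in> W" "w k \<noteq> 0" for w k
  proof -
    obtain u where u: "u \<in> U k0" "w = crd u" using w(1) by (auto simp: W_def)
    have k: "k < n" using W.support[OF w(1)] w(2) not_le by blast
    have "B.tns (fls_X ^ d) u \<in> ?S" using \<open>U k0 \<subseteq> ?U\<close> \<open>L \<subseteq> ?S\<close> u(1) by blast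
    then have "fls_integral_part e (fls_X ^ d * to_laurent (w k))" using k u(2) by simp
    then have "fls_integral_part (e + d) (to_laurent (w k))"
      by (simp add: fls_integral_part_def power_add mult.assoc)
    then show ?thesis using fls_integral_part_subdegree w(2) laur.ext_eq_0_iff by blast
  qed
  then show ?thesis by blast
qed

text \<open>The lattice is the \<open>\<complex>[[x]]\<close>-span of the vectors
  \<open>1 \<otimes> w i\<close>, where the \<open>w i\<close> lift the basis \<open>g\<close> of
  \<open>W/xW\<close>. The core is that it contains \<open>1 \<otimes> u\<close> for every
  \<open>u\<close> in \<open>U k0\<close>; spanning and stability both follow from that.\<close>

lemma full_rank_imp_regular:
  assumes indep: "W.mod_indep n g"
  shows "regular_at_0 M"
proof -
  have "\<forall>i. \<exists>w. i < n \<longrightarrow> w \<in> U k0 \<and> g i = crd w"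
  proof -
    have "g i \<in> W" if "i < n" for i using indep that by (simp add: W.mod_indep_def)
    then show ?thesis by (auto simp: W_def)
  qed
  then obtain w where w: "\<And>i. i < n \<Longrightarrow> w i \<in> U k0" "\<And>i. i < n \<Longrightarrow> g i = crd (w i)" by metis
  define A where "A = (\<lambda>i. B.tns 1 (w i)) ` {..<n}"
  define L where "L = O.span A"
  have wM: "w i \<in> carrier M" if "i < n" for i by (rule U_closed[OF w(1)[OF that]])
  have A: "finite A" "A \<subseteq> carrier B.T" by (auto simp: A_def wM)
  have Asub: "A \<subseteq> carrier TO" using A by simp
  interpret L: submodule "class_ring :: complex fps ring" L TO
    unfolding L_def by (rule O.span_is_submodule[OF Asub])
  have L_sub: "L \<subseteq> carrier B.T" using L.subset by simp
  have L_add: "s \<oplus>\<^sub>T t \<in> L" if "s \<in> L" "t \<in> L" for s t using L.m_closed that by simp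
  have L_smult: "fps_to_fls a \<odot>\<^sub>T t \<in> L" if "t \<in> L" for a t using L.smult_closed[of a t] that by simp
  have L_zero: "\<zero>\<^sub>T \<in> L" using L.zero_closed by simp
  have AL: "A \<subseteq> L" unfolding L_def by (rule O.in_own_span[OF Asub])
  \<comment> \<open>A vector of \<open>L\<close> with prescribed coordinates is built by adding one
    generator after another.\<close>
  have comb: "\<exists>t\<in>L. \<forall>k. B.coord t k = (\<Sum>i<j. fps_to_fls (a i) * to_laurent (g i k))" if "j \<le> n" for a j
    using that
  proof (induction j)
    case 0
    then show ?case using L_zero by (intro bexI[of _ "\<zero>\<^sub>T"]) auto
  next
    case (Suc j)
    then obtain t where t: "t \<in> L" "\<forall>k. B.coord t k = (\<Sum>i<j. fps_to_fls (a i) * to_laurent (g i k))" by auto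
    have wj: "B.tns 1 (w j) \<in> L" using AL Suc.prems by (auto simp: A_def)
    let ?t = "t \<oplus>\<^sub>T fps_to_fls (a j) \<odot>\<^sub>T B.tns 1 (w j)"
    have "?t \<in> L" by (intro L_add t L_smult wj)
    moreover have "B.coord ?t k = (\<Sum>i<Suc j. fps_to_fls (a i) * to_laurent (g i k))" for k
      using t L_sub L_smult[OF wj] wj Suc.prems w(2) by (simp add: B.coord_add B.coord_smult subset_iff)
    ultimately show ?case by blast
  qed
  have tnsL: "B.tns 1 u \<in> L" if u: "u \<in> U k0" for u
  proof -
    have "crd u \<in> W" using u by (simp add: W_def)
    then obtain p q where pq: "poly p 0 \<noteq> 0" "\<forall>k. to_fract p * crd u k = (\<Sum>i<n. to_fract (q i) * g i k)"
      using W.local_generation[OF indep] by blast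
    \<comment> \<open>The denominator \<open>p\<close> supplied by \<open>local_generation\<close>
      does not vanish at 0, so it is invertible in \<open>\<complex>[[x]]\<close> and the
      coefficients \<open>q i / p\<close> are admissible in \<open>L\<close>.\<close>
    define v where "v = inverse (fps_of_poly p)"
    have "fps_nth (fps_of_poly p) 0 \<noteq> 0" using pq(1) by (simp add: poly_0_coeff_0)
    then have vp: "fps_to_fls v * to_fls p = 1"
      by (simp add: v_def fls_times_fps_to_fls[symmetric] inverse_mult_eq_1)
    obtain t where t: "t \<in> L" "\<forall>k. B.coord t k = (\<Sum>i<n. fps_to_fls (v * fps_of_poly (q i)) * to_laurent (g i k))"
      using comb[of n "\<lambda>i. v * fps_of_poly (q i)"] by auto
    have "B.tns 1 u = t"
    proof (rule B.coord_inj)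
      fix k
      have "to_fls p * to_laurent (crd u k) = (\<Sum>i<n. to_fls (q i) * to_laurent (g i k))"
        using arg_cong[OF pq(2)[rule_format, of k], of to_laurent] by (simp add: laur.ext_sum)
      then have "fps_to_fls v * (to_fls p * to_laurent (crd u k)) = (\<Sum>i<n. fps_to_fls v * (to_fls (q i) * to_laurent (g i k)))"
        by (simp add: sum_distrib_left)
      then have "to_laurent (crd u k) = (\<Sum>i<n. fps_to_fls v * (to_fls (q i) * to_laurent (g i k)))"
        by (simp only: mult.assoc[symmetric] vp mult_1)
      then show "B.coord (B.tns 1 u) k = B.coord t k"
        using t(2) by (simp add: fls_times_fps_to_fls mult.assoc)
    qed (use t L_sub U_closed[OF u] in auto)
    then show ?thesis using t by simp
  qed
  have span: "B.T.span L = carrier B.T"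
  proof
    interpret S: submodule class_ring "B.T.span L" B.T by (rule B.T.span_is_submodule[OF L_sub])
    have S_smult: "a \<odot>\<^sub>T t \<in> B.T.span L" if "t \<in> B.T.span L" for a t
      using S.smult_closed[of a t] that by simp
    show "carrier B.T \<subseteq> B.T.span L"
    proof (rule B.T_subset_bas)
      fix i assume "i < n"
      then have bM: "b i \<in> carrier M" using N.b_closed by simp
      then obtain k where k: "b i \<in> U k" using U_exhausts by blast
      \<comment> \<open>A power of \<open>x\<close> brings \<open>b i\<close> down to level
        \<open>k0\<close> and thus into \<open>L\<close>; over \<open>\<complex>((x))\<close> it can
        be divided out again.\<close>
      define j where "j = nat (k - k0)"
      have "k - int j \<le> k0" unfolding j_def by linarith
      then have "poly_op (poly_X ^ j) \<odot> b i \<in> U k0" using U_X_power[OF k, of j] U_mono by blast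
      then have "B.tns 1 (poly_op (poly_X ^ j) \<odot> b i) \<in> L" by (rule tnsL)
      also have "B.tns 1 (poly_op (poly_X ^ j) \<odot> b i) = B.tns (fls_X ^ j) (b i)"
        using B.tns_smult[of "b i" 1 "poly_X ^ j"] bM to_fls_X_power[of j] by simp
      finally have "B.tns (fls_X ^ j) (b i) \<in> B.T.span L" using B.T.in_own_span[OF L_sub] by blast
      from S_smult[OF this, of "inverse (fls_X ^ j)"] show "B.tns 1 (b i) \<in> B.T.span L"
        by (simp only: B.smult_tns) simp
    qed (simp_all add: S.zero_closed S.m_closed S_smult)
    show "B.T.span L \<subseteq> carrier B.T" by (rule B.T.span_is_subset2[OF L_sub])
  qed
  \<comment> \<open>The Leibniz rule makes this a \<open>\<complex>[[x]]\<close>-module, as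
    \<open>x a'\<close> is again a power series. So stability has to be checked only on the
    generators, where it is the stability of \<open>U k0\<close> under
    \<open>\<theta>\<close>.\<close>
  let ?S = "{t \<in> L. euler t \<in> L}"
  have "L \<subseteq> ?S"
    unfolding L_def
  proof (rule O.span_is_subset, fold L_def)
    show "submodule class_ring ?S TO"
    proof (rule TO_submoduleI)
      fix a :: "complex fps" and t assume t: "t \<in> ?S"
      then have tc: "t \<in> carrier B.T" using L_sub by blast
      have "fls_X * fls_deriv (fps_to_fls a) = fps_to_fls (fps_X * fps_deriv a)"
        by (simp add: fls_deriv_fps_to_fls fls_times_fps_to_fls)
      then show "fps_to_fls a \<odot>\<^sub>T t \<in> ?S"
        using t by (simp add: euler_smult[OF tc] L_smult L_add)
    qed (use L_sub L_zero L_add euler_zero euler_add in \<open>auto simp: subset_iff\<close>)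
    show "A \<subseteq> ?S"
    proof
      fix t assume "t \<in> A"
      then obtain i where i: "i < n" "t = B.tns 1 (w i)" by (auto simp: A_def)
      have wi: "w i \<in> carrier M" using U_closed[OF w(1)[OF i(1)]] .
      have 0: "B.tns 0 (w i) = \<zero>\<^sub>T" using B.tns_eq_smult[of 0 "w i"] B.T.smult_l_null[of "B.tns 1 (w i)"] wi by simp
      have "euler t = B.tns 1 (\<theta> \<odot> w i)"
        using euler_tns[OF wi, of 1] 0 theta_closed[OF wi] i(2) by simp
      then show "t \<in> ?S" using tnsL[OF U_theta[OF w(1)[OF i(1)]]] AL \<open>t \<in> A\<close> by auto
    qed
  qed
  then have "euler ` L \<subseteq> L" by blast
  moreover have "lattice_in B.T L" unfolding lattice_in_def using A L_def span by blast
  ultimately show ?thesis unfolding regular_at_0_def laurent_extension_eq by blast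
qed

text \<open>Both ranks are known, so the equation reads \<open>r = n\<close>; the inequality
  \<open>r \<le> n\<close> is available from the start.\<close>

theorem regular_iff_rank_eq: "regular_at_0 M \<longleftrightarrow> rank (gr M U) = rank M"
proof -
  obtain r g where r: "r \<le> n" "W.mod_basis r g" using W.mod_basis_exists by blast
  have rank: "rank (gr M U) = rank M \<longleftrightarrow> r = n" using rank_gr[OF r(2)] rank_M by simp
  show ?thesis
  proof
    assume "regular_at_0 M"
    then obtain e where e: "\<And>w k. w \<in> W \<Longrightarrow> w k \<noteq> 0 \<Longrightarrow> - int e \<le> fls_subdegree (to_laurent (w k))"
      using regular_imp_bounded by blast
    \<comment> \<open>One power of \<open>x\<close> carries all \<open>b l\<close> into
      \<open>U k0\<close>. Hence \<open>W\<close> contains \<open>x\<^sup>d\<close> times the unit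
      vectors, which is the lower bound on \<open>W\<close> needed for the growth argument.\<close>
    have "\<exists>d. \<forall>l\<in>{..<n}. poly_op (poly_X ^ d) \<odot> b l \<in> U k0 \<and> l < n"
    proof (rule common_bound)
      fix l assume l: "l \<in> {..<n}"
      then obtain k where k: "b l \<in> U k" using U_exhausts N.b_closed by force
      have "k - int (nat (k - k0)) \<le> k0" by linarith
      then show "\<exists>d. poly_op (poly_X ^ d) \<odot> b l \<in> U k0 \<and> l < n"
        using U_X_power[OF k, of "nat (k - k0)"] U_mono l by blast
    next
      fix l and d d' :: nat assume d: "poly_op (poly_X ^ d) \<odot> b l \<in> U k0 \<and> l < n" "d \<le> d'"
      then have "b l \<in> carrier M" using N.b_closed by simp
      then have "poly_op (poly_X ^ d') \<odot> b l = poly_op (poly_X ^ (d' - d)) \<odot> (poly_op (poly_X ^ d) \<odot> b l)"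
        using d(2) by (simp add: poly_act_mult[symmetric] power_add[symmetric])
      then show "poly_op (poly_X ^ d') \<odot> b l \<in> U k0 \<and> l < n" using d U_poly by simp
    qed simp
    then obtain d where d: "\<And>l. l < n \<Longrightarrow> poly_op (poly_X ^ d) \<odot> b l \<in> U k0" by blast
    have unit: "(\<lambda>i. if i = l then to_fract (poly_X ^ d) else 0) \<in> W" if l: "l < n" for l
    proof -
      have "b l \<in> carrier M" using N.b_closed[OF l] by simp
      then have "crd (poly_op (poly_X ^ d) \<odot> b l) = (\<lambda>i. if i = l then to_fract (poly_X ^ d) else 0)"
        using N.coords_b[OF l] by (auto simp: crd_poly fun_eq_iff)
      then show ?thesis using d[OF l] unfolding W_def by (metis imageI)
    qed
    have "n \<le> r"
      by (rule W.bounded_imp_le_mod_basis[where d = d and e = e, OF r(2)], erule unit, erule e, assumption)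
    then show "rank (gr M U) = rank M" using r(1) rank by simp
  next
    assume "rank (gr M U) = rank M"
    then have "W.mod_indep n g" using r(2) rank by (simp add: W.mod_basis_def)
    then show "regular_at_0 M" by (rule full_rank_imp_regular)
  qed
qed

end

section \<open>Holonomic modules have finite rank\<close>

definition bernstein_pairs :: "nat \<Rightarrow> (nat \<times> nat) set" where
  "bernstein_pairs k = {(a, b). a + b \<le> k}"

lemma xd_span_sum:
  assumes "finite J" "\<And>j. j \<in> J \<Longrightarrow> P j \<in> xd_span I"
  shows "(\<lambda>f. \<Sum>j\<in>J. P j f) \<in> xd_span I"
  using assms
proof (induction J rule: finite_induct)
  case (insert j J)
  then show ?case using xd_span_add[of "P j" I "\<lambda>f. \<Sum>j\<in>J. P j f"] by simp
qed (simp add: xd_span.zero)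

text \<open>Replaces the double sum by the inductive span, so that the closure rules for normally
  ordered operators become available.\<close>

lemma bernstein_eq: "bernstein k = xd_span (bernstein_pairs k)"
proof
  show "bernstein k \<subseteq> xd_span (bernstein_pairs k)"
    unfolding bernstein_def
    by (auto intro!: xd_span_sum xd_span_monomial simp: bernstein_pairs_def)
  show "xd_span (bernstein_pairs k) \<subseteq> bernstein k"
  proof
    fix P assume "P \<in> xd_span (bernstein_pairs k)"
    then show "P \<in> bernstein k"
    proof (induction P rule: xd_span.induct)
      case zero
      have "const_op 0 f = 0" for f by (simp add: const_op_def)
      then show ?case unfolding bernstein_def by (auto intro!: exI[of _ "\<lambda>_ _. 0"])
    next
      case (step P a b c)
      then obtain d where d: "P = (\<lambda>f. \<Sum>a\<le>k. \<Sum>b\<le>k - a. const_op (d a b) ((x_op ^^ a) ((d_op ^^ b) f)))"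
        by (auto simp: bernstein_def)
      let ?d = "\<lambda>a' b'. d a' b' + (if b' = b then if a' = a then c else 0 else 0)"
      have c0: "const_op 0 f = 0" for f by (simp add: const_op_def)
      have cadd: "const_op (u + v) f = const_op u f + const_op v f" for u v f
        by (intro poly_mapping_eqI) (simp add: lookup_add distrib_right)
      have ab: "a \<le> k" "b \<le> k - a" using step by (auto simp: bernstein_pairs_def)
      have "(\<Sum>a'\<le>k. \<Sum>b'\<le>k - a'. const_op (if b' = b then if a' = a then c else 0 else 0) ((x_op ^^ a') ((d_op ^^ b') f)))
        = const_op c ((x_op ^^ a) ((d_op ^^ b) f))" for f
      proof -
        let ?s = "\<lambda>a'. \<Sum>b'\<le>k - a'. const_op (if b' = b then if a' = a then c else 0 else 0) ((x_op ^^ a') ((d_op ^^ b') f))"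
        have "?s a = (\<Sum>b'\<le>k - a. if b' = b then const_op c ((x_op ^^ a) ((d_op ^^ b') f)) else 0)"
          by (intro sum.cong refl) (simp add: c0)
        then have sa: "?s a = const_op c ((x_op ^^ a) ((d_op ^^ b) f))" using ab by simp
        have "(\<Sum>a'\<le>k. ?s a') = ?s a + (\<Sum>a'\<in>{..k} - {a}. ?s a')"
          using ab by (intro sum.remove) auto
        also have "(\<Sum>a'\<in>{..k} - {a}. ?s a') = 0"
          by (rule sum.neutral, rule ballI, rule sum.neutral) (simp add: c0)
        finally show ?thesis unfolding sa by simp
      qed
      then have eq: "(\<lambda>f. P f + const_op c ((x_op ^^ a) ((d_op ^^ b) f)))
        = (\<lambda>f. \<Sum>a\<le>k. \<Sum>b\<le>k - a. const_op (?d a b) ((x_op ^^ a) ((d_op ^^ b) f)))"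
        unfolding d by (simp only: cadd sum.distrib)
      show ?case unfolding bernstein_def by (rule CollectI, rule exI[of _ ?d]) (simp only: eq simp_thms)
    qed
  qed
qed

lemma bernstein_subset: "bernstein k \<subseteq> weyl_ops"
  unfolding bernstein_eq weyl_ops_eq_xd_span by (auto intro: xd_span_mono)

lemma bernstein_mono: "j \<le> k \<Longrightarrow> bernstein j \<subseteq> bernstein k"
  unfolding bernstein_eq by (auto elim!: xd_span_mono simp: bernstein_pairs_def)

lemma bernstein_exhausts: "P \<in> weyl_ops \<Longrightarrow> \<exists>k. P \<in> bernstein k"
  unfolding weyl_ops_eq_xd_span
proof (induction P rule: xd_span.induct)
  case (step P a b c)
  then obtain k where "P \<in> bernstein k" by blast
  then have "P \<in> xd_span (bernstein_pairs (max k (a + b)))"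
    using bernstein_mono[of k "max k (a + b)"] by (auto simp: bernstein_eq)
  moreover have "(a, b) \<in> bernstein_pairs (max k (a + b))" by (auto simp: bernstein_pairs_def)
  ultimately show ?case unfolding bernstein_eq by (blast intro: xd_span.step)
qed (auto simp: bernstein_eq intro: xd_span.zero)

lemma bernstein_x: "P \<in> bernstein k \<Longrightarrow> x_op \<circ> P \<in> bernstein (Suc k)"
  unfolding bernstein_eq by (erule xd_span_x) (auto simp: bernstein_pairs_def)

section \<open>Growth of the Bernstein filtration bounds the rank\<close>

context weyl_mod
begin

abbreviation MC :: "(complex, 'm) module" where "MC \<equiv> restrict_scalars const_op M"

lemma MC_simps [simp]:
  "carrier MC = carrier M" "add MC = add M" "\<zero>\<^bsub>MC\<^esub> = \<zero>" "c \<odot>\<^bsub>MC\<^esub> u = const_op c \<odot> u"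
  by (simp_all add: restrict_scalars_def)

lemma vectorspace_MC: "vectorspace class_ring MC"
proof -
  interpret N: poly_module poly_mod by (rule poly_module_poly_mod)
  have "module (class_ring :: complex ring) MC"
  proof (rule module_restrict_scalars)
    show "abelian_group M" ..
    fix a c x assume x: "x \<in> carrier M"
    show "const_op (a * c) \<odot> x = const_op a \<odot> (const_op c \<odot> x)"
      using N.sm_mult[of x "[:a:]" "[:c:]"] x by (simp add: poly_op_const mult.commute)
    show "const_op (a + c) \<odot> x = const_op a \<odot> x \<oplus> const_op c \<odot> x"
      using N.sm_add[of x "[:a:]" "[:c:]"] x by (simp add: poly_op_const)
    show "const_op 1 \<odot> x = x"
      using N.sm_one[of x] poly_op_const[of 1] x by (simp add: one_pCons)
  qed (auto simp: act_closed act_r_add weyl_ops.const)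
  then show ?thesis using class_field by (auto simp: vectorspace_def)
qed

interpretation C: vectorspace "class_ring :: complex ring" MC
  by (rule vectorspace_MC)

interpretation N: poly_module poly_mod
  by (rule poly_module_poly_mod)

text \<open>A relation over \<open>\<complex>\<close> among the \<open>x\<^sup>a v\<^sub>i\<close>
  is collected into one over \<open>\<complex>[x]\<close> among the \<open>v\<^sub>i\<close>: the
  numbers \<open>z\<close> become the coefficients of the polynomials \<open>q I i\<close>, which
  vanish by independence.\<close>

lemma monomials_independent:
  assumes indep: "N.indep r v" and I: "finite I" "I \<subseteq> UNIV \<times> {..<r}"
    and zero: "(\<Oplus>\<^bsub>MC\<^esub>t\<in>I. const_op (z t) \<odot> (poly_op (poly_X ^ fst t) \<odot> v (snd t))) = \<zero>"
  shows "\<forall>t\<in>I. z t = 0"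
proof
  have vc: "v i \<in> carrier M" if "i < r" for i using indep that by (auto simp: N.indep_def)
  define q where "q = (\<lambda>I i. \<Sum>t\<in>I. if i = snd t then monom (z t) (fst t) else 0)"
  have "(\<Oplus>\<^bsub>MC\<^esub>t\<in>I. const_op (z t) \<odot> (poly_op (poly_X ^ fst t) \<odot> v (snd t))) = N.lc r (q I) v"
    using I
  proof (induction I rule: finite_induct)
    case empty
    have "N.lc r (\<lambda>i. 0 * 0) v = \<zero>"
      using N.lc_smult[of r v 0 "\<lambda>_. 0"] N.sm_zero[OF N.lc_closed[of r v "\<lambda>_. 0"]] vc by simp
    then show ?case by (simp add: q_def)
  next
    case (insert t I)
    then have t: "snd t < r" by (cases t) auto
    have c: "const_op (z t) \<odot> (poly_op (poly_X ^ fst t) \<odot> v (snd t)) \<in> carrier M" if "t \<in> insert t' I" "insert t' I \<subseteq> UNIV \<times> {..<r}" for t t'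
      using that vc by (cases t) (auto intro!: act_closed weyl_ops.const poly_op_weyl)
    have "(\<Oplus>\<^bsub>MC\<^esub>t\<in>insert t I. const_op (z t) \<odot> (poly_op (poly_X ^ fst t) \<odot> v (snd t)))
      = const_op (z t) \<odot> (poly_op (poly_X ^ fst t) \<odot> v (snd t)) \<oplus> N.lc r (q I) v"
      using insert c by (subst C.finsum_insert) auto
    also have "const_op (z t) \<odot> (poly_op (poly_X ^ fst t) \<odot> v (snd t)) = poly_op (monom (z t) (fst t)) \<odot> v (snd t)"
    proof -
      have "monom (z t) (fst t) = [:z t:] * poly_X ^ fst t" by (simp add: monom_altdef)
      then show ?thesis
        using vc[OF t] by (simp only: poly_op_mult act_comp poly_op_weyl) (simp add: poly_op_const)
    qed
    also have "\<dots> = N.lc r (\<lambda>i. monom (z t) (fst t) * (if i = snd t then 1 else 0)) v"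
      using N.lc_smult[of r v "monom (z t) (fst t)" "\<lambda>i. if i = snd t then 1 else 0"] N.lc_delta[of r v "snd t"] vc t by simp
    also have "\<dots> \<oplus> N.lc r (q I) v = N.lc r (\<lambda>i. monom (z t) (fst t) * (if i = snd t then 1 else 0) + q I i) v"
      using N.lc_add[of r v "\<lambda>i. monom (z t) (fst t) * (if i = snd t then 1 else 0)" "q I"] vc by simp
    also have "(\<lambda>i. monom (z t) (fst t) * (if i = snd t then 1 else 0) + q I i) = q (insert t I)"
      using insert.hyps by (auto simp: q_def fun_eq_iff)
    finally show ?case .
  qed
  then have "N.lc r (q I) v = \<zero>" using zero by simp
  then have q0: "q I i = 0" if "i < r" for i using indep that by (simp add: N.indep_def)
  fix t assume t: "t \<in> I"
  have "coeff (q I (snd t)) (fst t) = (\<Sum>t'\<in>I. if t' = t then z t' else 0)"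
    unfolding q_def coeff_sum by (intro sum.cong refl) (auto simp: prod_eq_iff)
  then show "z t = 0" using q0[of "snd t"] t I by (cases t) auto
qed

definition filt :: "nat \<Rightarrow> (nat \<Rightarrow> 'm) \<Rightarrow> nat \<Rightarrow> 'm set" where
  "filt s m k = op_sums M s m (\<lambda>_. bernstein k)"

context
  fixes s :: nat and m :: "nat \<Rightarrow> 'm"
  assumes generates: "generates M s m"
begin

lemma m_closed: "l < s \<Longrightarrow> m l \<in> carrier M"
  using generates by (simp add: generates_def)

abbreviation F :: "nat \<Rightarrow> 'm set" where
  "F \<equiv> filt s m"

lemma F_subset: "F k \<subseteq> carrier M"
  unfolding filt_def by (intro op_sums_closed m_closed bernstein_subset)

lemma F_mono: "j \<le> k \<Longrightarrow> F j \<subseteq> F k"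
  unfolding filt_def by (intro op_sums_mono bernstein_mono)

lemma F_exhausts:
  assumes "u \<in> carrier M"
  shows "\<exists>k. u \<in> F k"
proof -
  have "op_sums M s m (\<lambda>_. weyl_ops) = carrier M" using generates by (simp add: generates_def weyl_def)
  then obtain P where P: "\<forall>l<s. P l \<in> weyl_ops" "u = (\<Oplus>l\<in>{..<s}. P l \<odot> m l)"
    using assms by (auto simp: op_sums_def)
  have "\<exists>K. \<forall>l\<in>{..<s}. P l \<in> bernstein K"
    by (rule common_bound) (use P bernstein_exhausts in \<open>auto elim: subsetD[OF bernstein_mono, rotated]\<close>)
  then obtain K where "\<forall>l<s. P l \<in> bernstein K" by blast
  then have "u \<in> F K" unfolding filt_def op_sums_def P(2) by blast
  then show ?thesis by blast
qed

lemma F_X_power: "u \<in> F k \<Longrightarrow> poly_op (poly_X ^ j) \<odot> u \<in> F (k + j)"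
proof (induction j)
  case 0
  then have "u \<in> carrier M" using F_subset by blast
  then have "poly_op (poly_X ^ 0) \<odot> u = u" by (simp only: power_0 poly_op_1 act_id)
  then show ?case using 0 by simp
next
  case (Suc j)
  have u: "u \<in> carrier M" using Suc.prems F_subset by blast
  have "poly_op (poly_X ^ Suc j) \<odot> u = x_op \<odot> (poly_op (poly_X ^ j) \<odot> u)"
    using u by (simp only: power_Suc poly_op_mult act_comp poly_op_weyl) (simp add: poly_op_X)
  moreover have "x_op \<odot> (poly_op (poly_X ^ j) \<odot> u) \<in> F (Suc (k + j))"
    using Suc unfolding filt_def
    by (intro op_sums_act[OF m_closed bernstein_subset weyl_ops.x bernstein_x]) auto
  ultimately show ?case by simp
qed

lemma F_subspace: "submodule class_ring (F k) MC"
  unfolding submodule_def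
proof (intro conjI allI impI)
  show "module (class_ring :: complex ring) MC" by (rule C.module_axioms)
  show "F k \<subseteq> carrier MC" using F_subset by simp
  show "\<zero>\<^bsub>MC\<^esub> \<in> F k"
    unfolding filt_def using op_sums_zero[where s = s and m = m and W = "\<lambda>_. bernstein k", OF m_closed]
    by (simp add: bernstein_eq xd_span.zero)
  show "v \<oplus>\<^bsub>MC\<^esub> w \<in> F k" if "v \<in> F k" "w \<in> F k" for v w
    unfolding filt_def MC_simps
    by (rule op_sums_add[OF m_closed bernstein_subset]) (use that in \<open>auto simp: bernstein_eq xd_span_add filt_def\<close>)
  show "c \<odot>\<^bsub>MC\<^esub> v \<in> F k" if "v \<in> F k" for c v
    using that unfolding filt_def MC_simps
    by (intro op_sums_act[OF m_closed bernstein_subset weyl_ops.const]) (auto simp: bernstein_eq xd_span_const)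
qed

lemma F_vectorspace: "vectorspace class_ring (MC\<lparr>carrier := F k\<rparr>)"
  using C.subspace_is_vs F_subspace vectorspace_MC by (auto simp: subspace_def)

text \<open>The finitely many \<open>x\<^sup>a \<partial>\<^sup>b m\<^sub>l\<close> with
  \<open>a + b \<le> k\<close> span. Finite dimension is required before the size of an independent
  set can be compared with \<open>dim\<close>.\<close>

lemma F_fin_dim: "vectorspace.fin_dim class_ring (MC\<lparr>carrier := F k\<rparr>)"
proof -
  interpret V: vectorspace "class_ring :: complex ring" "MC\<lparr>carrier := F k\<rparr>" by (rule F_vectorspace)
  define op where "op = (\<lambda>(a, b). (x_op ^^ a) \<circ> (d_op ^^ b))"
  have op: "op t \<in> bernstein k" if "t \<in> bernstein_pairs k" for t
  proof -
    have "const_op 1 f = f" for f by (simp add: const_op_def)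
    then show ?thesis using xd_span_monomial[of "fst t" "snd t" "bernstein_pairs k" 1] that
      by (simp add: bernstein_eq op_def case_prod_unfold o_def)
  qed
  define S where "S = (\<lambda>(t, l). op t \<odot> m l) ` (bernstein_pairs k \<times> {..<s})"
  have "bernstein_pairs k \<subseteq> {..k} \<times> {..k}" by (auto simp: bernstein_pairs_def)
  then have "finite S" unfolding S_def by (intro finite_imageI finite_cartesian_product finite_subset[of _ "{..k} \<times> {..k}"]) auto
  moreover have SF: "S \<subseteq> F k"
  proof
    fix y assume "y \<in> S"
    then obtain t l where tl: "t \<in> bernstein_pairs k" "l < s" "y = op t \<odot> m l" by (auto simp: S_def)
    define P where "P = (\<lambda>l'. if l' = l then op t else (\<lambda>f. 0))"
    have opw: "op t \<in> weyl_ops" using op[OF tl(1)] bernstein_subset by blast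
    have "(\<Oplus>l'\<in>{..<s}. P l' \<odot> m l') = (\<Oplus>l'\<in>{..<s}. if l = l' then op t \<odot> m l' else \<zero>)"
      using m_closed opw by (intro finsum_cong') (auto simp: P_def act_zero_op act_closed)
    also have "\<dots> = y"
      using tl m_closed opw by (subst finsum_singleton) (auto intro!: act_closed)
    finally have "y = (\<Oplus>l'\<in>{..<s}. P l' \<odot> m l')" by simp
    moreover have "\<forall>l'<s. P l' \<in> bernstein k" using op[OF tl(1)] by (auto simp: P_def bernstein_eq xd_span.zero)
    ultimately show "y \<in> F k" unfolding filt_def op_sums_def by blast
  qed
  moreover have "V.span S = F k"
  proof
    show "V.span S \<subseteq> F k" using V.span_is_subset2[of S] SF by simp
    have span_eq: "V.span S = C.span S" by (rule C.span_li_not_depend[OF SF F_subspace])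
    have SC: "S \<subseteq> carrier MC" using SF F_subset by auto
    interpret sp: submodule "class_ring :: complex ring" "C.span S" MC by (rule C.span_is_submodule[OF SC])
    have spa: "u \<oplus> v \<in> C.span S" if "u \<in> C.span S" "v \<in> C.span S" for u v using sp.m_closed[OF that] by simp
    have sps: "const_op c \<odot> u \<in> C.span S" if "u \<in> C.span S" for c u using sp.smult_closed[of c u] that by simp
    have "op_sums M s m (\<lambda>_. bernstein k) \<subseteq> C.span S"
    proof (rule op_sums_least)
      fix l P assume l: "l < s" and "P \<in> bernstein k"
      then have "P \<in> xd_span (bernstein_pairs k)" by (simp add: bernstein_eq)
      then show "P \<odot> m l \<in> C.span S"
      proof (induction P rule: xd_span.induct)
        case zero
        then show ?case using sp.zero_closed m_closed[OF l] by (simp add: act_zero_op)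
      next
        case (step P a b c)
        have P: "P \<in> weyl_ops" using step.hyps(1) bernstein_subset by (auto simp: bernstein_eq)
        have o: "op (a, b) \<in> weyl_ops" using op[OF step.hyps(2)] bernstein_subset by blast
        have "(\<lambda>f. P f + (const_op c \<circ> op (a, b)) f) \<odot> m l = P \<odot> m l \<oplus> const_op c \<odot> (op (a, b) \<odot> m l)"
          by (simp only: act_add[OF P weyl_ops.comp[OF weyl_ops.const o] m_closed[OF l]]
              act_comp[OF weyl_ops.const o m_closed[OF l]])
        moreover have "op (a, b) \<odot> m l \<in> C.span S"
          using C.in_own_span[OF SC] step.hyps(2) l by (auto simp: S_def)
        ultimately have "(\<lambda>f. P f + (const_op c \<circ> op (a, b)) f) \<odot> m l \<in> C.span S"
          using spa[OF step.IH sps] by simp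
        then show ?case by (simp add: op_def)
      qed
    qed (use sp.zero_closed sp.subset spa in auto)
    then show "F k \<subseteq> V.span S" unfolding span_eq by (simp only: filt_def)
  qed
  ultimately show ?thesis unfolding V.fin_dim_def by auto
qed

text \<open>\<open>x\<close> has Bernstein degree 1, so all \<open>x\<^sup>a v\<^sub>i\<close> with
  \<open>a \<le> k - j\<close> lie in \<open>F k\<close>: an independent family of length
  \<open>r\<close> forces growth by \<open>r\<close> per level.\<close>

lemma indep_card_le_dim:
  assumes indep: "N.indep r v" and vF: "\<And>i. i < r \<Longrightarrow> v i \<in> F j" and "j \<le> k"
  shows "(k - j + 1) * r \<le> vectorspace.dim class_ring (MC\<lparr>carrier := F k\<rparr>)"
proof -
  interpret V: vectorspace "class_ring :: complex ring" "MC\<lparr>carrier := F k\<rparr>" by (rule F_vectorspace)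
  define I where "I = {..k - j} \<times> {..<r}"
  define y where "y = (\<lambda>t. poly_op (poly_X ^ fst t) \<odot> v (snd t))"
  have yF: "y t \<in> F k" if "t \<in> I" for t
  proof -
    have "y t \<in> F (j + fst t)" unfolding y_def using that vF by (intro F_X_power) (auto simp: I_def)
    moreover have "j + fst t \<le> k" using that \<open>j \<le> k\<close> by (auto simp: I_def)
    ultimately show ?thesis using F_mono by blast
  qed
  have yM: "y t \<in> carrier M" if "t \<in> I" for t using yF[OF that] F_subset by blast
  have I: "finite I" "I \<subseteq> UNIV \<times> {..<r}" by (auto simp: I_def)
  have inj: "inj_on y I"
  proof
    fix t t' assume t: "t \<in> I" "t' \<in> I" "y t = y t'"
    show "t = t'"
    proof (rule ccontr)
      assume "t \<noteq> t'"
      \<comment> \<open>Two equal vectors at different indices would satisfy the relation with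
        coefficients 1 and -1.\<close>
      let ?z = "\<lambda>t''. if t'' = t then 1 else - 1 :: complex"
      have cy: "const_op c \<odot> y t'' \<in> carrier M" if "t'' \<in> I" for c t''
        by (intro act_closed weyl_ops.const yM that)
      have "(\<Oplus>\<^bsub>MC\<^esub>t\<in>{t, t'}. const_op (?z t) \<odot> y t) = const_op (?z t) \<odot> y t \<oplus> (\<Oplus>\<^bsub>MC\<^esub>t\<in>{t'}. const_op (?z t) \<odot> y t)"
        using cy t(1,2) \<open>t \<noteq> t'\<close> by (subst C.finsum_insert) auto
      also have "(\<Oplus>\<^bsub>MC\<^esub>t\<in>{t'}. const_op (?z t) \<odot> y t) = const_op (?z t') \<odot> y t'"
        using cy t(1,2) by (subst C.finsum_insert) auto
      also have "const_op (?z t) \<odot> y t \<oplus> const_op (?z t') \<odot> y t' = const_op 1 \<odot> y t \<oplus> const_op (- 1) \<odot> y t"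
        using t(3) \<open>t \<noteq> t'\<close> by simp
      also have "\<dots> = \<zero>"
        using C.smult_l_distr[of 1 "- 1" "y t"] C.smult_l_null[of "y t"] yM[OF t(1)] by simp
      finally have "\<forall>t''\<in>{t, t'}. ?z t'' = 0"
        using I t unfolding y_def by (intro monomials_independent[OF indep]) auto
      then show False by auto
    qed
  qed
  have yI: "y ` I \<subseteq> F k" using yF by blast
  have yC: "y ` I \<subseteq> carrier MC" using yM by auto
  have "C.lin_indpt (y ` I)"
  proof (rule C.finite_lin_indpt2)
    fix a assume "C.lincomb a (y ` I) = \<zero>\<^bsub>MC\<^esub>"
    moreover have "C.lincomb a (y ` I) = (\<Oplus>\<^bsub>MC\<^esub>t\<in>I. const_op (a (y t)) \<odot> y t)"
      unfolding C.lincomb_def using yM inj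
      by (subst C.finsum_reindex) (auto intro!: act_closed weyl_ops.const)
    ultimately have "\<forall>t\<in>I. a (y t) = 0"
      unfolding y_def by (intro monomials_independent[OF indep I]) simp
    then show "\<forall>v\<in>y ` I. a v = \<zero>\<^bsub>class_ring\<^esub>" by auto
  qed (use I yC in auto)
  then have "V.lin_indpt (y ` I)" using C.span_li_not_depend(2)[OF yI F_subspace] by simp
  then have "card (y ` I) \<le> V.dim" using V.li_le_dim(2)[OF F_fin_dim] yI by simp
  then show ?thesis using card_image[OF inj] by (simp add: I_def)
qed

end

text \<open>Growth by \<open>r\<close> per level against a Hilbert polynomial
  \<open>c0 + c1 k\<close> gives \<open>r \<le> c1\<close>. In the zero module, the relation with
  all coefficients 1 rules out nonempty independent families.\<close>

lemma holonomic_imp_finite_rank: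
  assumes "carrier M = {\<zero>} \<or> has_bernstein_dim M 1"
  shows "\<exists>n b. finite_rank_module poly_mod n b"
proof -
  have "\<exists>B. \<forall>r v. N.indep r v \<longrightarrow> r \<le> B"
    using assms
  proof
    assume 0: "carrier M = {\<zero>}"
    have "r \<le> 0" if "N.indep r v" for r v
    proof -
      have "N.lc r (\<lambda>_. 1) v \<in> carrier M"
        using N.lc_closed[of r v "\<lambda>_. 1"] that by (auto simp: N.indep_def)
      then have "N.lc r (\<lambda>_. 1) v = \<zero>" using 0 by simp
      then have "\<forall>i<r. (1 :: complex poly) = 0" using that by (auto simp: N.indep_def dest!: spec[of _ "\<lambda>_. 1"])
      then show ?thesis by (cases r) auto
    qed
    then show ?thesis by blast
  next
    assume "has_bernstein_dim M 1"
    then obtain s m h where gens: "generates M s m" and h: "degree h = 1"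
      and ev: "\<forall>\<^sub>F k in sequentially. of_nat (vectorspace.dim class_ring (MC\<lparr>carrier := filt s m k\<rparr>)) = poly h (of_nat k :: rat)"
      unfolding has_bernstein_dim_def filt_def by blast
    obtain K where K: "\<And>k. k \<ge> K \<Longrightarrow> of_nat (vectorspace.dim class_ring (MC\<lparr>carrier := filt s m k\<rparr>)) = poly h (of_nat k :: rat)"
      using ev unfolding eventually_sequentially by blast
    define c0 c1 where "c0 = coeff h 0" and "c1 = coeff h 1"
    have h_eq: "poly h x = c0 + c1 * x" for x
      using h by (simp add: poly_altdef c0_def c1_def)
    have "r \<le> nat \<lfloor>c1\<rfloor>" if rv: "N.indep r v" for r v
    proof -
      have "\<exists>j. \<forall>i\<in>{..<r}. v i \<in> filt s m j"
        by (rule common_bound) (use rv F_exhausts[OF gens] in \<open>auto simp: N.indep_def elim: subsetD[OF F_mono[OF gens], rotated]\<close>)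
      then obtain j where vj: "\<And>i. i < r \<Longrightarrow> v i \<in> filt s m j" by blast
      have "of_nat r \<le> c1"
      proof (rule ccontr)
        assume "\<not> of_nat r \<le> c1"
        then have pos: "of_nat r - c1 > 0" by simp
        \<comment> \<open>If \<open>r > c1\<close>, the resulting bound
          \<open>(r - c1) k \<le> c0 + r j - r\<close> fails as soon as \<open>k\<close> exceeds
          this quotient.\<close>
        obtain k1 where k1: "(c0 + of_nat r * of_nat j) / (of_nat r - c1) < of_nat k1"
          using reals_Archimedean2 by blast
        define k where "k = max k1 (max K j)"
        have k: "k \<ge> K" "k \<ge> j" "of_nat k1 \<le> (of_nat k :: rat)" by (auto simp: k_def)
        have "(k - j + 1) * r \<le> vectorspace.dim class_ring (MC\<lparr>carrier := filt s m k\<rparr>)"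
          by (rule indep_card_le_dim[OF gens rv vj k(2)])
        then have "of_nat ((k - j + 1) * r) \<le> (of_nat (vectorspace.dim class_ring (MC\<lparr>carrier := filt s m k\<rparr>)) :: rat)"
          by (simp only: of_nat_le_iff)
        also have "\<dots> = c0 + c1 * of_nat k" using K[OF k(1)] h_eq by simp
        finally have "(of_nat k - of_nat j + 1) * of_nat r \<le> c0 + c1 * of_nat k"
          using k(2) by (simp add: of_nat_diff distrib_right add.commute)
        then have "(of_nat r - c1) * of_nat k \<le> c0 + of_nat r * of_nat j - of_nat r"
          by (simp add: algebra_simps)
        moreover have "c0 + of_nat r * of_nat j < of_nat k * (of_nat r - c1)"
        proof -
          have "(c0 + of_nat r * of_nat j) / (of_nat r - c1) < of_nat k" using k1 k(3) by simp
          then show ?thesis using pos by (simp add: pos_divide_less_eq)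
        qed
        moreover have "(0 :: rat) \<le> of_nat r" by simp
        ultimately show False by (simp add: mult.commute)
      qed
      then show ?thesis by (simp add: le_nat_iff le_floor_iff)
    qed
    then show ?thesis by blast
  qed
  then obtain B where B: "\<forall>r v. N.indep r v \<longrightarrow> r \<le> B" by blast
  have "\<exists>r v. N.indep r v \<and> (\<forall>r' v'. N.indep r' v' \<longrightarrow> r' \<le> r)"
    by (rule N.maximal_indep_exists[of B]) (use B in blast)
  then obtain n b where "N.indep n b" "\<forall>r' v'. N.indep r' v' \<longrightarrow> r' \<le> n" by blast
  then have "finite_rank_module poly_mod n b" by unfold_locales auto
  then show ?thesis by blast
qed

end

theorem theorem4p2:
  fixes M :: "'m weyl_module" and U :: "int \<Rightarrow> 'm set"
  assumes "holonomic M"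
    and "V_good_filtration M U"
  shows "regular_at_0 M \<longleftrightarrow> rank (gr M U) = rank M"
proof -
  have M: "left_module weyl M" "carrier M = {\<zero>\<^bsub>M\<^esub>} \<or> has_bernstein_dim M 1"
    using assms(1) by (auto simp: holonomic_def)
  interpret weyl_mod M using M(1) by (simp add: weyl_mod_def)
  obtain n b where nb: "finite_rank_module poly_mod n b" using holonomic_imp_finite_rank[OF M(2)] by blast
  obtain s m e where sme: "generates M s m" "\<And>k. U k = op_sums M s m (\<lambda>l. V_weyl (k - e l))"
    using assms(2) by (auto simp: V_good_filtration_def)
  interpret V_filtered_module M U s m e
    by unfold_locales (use sme in \<open>auto simp: generates_def\<close>)
  interpret N: finite_rank_module poly_mod n b by (rule nb)
  interpret finite_rank_V_module M U s m e n b ..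
  show ?thesis by (rule regular_iff_rank_eq)
qed

end
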